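(* For all $\vec{x}=(a,b,c,d,e,f,g)^T\in V$ we have the relation $$\sin\pi a\,\sin\pi(f-e)\sin\pi(g-c)\sin\pi(g-d)\,\beta(\sigma\vec{x})K_{p_0}(\vec{x})+\gamma((56)\vec{x})\beta(\vec{x})K_{n_4}(\vec{x})-\gamma(\vec{x})\beta((56)\vec{x})K_{n_8}(\vec{x})=0,$$ where $(56)\vec{x}=(a,b,c,d,f,e,g)^T$ and $$\sigma\vec{x}=(1+b-e,\;b,\;f-c,\;g-c,\;1+a+b-e,\;1+b-c,\;1+b+d-e)^T.$$ This is a $244$ relation, i.e. the triple $(p_0,n_4,n_8)$ has Hamming type $244$.
   Context: Let $V=\{(a,b,c,d,e,f,g)^T\in\mathbb{C}^7 : e+f+g-a-b-c-d=1\}$. With $(u)_k=u(u+1)\cdots(u+k-1)$, $(u)_0=1$, and ${}_4F_3(a,b,c,d;e,f,g;1)=\sum_{k\ge0}\frac{(a)_k(b)_k(c)_k(d)_k}{k!\,(e)_k(f)_k(g)_k}$, define for $\vec{x}=(a,b,c,d,e,f,g)^T\in V$ $$K(\vec{x})=K(a;b,c,d;e,f,g)=\frac{{}_4F_3(a,b,c,d;e,f,g;1)}{\Gamma(e)\Gamma(f)\Gamma(g)\Gamma(1+a-e)\Gamma(1+a-f)\Gamma(1+a-g)}+\frac{{}_4F_3(a,1+a-e,1+a-f,1+a-g;1+a-b,1+a-c,1+a-d;1)}{\Gamma(1+a-b)\Gamma(1+a-c)\Gamma(1+a-d)\Gamma(b)\Gamma(c)\Gamma(d)},$$ where each ${}_4F_3(A,B,C,D;E,F,G;1)/(\Gamma(E)\Gamma(F)\Gamma(G))$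 is read as $\sum_{k\ge0}\frac{(A)_k(B)_k(C)_k(D)_k}{k!\,\Gamma(k+E)\Gamma(k+F)\Gamma(k+G)}$, so $K$ is entire on $V$. Put $$\beta(\vec{x})=\frac{1}{\Gamma(a)\Gamma(1+b-e)\Gamma(f-c)\Gamma(f-d)\Gamma(g-c)\Gamma(g-d)},$$ $$\gamma(\vec{x})=\frac{\sin\pi(e-b)}{\sin\pi(c-b)}\Bigl[\sin\pi(a-c)\sin\pi(e-a-b)\sin\pi(f-b)\sin\pi(g-b)-\sin\pi(a-b)\sin\pi(e-a-c)\sin\pi(f-c)\sin\pi(g-c)\Bigr],$$ with $\gamma$ extended by continuity across its removable singularities $c-b\in\mathbb{Z}$. For an element $\mu$ of the group $M_K$ below, $K_\mu(\vec{x})=K(\mu\vec{x})$. The elements $p_0,n_4,n_8\in M_K$ act on $V$ by $p_0\vec{x}=\vec{x}$, $n_4\vec{x}=(e-a,e-b,e-c,e-d,1+e-f,1+e-g,e)^T$, $n_8\vec{x}=(f-a,f-b,f-c,f-d,1+f-g,f,1+f-e)^T$. Hamming type. Let $S\in GL(7,\mathbb{R})$ be the matrix with rows $(1,0,0,0,0,0,0)$, $(0,0,1,1,0,0,0)$, $(0,1,0,1,0,0,0)$, $(0,1,1,0,0,0,0)$, $(0,1,1,1,1,0,0)$, $(0,1,1,1,0,1,0)$, $(0,1,1,1,0,0,1)$; $P_{1,6}$ the group of $7\times7$ permutation matrices fixing the first coordinate; $G_K=SP_{1,6}S^{-1}$ (under which $K$ is invariant); $M_K\subset GL(7,\mathbb{R})$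 the subgroup generated by $G_K$ and the permutation matrix $(12)$. For $1\le i<j\le6$, $\varepsilon=\pm1$, let $M_6^{\varepsilon}(i,j)$ be the $6\times6$ permutation matrix of the transposition $(i\,j)$ with its two off-diagonal $1$'s replaced by $\varepsilon$. There is a unique injective homomorphism $\theta:M_K\to GL(6,\mathbb{R})$ with $S(i,i+1)S^{-1}\mapsto M_6^{+}(i-1,i)$ for $2\le i\le6$ and $(12)\mapsto M_6^{-}(2,3)$. With $\omega_0=(1,1,1,1,1,1)^T$, the Hamming distance between $\mu,\nu\in M_K$ is the number of coordinates in which $\theta(\mu)^{-1}\omega_0$ and $\theta(\nu)^{-1}\omega_0$ differ (it depends only on the right cosets $G_K\mu,G_K\nu$). The Hamming type of a triple is the list of its three pairwise Hamming distances in nondecreasing order. *)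

theory Defs
  imports "HOL-Analysis.Analysis" "HOL-Algebra.Generated_Groups"
begin

text \<open>
  Vectors and matrices are indexed by the numeral types \<open>6\<close> and \<open>7\<close>, in which \<open>6 = 0\<close>
  and \<open>7 = 0\<close> respectively; the coordinates are written \<open>1, \<dots>, 6\<close> and \<open>1, \<dots>, 7\<close>.
\<close>

section \<open>The functions K, beta and gamma\<close>

definition V :: "(complex^7) set" where
  "V = {x. x$5 + x$6 + x$7 - x$1 - x$2 - x$3 - x$4 = 1}"

text \<open>
  \<open>reg_F43 A B C D E F G\<close> is \<open>\<^sub>4F\<^sub>3(A,B,C,D;E,F,G;1) / (\<Gamma>(E) \<Gamma>(F) \<Gamma>(G))\<close>, in the form that
  is meaningful for all \<open>E\<close>, \<open>F\<close>, \<open>G\<close>. Note that \<^const>\<open>rGamma\<close> is the entire function \<open>1/\<Gamma>\<close>.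
\<close>

definition reg_F43 ::
  "complex \<Rightarrow> complex \<Rightarrow> complex \<Rightarrow> complex \<Rightarrow> complex \<Rightarrow> complex \<Rightarrow> complex \<Rightarrow> complex" where
  "reg_F43 A B C D E F G =
     (\<Sum>k. pochhammer A k * pochhammer B k * pochhammer C k * pochhammer D k / fact k *
          (rGamma (of_nat k + E) * rGamma (of_nat k + F) * rGamma (of_nat k + G)))"

definition K :: "complex^7 \<Rightarrow> complex" where
  "K x = (let a = x$1; b = x$2; c = x$3; d = x$4; e = x$5; f = x$6; g = x$7 in
     reg_F43 a b c d e f g * (rGamma (1 + a - e) * rGamma (1 + a - f) * rGamma (1 + a - g)) +
     reg_F43 a (1 + a - e) (1 + a - f) (1 + a - g) (1 + a - b) (1 + a - c) (1 + a - d) *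
       (rGamma b * rGamma c * rGamma d))"

definition beta :: "complex^7 \<Rightarrow> complex" where
  "beta x = (let a = x$1; b = x$2; c = x$3; d = x$4; e = x$5; f = x$6; g = x$7 in
     rGamma a * rGamma (1 + b - e) * rGamma (f - c) * rGamma (f - d) * rGamma (g - c) * rGamma (g - d))"

definition sinpi :: "complex \<Rightarrow> complex" where
  "sinpi z = sin (of_real pi * z)"

definition gamma_raw :: "complex^7 \<Rightarrow> complex" where
  "gamma_raw x = (let a = x$1; b = x$2; c = x$3; d = x$4; e = x$5; f = x$6; g = x$7 in
     sinpi (e - b) / sinpi (c - b) *
     (sinpi (a - c) * sinpi (e - a - b) * sinpi (f - b) * sinpi (g - b) -
      sinpi (a - b) * sinpi (e - a - c) * sinpi (f - c) * sinpi (g - c)))"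

definition gamma :: "complex^7 \<Rightarrow> complex" where
  "gamma x = (if x$3 - x$2 \<notin> \<int> then gamma_raw x
              else Lim (at x within {y \<in> V. y$3 - y$2 \<notin> \<int>}) gamma_raw)"

section \<open>The groups\<close>

definition GL :: "(real^'n^'n) monoid" where
  "GL = \<lparr>carrier = {A. invertible A}, mult = (**), one = mat 1\<rparr>"

definition perm_matrix :: "('n \<Rightarrow> 'n) \<Rightarrow> real^'n^'n" where
  "perm_matrix p = (\<chi> i j. if p i = j then 1 else 0)"

definition S_mat :: "real^7^7" where
  "S_mat = vector
     [vector [1, 0, 0, 0, 0, 0, 0],
      vector [0, 0, 1, 1, 0, 0, 0],
      vector [0, 1, 0, 1, 0, 0, 0],
      vector [0, 1, 1, 0, 0, 0, 0],
      vector [0, 1, 1, 1, 1, 0, 0],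
      vector [0, 1, 1, 1, 0, 1, 0],
      vector [0, 1, 1, 1, 0, 0, 1]]"

definition P_1_6 :: "(real^7^7) set" where
  "P_1_6 = {perm_matrix p | p. p permutes UNIV \<and> p 1 = 1}"

definition G_K :: "(real^7^7) set" where
  "G_K = (\<lambda>P. S_mat ** P ** matrix_inv S_mat) ` P_1_6"

definition M_K :: "(real^7^7) set" where
  "M_K = generate GL (G_K \<union> {perm_matrix (Transposition.transpose 1 2)})"

definition act :: "real^7^7 \<Rightarrow> complex^7 \<Rightarrow> complex^7" where
  "act A x = map_matrix of_real A *v x"

definition K_sub :: "real^7^7 \<Rightarrow> complex^7 \<Rightarrow> complex" where
  "K_sub A x = K (act A x)"

text \<open>
  An element of \<open>M_K\<close> is determined by its action on \<open>V\<close>, since \<open>V\<close> spans \<open>\<complex>\<^sup>7\<close>.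
\<close>

definition M_K_elt :: "(complex^7 \<Rightarrow> complex^7) \<Rightarrow> real^7^7" where
  "M_K_elt h = (THE A. A \<in> M_K \<and> (\<forall>x\<in>V. act A x = h x))"

definition p0 :: "real^7^7" where
  "p0 = M_K_elt (\<lambda>x. x)"

definition n4 :: "real^7^7" where
  "n4 = M_K_elt (\<lambda>x.
     let a = x$1; b = x$2; c = x$3; d = x$4; e = x$5; f = x$6; g = x$7 in
     vector [e - a, e - b, e - c, e - d, 1 + e - f, 1 + e - g, e])"

definition n8 :: "real^7^7" where
  "n8 = M_K_elt (\<lambda>x.
     let a = x$1; b = x$2; c = x$3; d = x$4; e = x$5; f = x$6; g = x$7 in
     vector [f - a, f - b, f - c, f - d, 1 + f - g, f, 1 + f - e])"

section \<open>Hamming type\<close>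

definition M6 :: "real \<Rightarrow> 6 \<Rightarrow> 6 \<Rightarrow> real^6^6" where
  "M6 \<epsilon> i j = (\<chi> r c. let m = perm_matrix (Transposition.transpose i j) $ r $ c in if r = c then m else \<epsilon> * m)"

definition is_theta :: "(real^7^7 \<Rightarrow> real^6^6) \<Rightarrow> bool" where
  "is_theta \<theta> \<longleftrightarrow>
     \<theta> \<in> hom (GL\<lparr>carrier := M_K\<rparr>) GL \<and> inj_on \<theta> M_K \<and>
     (\<forall>i\<in>{2..6::nat}.
        \<theta> (S_mat ** perm_matrix (Transposition.transpose (of_nat i) (of_nat (i + 1))) ** matrix_inv S_mat) =
        M6 1 (of_nat (i - 1)) (of_nat i)) \<and>
     \<theta> (perm_matrix (Transposition.transpose 1 2)) = M6 (-1) 2 3"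

text \<open>
  These conditions only constrain \<open>\<theta>\<close> on \<open>M_K\<close>; \<^const>\<open>extensional\<close> fixes its values elsewhere.
\<close>

definition theta :: "real^7^7 \<Rightarrow> real^6^6" where
  "theta = (THE \<theta>. is_theta \<theta> \<and> \<theta> \<in> extensional M_K)"

definition omega0 :: "real^6" where
  "omega0 = (\<chi> i. 1)"

definition hamming_dist :: "real^7^7 \<Rightarrow> real^7^7 \<Rightarrow> nat" where
  "hamming_dist \<mu> \<nu> =
     card {i. (matrix_inv (theta \<mu>) *v omega0) $ i \<noteq> (matrix_inv (theta \<nu>) *v omega0) $ i}"

definition hamming_type :: "real^7^7 \<Rightarrow> real^7^7 \<Rightarrow> real^7^7 \<Rightarrow> nat list" where
  "hamming_type \<mu> \<nu> \<rho> = sort [hamming_dist \<mu> \<nu>, hamming_dist \<mu> \<rho>, hamming_dist \<nu> \<rho>]"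


section \<open>The descriptions defining \<open>p0\<close>, \<open>n4\<close>, \<open>n8\<close> and \<open>theta\<close> determine unique objects\<close>

lemma forall_7: "(\<forall>i::7. P i) \<longleftrightarrow> P 1 \<and> P 2 \<and> P 3 \<and> P 4 \<and> P 5 \<and> P 6 \<and> P 7"
proof -
  have "i = 1 \<or> i = 2 \<or> i = 3 \<or> i = 4 \<or> i = 5 \<or> i = 6 \<or> i = 7" for i :: 7
  proof (induct i)
    case (of_int z)
    then have "z \<in> {0..6}" by simp
    also have "{0..6::int} = {0,1,2,3,4,5,6}" by auto
    finally show ?case by auto
  qed
  then show ?thesis by metis
qed

lemma forall_6: "(\<forall>i::6. P i) \<longleftrightarrow> P 1 \<and> P 2 \<and> P 3 \<and> P 4 \<and> P 5 \<and> P 6"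
proof -
  have "i = 1 \<or> i = 2 \<or> i = 3 \<or> i = 4 \<or> i = 5 \<or> i = 6" for i :: 6
  proof (induct i)
    case (of_int z)
    then have "z \<in> {0..5}" by simp
    also have "{0..5::int} = {0,1,2,3,4,5}" by auto
    finally show ?case by auto
  qed
  then show ?thesis by metis
qed

lemma sum_7: "sum f (UNIV::7 set) = f 1 + f 2 + f 3 + f 4 + f 5 + f 6 + f 7"
proof -
  have U: "UNIV = {1, 2, 3, 4, 5, 6, 7::7}" using forall_7[of "\<lambda>i. i \<in> {1, 2, 3, 4, 5, 6, 7}"] by auto
  show ?thesis unfolding U by (simp add: ac_simps)
qed

lemma sum_6: "sum f (UNIV::6 set) = f 1 + f 2 + f 3 + f 4 + f 5 + f 6"
proof -
  have U: "UNIV = {1, 2, 3, 4, 5, 6::6}" using forall_6[of "\<lambda>i. i \<in> {1, 2, 3, 4, 5, 6}"] by auto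
  show ?thesis unfolding U by (simp add: ac_simps)
qed

lemma vector_7 [simp]:
  "(vector [a,b,c,d,e,f,g] :: 'a::zero^7) $ 1 = a"
  "(vector [a,b,c,d,e,f,g] :: 'a::zero^7) $ 2 = b"
  "(vector [a,b,c,d,e,f,g] :: 'a::zero^7) $ 3 = c"
  "(vector [a,b,c,d,e,f,g] :: 'a::zero^7) $ 4 = d"
  "(vector [a,b,c,d,e,f,g] :: 'a::zero^7) $ 5 = e"
  "(vector [a,b,c,d,e,f,g] :: 'a::zero^7) $ 6 = f"
  "(vector [a,b,c,d,e,f,g] :: 'a::zero^7) $ 7 = g"
  unfolding vector_def by simp_all

lemma vector_6 [simp]:
  "(vector [a,b,c,d,e,f] :: 'a::zero^6) $ 1 = a"
  "(vector [a,b,c,d,e,f] :: 'a::zero^6) $ 2 = b"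
  "(vector [a,b,c,d,e,f] :: 'a::zero^6) $ 3 = c"
  "(vector [a,b,c,d,e,f] :: 'a::zero^6) $ 4 = d"
  "(vector [a,b,c,d,e,f] :: 'a::zero^6) $ 5 = e"
  "(vector [a,b,c,d,e,f] :: 'a::zero^6) $ 6 = f"
  unfolding vector_def by simp_all

lemma GL_simps [simp]:
  "A \<in> carrier GL \<longleftrightarrow> invertible A" "A \<otimes>\<^bsub>GL\<^esub> B = A ** B" "\<one>\<^bsub>GL\<^esub> = mat 1"
  by (simp_all add: GL_def)

lemma group_GL: "group (GL :: (real^'n^'n) monoid)"
proof (rule groupI)
  fix A :: "real^'n^'n" assume "A \<in> carrier GL"
  then obtain B where "A ** B = mat 1" "B ** A = mat 1" by (auto simp: invertible_def)
  then show "\<exists>B\<in>carrier GL. B \<otimes>\<^bsub>GL\<^esub> A = \<one>\<^bsub>GL\<^esub>" by (auto simp: invertible_def intro!: bexI[of _ B])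
next
  show "\<one>\<^bsub>GL\<^esub> \<in> carrier (GL :: (real^'n^'n) monoid)"
    by (auto simp: invertible_def intro!: exI[of _ "mat 1"])
qed (auto simp: invertible_mult matrix_mul_assoc)

definition S_inv :: "real^7^7" where
  "S_inv = vector
     [vector [1, 0, 0, 0, 0, 0, 0],
      vector [0, -1/2, 1/2, 1/2, 0, 0, 0],
      vector [0, 1/2, -1/2, 1/2, 0, 0, 0],
      vector [0, 1/2, 1/2, -1/2, 0, 0, 0],
      vector [0, -1/2, -1/2, -1/2, 1, 0, 0],
      vector [0, -1/2, -1/2, -1/2, 0, 1, 0],
      vector [0, -1/2, -1/2, -1/2, 0, 0, 1]]"

lemma S_mat_inv: "S_mat ** S_inv = mat 1" "S_inv ** S_mat = mat 1"
  by (simp_all add: vec_eq_iff forall_7 matrix_matrix_mult_def sum_7 S_mat_def S_inv_def mat_def)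

lemma matrix_inv_S: "matrix_inv S_mat = S_inv"
proof -
  have inv: "S_mat ** matrix_inv S_mat = mat 1 \<and> matrix_inv S_mat ** S_mat = mat 1"
    unfolding matrix_inv_def by (rule someI[of _ S_inv]) (simp add: S_mat_inv)
  have "matrix_inv S_mat = matrix_inv S_mat ** (S_mat ** S_inv)"
    by (simp add: S_mat_inv)
  also have "\<dots> = S_inv"
    using inv by (simp add: matrix_mul_assoc)
  finally show ?thesis .
qed

lemma perm_matrix_mult: "perm_matrix p ** perm_matrix q = perm_matrix (q \<circ> p)"
proof -
  have "(\<Sum>k\<in>UNIV. (if p i = k then 1 else 0) * (if q k = j then 1 else 0)) =
        (if q (p i) = j then 1 else (0::real))" for i j
    by (subst sum.remove[of _ "p i"]) (auto intro!: sum.neutral)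
  then show ?thesis by (simp add: perm_matrix_def matrix_matrix_mult_def vec_eq_iff)
qed

lemma perm_matrix_id: "perm_matrix id = mat 1"
  by (simp add: perm_matrix_def mat_def vec_eq_iff)

lemma invertible_perm_matrix: "p permutes UNIV \<Longrightarrow> invertible (perm_matrix p)"
  unfolding invertible_def
  by (rule exI[of _ "perm_matrix (Hilbert_Choice.inv p)"])
    (simp add: perm_matrix_mult perm_matrix_id permutes_inv_o)

definition conj_S :: "(7 \<Rightarrow> 7) \<Rightarrow> real^7^7" where
  "conj_S p = S_mat ** perm_matrix p ** S_inv"

lemma conj_S_mult: "conj_S p ** conj_S q = conj_S (q \<circ> p)"
proof -
  have "conj_S p ** conj_S q = S_mat ** perm_matrix p ** (S_inv ** S_mat) ** perm_matrix q ** S_inv"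
    by (simp add: conj_S_def matrix_mul_assoc)
  also have "\<dots> = S_mat ** (perm_matrix p ** perm_matrix q) ** S_inv"
    by (simp add: S_mat_inv matrix_mul_assoc)
  finally show ?thesis
    by (simp add: conj_S_def perm_matrix_mult)
qed

lemma invertible_conj_S: "p permutes UNIV \<Longrightarrow> invertible (conj_S p)"
proof -
  assume "p permutes UNIV"
  moreover have "invertible S_mat" "invertible S_inv"
    using S_mat_inv by (auto simp: invertible_def)
  ultimately show ?thesis by (simp add: conj_S_def invertible_mult invertible_perm_matrix)
qed

lemma G_K_eq: "G_K = {conj_S p | p. p permutes UNIV \<and> p 1 = 1}"
  by (auto simp: G_K_def P_1_6_def conj_S_def matrix_inv_S)

lemma M_gens: "G_K \<union> {perm_matrix (Transposition.transpose 1 2)} \<subseteq> carrier GL"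
  by (auto simp: G_K_eq invertible_conj_S intro!: invertible_perm_matrix permutes_swap_id)

lemma M_K_subgroup: "subgroup M_K GL"
  unfolding M_K_def by (rule group.generate_is_subgroup[OF group_GL M_gens])

lemma M_K_mult: "A \<in> M_K \<Longrightarrow> B \<in> M_K \<Longrightarrow> A ** B \<in> M_K"
  using subgroup.m_closed[OF M_K_subgroup] by simp

lemma M_K_invertible: "A \<in> M_K \<Longrightarrow> invertible A"
  using subgroup.subset[OF M_K_subgroup] by auto

lemma conj_S_in_M_K: "p permutes UNIV \<Longrightarrow> p 1 = 1 \<Longrightarrow> conj_S p \<in> M_K"
  unfolding M_K_def by (rule generate.incl) (auto simp: G_K_eq)

lemma swap_in_M_K: "perm_matrix (Transposition.transpose 1 2) \<in> M_K"
  unfolding M_K_def by (rule generate.incl) auto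

lemma act_mult: "act (A ** B) x = act A (act B x)"
proof -
  have "map_matrix of_real (A ** B) = map_matrix of_real A ** (map_matrix of_real B :: complex^7^7)"
    by (simp add: vec_eq_iff matrix_matrix_mult_def)
  then show ?thesis by (simp add: act_def matrix_vector_mul_assoc)
qed

lemma act_one: "act (mat 1) x = x"
proof -
  have "map_matrix of_real (mat 1) = (mat 1 :: complex^7^7)"
    by (simp add: vec_eq_iff mat_def)
  then show ?thesis by (simp add: act_def)
qed

lemma act_perm_matrix: "act (perm_matrix p) x = (\<chi> i. x $ p i)"
proof -
  have "(\<Sum>j\<in>UNIV. of_real (if p i = j then 1 else 0) * x $ j) = x $ p i" for i
    by (subst sum.remove[of _ "p i"]) (auto intro!: sum.neutral)
  then show ?thesis by (simp add: act_def perm_matrix_def matrix_vector_mult_def vec_eq_iff)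
qed

lemma act_conj_S: "act (conj_S p) x = act S_mat (\<chi> i. act S_inv x $ p i)"
  by (simp add: conj_S_def act_mult act_perm_matrix)

lemma act_eq_on_V:
  assumes "\<forall>x\<in>V. act A x = act B x"
  shows "A = B"
proof -
  define x0 :: "complex^7" where "x0 = vector [0,0,0,0,1,0,0]"
  have x0: "x0 \<in> V" by (simp add: V_def x0_def)
  have "act A y = act B y" for y
  proof -
    define t where "t = y$5 + y$6 + y$7 - y$1 - y$2 - y$3 - y$4"
    have *: "act C (u + s *s w) = act C u + s *s act C w" for C s u w
      by (simp add: act_def vector_scalar_commute matrix_vector_right_distrib)
    have "y + (1 - t) *s x0 \<in> V"
      by (simp add: V_def x0_def t_def algebra_simps)
    then have "act A (y + (1 - t) *s x0) = act B (y + (1 - t) *s x0)" "act A x0 = act B x0"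
      using assms x0 by auto
    then show ?thesis by (simp only: *) simp
  qed
  then have "(map_matrix of_real A :: complex^7^7) = map_matrix of_real B"
    unfolding act_def by (metis matrix_eq)
  then show ?thesis by (simp add: vec_eq_iff)
qed

lemma M_K_elt_eqI: "A \<in> M_K \<Longrightarrow> (\<And>x. x \<in> V \<Longrightarrow> act A x = h x) \<Longrightarrow> M_K_elt h = A"
  unfolding M_K_elt_def by (rule the_equality) (auto intro!: act_eq_on_V)

lemma p0_eq: "p0 = mat 1"
  unfolding p0_def
  using subgroup.one_closed[OF M_K_subgroup] by (intro M_K_elt_eqI) (auto simp: act_one)

abbreviation "gS i j \<equiv> conj_S (Transposition.transpose i j)"

lemma gS_in_M_K: "i \<noteq> 1 \<Longrightarrow> j \<noteq> 1 \<Longrightarrow> gS i j \<in> M_K"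
  by (rule conj_S_in_M_K) (auto simp: permutes_swap_id Transposition.transpose_def)

lemmas act_simps = act_def matrix_vector_mult_def sum_7 S_mat_def S_inv_def

lemma act_gens:
  "act (gS 2 3) x = vector [x$1, x$3, x$2, x$4, x$5, x$6, x$7]"
  "act (gS 3 4) x = vector [x$1, x$2, x$4, x$3, x$5, x$6, x$7]"
  "act (gS 4 5) x = vector [x$1, x$5 - x$3, x$5 - x$2, x$4, x$5, x$5 + x$6 - x$2 - x$3, x$5 + x$7 - x$2 - x$3]"
  "act (gS 5 6) x = vector [x$1, x$2, x$3, x$4, x$6, x$5, x$7]"
  "act (gS 6 7) x = vector [x$1, x$2, x$3, x$4, x$5, x$7, x$6]"
  "act (perm_matrix (Transposition.transpose 1 2)) x = vector [x$2, x$1, x$3, x$4, x$5, x$6, x$7]"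
  unfolding act_conj_S act_perm_matrix
  by (simp_all add: vec_eq_iff forall_7 act_simps Transposition.transpose_def field_simps)

lemma n4_spec:
  "n4 \<in> M_K"
  "vector [a, b, c, d, e, f, g] \<in> V \<Longrightarrow>
     act n4 (vector [a, b, c, d, e, f, g]) = vector [e - a, e - b, e - c, e - d, 1 + e - f, 1 + e - g, e]"
proof -
  define s where "s = perm_matrix (Transposition.transpose (1::7) 2)"
  define A where "A = gS 2 3 ** gS 3 4 ** gS 5 6 ** gS 6 7 ** gS 5 6 ** s ** gS 2 3 ** gS 4 5 ** gS 3 4 ** s ** gS 4 5"
  have A: "A \<in> M_K" unfolding A_def s_def by (intro M_K_mult gS_in_M_K swap_in_M_K) auto
  have act: "act A x = vector [x$5 - x$1, x$5 - x$2, x$5 - x$3, x$5 - x$4, 1 + x$5 - x$6, 1 + x$5 - x$7, x$5]"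
    if "x \<in> V" for x
  proof -
    have "x$7 = 1 + x$1 + x$2 + x$3 + x$4 - x$5 - x$6" using that by (simp add: V_def algebra_simps)
    then show ?thesis by (simp add: A_def s_def act_mult act_gens) (simp add: vec_eq_iff forall_7)
  qed
  have eq: "n4 = A" unfolding n4_def by (rule M_K_elt_eqI) (simp_all add: A act Let_def)
  show "n4 \<in> M_K" by (simp add: eq A)
  show "vector [a, b, c, d, e, f, g] \<in> V \<Longrightarrow>
     act n4 (vector [a, b, c, d, e, f, g]) = vector [e - a, e - b, e - c, e - d, 1 + e - f, 1 + e - g, e]"
    by (simp add: eq act)
qed

lemma n8_spec:
  "n8 \<in> M_K"
  "vector [a, b, c, d, e, f, g] \<in> V \<Longrightarrow>
     act n8 (vector [a, b, c, d, e, f, g]) = vector [f - a, f - b, f - c, f - d, 1 + f - g, f, 1 + f - e]"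
proof -
  define s where "s = perm_matrix (Transposition.transpose (1::7) 2)"
  define A where "A = gS 2 3 ** gS 3 4 ** gS 5 6 ** s ** gS 2 3 ** gS 4 5 ** gS 3 4 ** s ** gS 4 5 ** gS 5 6"
  have A: "A \<in> M_K" unfolding A_def s_def by (intro M_K_mult gS_in_M_K swap_in_M_K) auto
  have act: "act A x = vector [x$6 - x$1, x$6 - x$2, x$6 - x$3, x$6 - x$4, 1 + x$6 - x$7, x$6, 1 + x$6 - x$5]"
    if "x \<in> V" for x
  proof -
    have "x$7 = 1 + x$1 + x$2 + x$3 + x$4 - x$5 - x$6" using that by (simp add: V_def algebra_simps)
    then show ?thesis by (simp add: A_def s_def act_mult act_gens) (simp add: vec_eq_iff forall_7)
  qed
  have eq: "n8 = A" unfolding n8_def by (rule M_K_elt_eqI) (simp_all add: A act Let_def)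
  show "n8 \<in> M_K" by (simp add: eq A)
  show "vector [a, b, c, d, e, f, g] \<in> V \<Longrightarrow>
     act n8 (vector [a, b, c, d, e, f, g]) = vector [f - a, f - b, f - c, f - d, 1 + f - g, f, 1 + f - e]"
    by (simp add: eq act)
qed

text \<open>
  As a representation of \<open>M_K\<close>, \<open>\<real>\<^sup>7\<close> is the sum of the fixed line spanned by \<open>fix_v\<close> and the
  kernel of the invariant functional \<open>fix_l\<close>; \<open>theta\<close> is the action on the latter, in the basis
  formed by the columns of \<open>theta_R\<close>.
\<close>

definition fix_v :: "real^7" where "fix_v = vector [1/2, 1/2, 1/2, 1/2, 1, 1, 1]"
definition fix_l :: "real^7" where "fix_l = vector [-1, -1, -1, -1, 1, 1, 1]"

definition theta_R :: "real^6^7" where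
  "theta_R = vector
     [vector [-1/2, -1/2, -1/2, -1/2, -1/2, -1/2],
      vector [-1/2, 1/2, 1/2, -1/2, -1/2, -1/2],
      vector [1/2, -1/2, 1/2, -1/2, -1/2, -1/2],
      vector [1/2, 1/2, -1/2, -1/2, -1/2, -1/2],
      vector [0, 0, 0, 0, -1, -1],
      vector [0, 0, 0, -1, 0, -1],
      vector [0, 0, 0, -1, -1, 0]]"

definition theta_Q :: "real^7^6" where
  "theta_Q = vector
     [vector [-1/2, -1/2, 1/2, 1/2, 0, 0, 0],
      vector [-1/2, 1/2, -1/2, 1/2, 0, 0, 0],
      vector [-1/2, 1/2, 1/2, -1/2, 0, 0, 0],
      vector [-1/2, -1/2, -1/2, -1/2, 1, 0, 0],
      vector [-1/2, -1/2, -1/2, -1/2, 0, 1, 0],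
      vector [-1/2, -1/2, -1/2, -1/2, 0, 0, 1]]"

definition fix_D :: "real^7^7" where "fix_D = (\<chi> i j. fix_v $ i * fix_l $ j)"

lemma theta_QR: "theta_Q ** theta_R = mat 1"
  by (simp add: vec_eq_iff forall_6 matrix_matrix_mult_def sum_7 theta_Q_def theta_R_def mat_def)

lemma theta_RQ: "theta_R ** theta_Q = mat 1 - fix_D"
  by (simp add: vec_eq_iff forall_7 matrix_matrix_mult_def sum_6 theta_Q_def theta_R_def mat_def
      fix_D_def fix_v_def fix_l_def)

lemma fix_D_perm:
  assumes "p permutes UNIV" "p 1 = 1"
  shows "S_inv ** fix_D ** S_mat ** perm_matrix p = S_inv ** fix_D ** S_mat"
    and "perm_matrix p ** (S_inv ** fix_D ** S_mat) = S_inv ** fix_D ** S_mat"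
proof -
  define w :: "real^7" where "w = (\<chi> i. if i = 1 then 1/2 else 1/4)"
  define m :: "real^7" where "m = (\<chi> i. if i = 1 then -1 else 1)"
  have "S_inv ** fix_D = (\<chi> i j. w $ i * fix_l $ j)"
    by (simp add: vec_eq_iff matrix_matrix_mult_def fix_D_def flip: sum_distrib_right mult.assoc)
      (simp add: forall_7 sum_7 S_inv_def fix_v_def w_def)
  moreover have "(\<chi> i j. w $ i * fix_l $ j) ** S_mat = (\<chi> i j. w $ i * m $ j)"
    by (simp add: vec_eq_iff matrix_matrix_mult_def mult.assoc flip: sum_distrib_left)
      (simp add: forall_7 sum_7 S_mat_def fix_l_def m_def)
  ultimately have D: "S_inv ** fix_D ** S_mat = (\<chi> i j. w $ i * m $ j)"
    by simp
  have p1: "p i = 1 \<longleftrightarrow> i = 1" for i using injD[OF permutes_inj[OF assms(1)], of i 1] assms(2) by auto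
  have ex: "\<exists>k. p k = j" for j using permutes_surj[OF assms(1)] by (metis surjD)
  have "(\<Sum>k\<in>UNIV. (if p i = k then 1 else 0) * (w $ k * m $ j)) = w $ i * m $ j" for i j
    by (subst sum.remove[of _ "p i"]) (auto intro!: sum.neutral simp: w_def p1)
  then show "perm_matrix p ** (S_inv ** fix_D ** S_mat) = S_inv ** fix_D ** S_mat"
    unfolding D by (simp add: perm_matrix_def matrix_matrix_mult_def vec_eq_iff)
  have "(\<Sum>k\<in>UNIV. (w $ i * m $ k) * (if p k = j then 1 else 0)) = w $ i * m $ j" for i j
  proof -
    obtain k where k: "p k = j" using ex by blast
    have *: "p k' = j \<longleftrightarrow> k' = k" for k'
      using injD[OF permutes_inj[OF assms(1)], of k' k] k by auto
    have "m $ k = m $ j"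
      using k p1[of k] by (auto simp: m_def)
    then show ?thesis
      by (simp add: * if_distrib cong: if_cong)
  qed
  then show "S_inv ** fix_D ** S_mat ** perm_matrix p = S_inv ** fix_D ** S_mat"
    unfolding D by (simp add: perm_matrix_def matrix_matrix_mult_def vec_eq_iff)
qed

lemma fix_D_gens:
  assumes "A \<in> G_K \<union> {perm_matrix (Transposition.transpose 1 2)}"
  shows "fix_D ** A = fix_D" and "A ** fix_D = fix_D"
proof -
  have "fix_D ** conj_S p = fix_D \<and> conj_S p ** fix_D = fix_D" if p: "p permutes UNIV" "p 1 = 1" for p
  proof -
    have *: "fix_D ** S_mat ** S_inv = fix_D"
      by (simp add: S_mat_inv flip: matrix_mul_assoc)
    have E: "S_mat ** (S_inv ** fix_D ** S_mat) ** S_inv = fix_D"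
      by (simp add: * S_mat_inv matrix_mul_assoc)
    have "fix_D ** conj_S p = S_mat ** (S_inv ** fix_D ** S_mat ** perm_matrix p) ** S_inv"
      by (simp add: S_mat_inv conj_S_def matrix_mul_assoc)
    moreover have "S_mat ** perm_matrix p ** S_inv ** fix_D =
        S_mat ** perm_matrix p ** S_inv ** (fix_D ** S_mat ** S_inv)"
      by (simp add: *)
    then have "conj_S p ** fix_D = S_mat ** (perm_matrix p ** (S_inv ** fix_D ** S_mat)) ** S_inv"
      by (simp add: conj_S_def matrix_mul_assoc)
    ultimately show ?thesis using fix_D_perm[OF p] E by simp
  qed
  moreover have "fix_D ** perm_matrix (Transposition.transpose 1 2) = fix_D"
    "perm_matrix (Transposition.transpose 1 2) ** fix_D = fix_D"
    by (simp_all add: vec_eq_iff forall_7 matrix_matrix_mult_def sum_7 fix_D_def fix_v_def fix_l_def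
        perm_matrix_def Transposition.transpose_def)
  ultimately show "fix_D ** A = fix_D" "A ** fix_D = fix_D"
    using assms by (auto simp: G_K_eq)
qed

lemma GL_m_inv:
  assumes "invertible A"
  shows "A ** inv\<^bsub>GL\<^esub> A = mat 1" "inv\<^bsub>GL\<^esub> A ** A = mat 1"
  using group.r_inv[OF group_GL, of A] group.l_inv[OF group_GL, of A] assms by simp_all

lemma fix_D_M_K: "A \<in> M_K \<Longrightarrow> fix_D ** A = fix_D \<and> A ** fix_D = fix_D"
  unfolding M_K_def
proof (induction rule: generate.induct)
  case (inv h)
  then have h: "invertible h" using M_gens by auto
  have "fix_D ** inv\<^bsub>GL\<^esub> h = fix_D ** h ** inv\<^bsub>GL\<^esub> h"
    by (simp add: fix_D_gens[OF inv])
  also have "\<dots> = fix_D"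
    by (simp add: GL_m_inv[OF h] flip: matrix_mul_assoc)
  finally have "fix_D ** inv\<^bsub>GL\<^esub> h = fix_D" .
  moreover have "inv\<^bsub>GL\<^esub> h ** fix_D = inv\<^bsub>GL\<^esub> h ** (h ** fix_D)"
    by (simp add: fix_D_gens[OF inv])
  then have "inv\<^bsub>GL\<^esub> h ** fix_D = fix_D"
    by (simp add: GL_m_inv[OF h] matrix_mul_assoc)
  ultimately show ?case ..
next
  case (eng h1 h2)
  have "fix_D ** (h1 ** h2) = fix_D ** h1 ** h2" "(h1 ** h2) ** fix_D = h1 ** (h2 ** fix_D)"
    by (simp_all only: matrix_mul_assoc)
  with eng show ?case by simp
qed (use fix_D_gens in auto)

lemma matrix_sub_distrib:
  fixes A :: "real^'n^'m" and B C :: "real^'k^'n" and A' B' :: "real^'n^'m"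
  shows "A ** (B - C) = A ** B - A ** C" "(A' - B') ** C = A' ** C - B' ** C"
  by (simp_all add: vec_eq_iff matrix_matrix_mult_def algebra_simps sum_subtractf)

lemma theta_mult:
  assumes "A \<in> M_K"
  shows "theta_Q ** A ** theta_R ** (theta_Q ** B ** theta_R) = theta_Q ** (A ** B) ** theta_R"
proof -
  have "theta_Q ** fix_D = 0"
    by (simp add: vec_eq_iff forall_6 forall_7 matrix_matrix_mult_def sum_7 theta_Q_def
        fix_D_def fix_v_def fix_l_def)
  then have "theta_Q ** (A ** fix_D) = 0" using fix_D_M_K[OF assms] by simp
  have "theta_Q ** A ** theta_R ** (theta_Q ** B ** theta_R) =
      theta_Q ** (A ** (theta_R ** theta_Q)) ** B ** theta_R"
    by (simp add: matrix_mul_assoc)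
  also have "theta_Q ** (A ** (theta_R ** theta_Q)) = theta_Q ** A"
    unfolding theta_RQ using \<open>theta_Q ** (A ** fix_D) = 0\<close>
    by (simp add: matrix_sub_distrib)
  finally show ?thesis by (simp add: matrix_mul_assoc)
qed


lemma theta_gens:
  "theta_Q ** gS 2 3 ** theta_R = M6 1 1 2"
  "theta_Q ** gS 3 4 ** theta_R = M6 1 2 3"
  "theta_Q ** gS 4 5 ** theta_R = M6 1 3 4"
  "theta_Q ** gS 5 6 ** theta_R = M6 1 4 5"
  "theta_Q ** gS 6 7 ** theta_R = M6 1 5 6"
  "theta_Q ** perm_matrix (Transposition.transpose 1 2) ** theta_R = M6 (-1) 2 3"
proof -
  define QS :: "real^7^6" where "QS = vector
     [vector [-1/2, 1, 0, 0, 0, 0, 0],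
      vector [-1/2, 0, 1, 0, 0, 0, 0],
      vector [-1/2, 0, 0, 1, 0, 0, 0],
      vector [-1/2, 0, 0, 0, 1, 0, 0],
      vector [-1/2, 0, 0, 0, 0, 1, 0],
      vector [-1/2, 0, 0, 0, 0, 0, 1]]"
  define SR :: "real^6^7" where "SR = vector
     [vector [-1/2, -1/2, -1/2, -1/2, -1/2, -1/2],
      vector [3/4, -1/4, -1/4, -1/4, -1/4, -1/4],
      vector [-1/4, 3/4, -1/4, -1/4, -1/4, -1/4],
      vector [-1/4, -1/4, 3/4, -1/4, -1/4, -1/4],
      vector [-1/4, -1/4, -1/4, 3/4, -1/4, -1/4],
      vector [-1/4, -1/4, -1/4, -1/4, 3/4, -1/4],
      vector [-1/4, -1/4, -1/4, -1/4, -1/4, 3/4]]"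
  have QS: "theta_Q ** S_mat = QS"
    by (simp add: vec_eq_iff forall_6 forall_7 matrix_matrix_mult_def sum_7 theta_Q_def S_mat_def QS_def)
  have SR: "S_inv ** theta_R = SR"
    by (simp add: vec_eq_iff forall_6 forall_7 matrix_matrix_mult_def sum_7 theta_R_def S_inv_def SR_def)
  have *: "theta_Q ** conj_S p ** theta_R = QS ** (perm_matrix p ** SR)" for p
    unfolding QS[symmetric] SR[symmetric] by (simp add: conj_S_def matrix_mul_assoc)
  have P: "perm_matrix p ** SR = (\<chi> i j. SR $ p i $ j)" for p
  proof -
    have "(\<Sum>k\<in>UNIV. (if p i = k then 1 else 0) * SR $ k $ j) = SR $ p i $ j" for i j
      by (subst sum.remove[of _ "p i"]) (auto intro!: sum.neutral)
    then show ?thesis by (simp add: perm_matrix_def matrix_matrix_mult_def vec_eq_iff)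
  qed
  show
    "theta_Q ** gS 2 3 ** theta_R = M6 1 1 2"
    "theta_Q ** gS 3 4 ** theta_R = M6 1 2 3"
    "theta_Q ** gS 4 5 ** theta_R = M6 1 3 4"
    "theta_Q ** gS 5 6 ** theta_R = M6 1 4 5"
    "theta_Q ** gS 6 7 ** theta_R = M6 1 5 6"
    unfolding * P
    by (simp_all add: vec_eq_iff forall_6 matrix_matrix_mult_def sum_7 QS_def SR_def
        perm_matrix_def M6_def Transposition.transpose_def)
  show "theta_Q ** perm_matrix (Transposition.transpose 1 2) ** theta_R = M6 (-1) 2 3"
    by (simp add: vec_eq_iff forall_6 matrix_matrix_mult_def sum_7 theta_Q_def theta_R_def
        perm_matrix_def M6_def Transposition.transpose_def)
qed

lemma is_theta_iff:
  "is_theta \<theta> \<longleftrightarrow>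
     \<theta> \<in> hom (GL\<lparr>carrier := M_K\<rparr>) GL \<and> inj_on \<theta> M_K \<and>
     \<theta> (gS 2 3) = M6 1 1 2 \<and> \<theta> (gS 3 4) = M6 1 2 3 \<and> \<theta> (gS 4 5) = M6 1 3 4 \<and>
     \<theta> (gS 5 6) = M6 1 4 5 \<and> \<theta> (gS 6 7) = M6 1 5 6 \<and>
     \<theta> (perm_matrix (Transposition.transpose 1 2)) = M6 (-1) 2 3"
proof -
  have *: "{2..6::nat} = {2, 3, 4, 5, 6}" by auto
  show ?thesis
    unfolding is_theta_def * matrix_inv_S conj_S_def by (auto simp del: One_nat_def)
qed

lemma is_theta_theta_QR: "is_theta (\<lambda>A\<in>M_K. theta_Q ** A ** theta_R)"
proof -
  have inv: "invertible (theta_Q ** A ** theta_R)" if A: "A \<in> M_K" for A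
  proof -
    let ?B = "inv\<^bsub>GL\<^esub> A"
    have B: "?B \<in> M_K" by (rule subgroup.m_inv_closed[OF M_K_subgroup A])
    have "A ** ?B = mat 1" "?B ** A = mat 1" using GL_m_inv M_K_invertible[OF A] by auto
    then show ?thesis
      unfolding invertible_def
      by (intro exI[of _ "theta_Q ** ?B ** theta_R"]) (simp add: theta_mult A B theta_QR)
  qed
  have inj: "inj_on (\<lambda>A. theta_Q ** A ** theta_R) M_K"
  proof (rule inj_onI)
    have *: "theta_R ** (theta_Q ** A ** theta_R) ** theta_Q = A - fix_D" if "A \<in> M_K" for A
    proof -
      have DD: "fix_D ** fix_D = fix_D"
        by (simp add: vec_eq_iff forall_7 matrix_matrix_mult_def sum_7 fix_D_def fix_v_def fix_l_def)
      have "theta_R ** (theta_Q ** A ** theta_R) ** theta_Q =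
          (theta_R ** theta_Q) ** A ** (theta_R ** theta_Q)"
        by (simp add: matrix_mul_assoc)
      also have "\<dots> = A - fix_D"
        unfolding theta_RQ using fix_D_M_K[OF that]
        by (simp add: matrix_sub_distrib DD)
      finally show ?thesis .
    qed
    fix A B
    assume A: "A \<in> M_K" and B: "B \<in> M_K"
      and eq: "theta_Q ** A ** theta_R = theta_Q ** B ** theta_R"
    have "A - fix_D = B - fix_D"
      using *[OF A] *[OF B] unfolding eq by (rule trans[OF sym])
    then show "A = B" by simp
  qed
  show ?thesis
    unfolding is_theta_iff
    using inj by (simp add: hom_def inv theta_mult M_K_mult gS_in_M_K swap_in_M_K theta_gens)
qed

lemma is_theta_unique:
  assumes "is_theta \<theta>" "is_theta \<theta>'" "A \<in> M_K"
  shows "\<theta> A = \<theta>' A"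
proof -
  define H where "H = {A \<in> M_K. \<theta> A = \<theta>' A}"
  have hom: "\<theta> (A ** B) = \<theta> A ** \<theta> B" "\<theta>' (A ** B) = \<theta>' A ** \<theta>' B"
    if "A \<in> M_K" "B \<in> M_K" for A B
    using assms(1,2) that by (auto simp: is_theta_def hom_def)
  have mult: "A ** B \<in> H" if "A \<in> H" "B \<in> H" for A B
    using that hom by (auto simp: H_def M_K_mult)
  have "group_hom (GL\<lparr>carrier := M_K\<rparr>) GL f" if "is_theta f" for f
    using that group_GL subgroup.subgroup_is_group[OF M_K_subgroup group_GL]
    by (auto simp: group_hom_def group_hom_axioms_def is_theta_def)
  then have hinv: "f (inv\<^bsub>GL\<^esub> B) = inv\<^bsub>GL\<^esub> (f B)" and hone: "f (mat 1) = mat 1"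
    if "is_theta f" "B \<in> M_K" for f B
    using that group_hom.hom_inv[of "GL\<lparr>carrier := M_K\<rparr>" GL f B] group_hom.hom_one[of "GL\<lparr>carrier := M_K\<rparr>" GL f]
      group.m_inv_consistent[OF group_GL M_K_subgroup that(2)] by auto
  have adj: "gS 2 3 \<in> H" "gS 3 4 \<in> H" "gS 4 5 \<in> H" "gS 5 6 \<in> H" "gS 6 7 \<in> H"
    "perm_matrix (Transposition.transpose 1 2) \<in> H"
    using assms(1,2) by (simp_all add: H_def is_theta_iff gS_in_M_K swap_in_M_K)
  have step: "gS i k \<in> H" if "gS i j \<in> H" "gS j k \<in> H" "i \<noteq> j" "i \<noteq> k" "j \<noteq> k" for i j k
  proof -
    have "Transposition.transpose i j \<circ> (Transposition.transpose j k \<circ> Transposition.transpose i j)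
        = Transposition.transpose i k"
      using that(3-) by (auto simp: fun_eq_iff Transposition.transpose_def)
    then have "gS i k = gS i j ** gS j k ** gS i j"
      by (simp add: conj_S_mult comp_assoc)
    then show ?thesis using mult that by simp
  qed
  have idH: "conj_S id \<in> H"
    using hone[OF assms(1) subgroup.one_closed[OF M_K_subgroup]]
      hone[OF assms(2) subgroup.one_closed[OF M_K_subgroup]] subgroup.one_closed[OF M_K_subgroup]
    by (simp add: conj_S_def perm_matrix_id S_mat_inv H_def)
  have a24: "gS 2 4 \<in> H" using step[OF adj(1,2)] by simp
  have a25: "gS 2 5 \<in> H" using step[OF a24 adj(3)] by simp
  have a26: "gS 2 6 \<in> H" using step[OF a25 adj(4)] by simp
  have a27: "gS 2 7 \<in> H" using step[OF a26 adj(5)] by simp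
  have g2: "gS 2 k \<in> H" if "k \<noteq> 1" for k
  proof -
    have "\<forall>k. k \<noteq> 1 \<longrightarrow> gS 2 k \<in> H"
      unfolding forall_7 using a24 a25 a26 a27 adj(1) idH by simp
    then show ?thesis using that by blast
  qed
  have comm: "gS i j = gS j i" for i j by (simp add: Transposition.transpose_commute)
  have gS: "gS i j \<in> H" if "i \<noteq> 1" "j \<noteq> 1" for i j
  proof (cases "i = j \<or> i = 2 \<or> j = 2")
    case True
    then show ?thesis using g2 that idH comm by auto
  next
    case False
    then show ?thesis using step[of i 2 j] g2[OF that(1)] g2[OF that(2)] comm by auto
  qed
  have conj: "conj_S p \<in> H" if "p permutes UNIV" "p 1 = 1" for p
  proof -
    have "p permutes (UNIV - {1})"
      using that by (auto simp: permutes_def)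
    from this finite show ?thesis
    proof (induction p rule: permutes_induct)
      case (swap a b p)
      then have "conj_S p ** gS a b \<in> H"
        by (intro mult gS) auto
      then show ?case by (simp only: conj_S_mult)
    next
      case id
      show ?case by (rule idH)
    qed
  qed
  have "A \<in> H"
    using assms(3) unfolding M_K_def
  proof (induction rule: generate.induct)
    case one
    then show ?case using idH by (simp add: conj_S_def perm_matrix_id S_mat_inv)
  next
    case (incl h)
    then show ?case using conj adj(6) by (auto simp: G_K_eq)
  next
    case (inv h)
    then have h: "h \<in> H" using conj adj(6) by (auto simp: G_K_eq)
    then have "h \<in> M_K" "\<theta> h = \<theta>' h" by (auto simp: H_def)
    then show ?case
      using hinv[OF assms(1)] hinv[OF assms(2)] subgroup.m_inv_closed[OF M_K_subgroup]
      by (simp add: H_def)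
  next
    case (eng h1 h2)
    then show ?case using mult by simp
  qed
  then show ?thesis by (simp add: H_def)
qed

lemma theta_eq: "theta = (\<lambda>A\<in>M_K. theta_Q ** A ** theta_R)"
  unfolding theta_def
proof (rule the_equality)
  fix \<theta> assume *: "is_theta \<theta> \<and> \<theta> \<in> extensional M_K"
  show "\<theta> = (\<lambda>A\<in>M_K. theta_Q ** A ** theta_R)"
    by (rule extensionalityI[of _ M_K]) (use * is_theta_unique[OF _ is_theta_theta_QR] in auto)
qed (simp add: is_theta_theta_QR)

lemma is_theta_theta: "is_theta theta"
  by (simp add: theta_eq is_theta_theta_QR)

end

theory Submission
  imports Defs "HOL-Complex_Analysis.Complex_Analysis" "HOL-Real_Asymp.Real_Asymp"
begin

text \<open>
  The proof rests on two facts. First, put \<open>b = u\<^sub>2 + u\<^sub>3\<close>, \<open>c = u\<^sub>1 + u\<^sub>3\<close>, \<open>d = u\<^sub>1 + u\<^sub>2\<close>,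
  \<open>e = u\<^sub>1 + u\<^sub>2 + u\<^sub>3 + u\<^sub>4\<close>, \<open>f = u\<^sub>1 + u\<^sub>2 + u\<^sub>3 + u\<^sub>5\<close> and \<open>g = u\<^sub>1 + u\<^sub>2 + u\<^sub>3 + u\<^sub>6\<close>;
  then \<open>K\<close> is symmetric in all six variables \<open>u\<^sub>i\<close>. Indeed, for positive \<open>u\<^sub>i\<close> with sum at least 1 it is, up to
  Gamma factors, the integral over \<open>\<sigma> > 0\<close> and \<open>0 < x, y < 1\<close> of a positive function. The regions \<open>y < x\<close> and
  \<open>y > x\<close> give the two series in \<open>K\<close>, whereas integrating over \<open>x\<close> and \<open>y\<close> first gives a product of two
  functions \<open>\<^sub>2F\<^sub>1\<close>, on which the exchange of \<open>u\<^sub>1\<close> and \<open>u\<^sub>5\<close> acts by Euler's transformation. The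
  identity theorem extends the symmetry to complex parameters.

  Secondly, for balanced parameters the sum \<open>E s\<close> over all integers \<open>k\<close> of \<open>T (s + k)\<close>, where
  \<open>T s = \<Prod>\<^sub>i 1 / (\<Gamma> (1 - a\<^sub>i - s) \<Gamma> (e\<^sub>i + s))\<close>, is entire, has period 1 and is
  \<open>o (exp (4 \<pi> \<bar>Im s\<bar>))\<close>. Hence it lies in the three-dimensional space spanned by \<open>1\<close> and
  \<open>exp (\<plusminus> 2 \<pi> \<i> s)\<close>. Its values at \<open>1 - e\<^sub>i\<close> and \<open>- a\<^sub>j\<close> are the series occurring in \<open>K\<close>. After one
  application of the symmetry to each of them, the three functions \<open>K\<close> of the theorem all come from the
  same \<open>E\<close>, and the claim becomes a trigonometric identity.
\<close>

section \<open>Balanced hypergeometric terms\<close>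

text \<open>Taken as they stand, the three functions \<open>K\<close> lead to sums \<open>E\<close>
  with different parameters. The exchange in \<open>Kf_swap\<close> brings all of them, up to a
  shift of \<open>s\<close>, to the list
  \<open>a, b, g - d, g - c; 1, 1 + a + b - f, 1 + a + b - e, g\<close>, which is symmetric in
  \<open>e\<close> and \<open>f\<close>. For this one \<open>E\<close>, the function for
  \<open>p0\<close> involves the points \<open>0\<close> and \<open>- a\<close>, that for
  \<open>n4\<close> the points \<open>e - a - b\<close> and \<open>- b\<close>, that for
  \<open>n8\<close> the points \<open>f - a - b\<close> and \<open>- b\<close>. Interpolation from
  \<open>0\<close>, \<open>- a\<close>, \<open>- b\<close> leaves three coefficients, each of which
  vanishes by an identity for \<open>gamma_factor\<close>.

  Three nodes suffice because of the balance condition: \<open>T (s + k)\<close> behaves like four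
  sines of \<open>s\<close> divided by \<open>k^2\<close>. Four sines alone would still allow
  frequency two, but summing the inverse squares gains a factor of order
  \<open>1 / \<bar>Im s\<bar>\<close>, which excludes it.

  The symmetry is proved at positive parameters because all integrands and series there are
  nonnegative, so that Tonelli's theorem applies in \<open>ennreal\<close> before anything is known
  to converge.\<close>

lemma prod_one_plus_linear:
  fixes R :: real
  assumes "R \<ge> 0"
  shows "\<exists>C\<ge>0. \<forall>(a :: nat \<Rightarrow> complex) x. (\<forall>i<n. norm (a i) \<le> R) \<and> norm x \<le> 1 \<longrightarrow>
           norm ((\<Prod>i<n. 1 + a i * x) - (1 + x * (\<Sum>i<n. a i))) \<le> C * norm x ^ 2"
proof (induction n)
  case 0
  then show ?case by (auto intro: exI[of _ 0])
next
  case (Suc n)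
  then obtain C where C: "C \<ge> 0" "\<And>(a :: nat \<Rightarrow> complex) x. (\<forall>i<n. norm (a i) \<le> R) \<Longrightarrow> norm x \<le> 1 \<Longrightarrow>
           norm ((\<Prod>i<n. 1 + a i * x) - (1 + x * (\<Sum>i<n. a i))) \<le> C * norm x ^ 2"
    by blast
  show ?case
  proof (intro exI[of _ "C * (1 + R) + (real n * R) * R"] conjI allI impI)
    show "0 \<le> C * (1 + R) + real n * R * R" using C(1) assms by simp
    fix a :: "nat \<Rightarrow> complex" and x :: complex
    assume *: "(\<forall>i<Suc n. norm (a i) \<le> R) \<and> norm x \<le> 1"
    define P where "P = (\<Prod>i<n. 1 + a i * x)"
    define S where "S = (\<Sum>i<n. a i)"
    have S: "norm S \<le> real n * R"
      unfolding S_def using sum_norm_bound[of "{..<n}" a R] * by simp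
    have an: "norm (a n) \<le> R" using * by simp
    have P: "norm (P - (1 + x * S)) \<le> C * norm x ^ 2"
      unfolding P_def S_def using C(2)[of a x] * by simp
    have "norm (1 + a n * x) \<le> 1 + norm (a n) * norm x"
      by (metis norm_mult norm_one norm_triangle_ineq)
    also have "norm (a n) * norm x \<le> R * 1"
      using an * assms by (intro mult_mono) auto
    finally have 1: "norm (1 + a n * x) \<le> 1 + R" by simp
    have "(\<Prod>i<Suc n. 1 + a i * x) - (1 + x * (\<Sum>i<Suc n. a i))
        = (P - (1 + x * S)) * (1 + a n * x) + x^2 * (S * a n)"
      by (simp add: P_def S_def algebra_simps power2_eq_square)
    also have "norm \<dots> \<le> norm (P - (1 + x * S)) * norm (1 + a n * x) + norm x^2 * (norm S * norm (a n))"
      by (metis norm_mult norm_power norm_triangle_ineq)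
    also have "\<dots> \<le> (C * norm x ^ 2) * (1 + R) + norm x^2 * ((real n * R) * R)"
      using P 1 S an assms C(1) by (intro add_mono mult_mono mult_nonneg_nonneg) auto
    finally show "norm ((\<Prod>i<Suc n. 1 + a i * x) - (1 + x * (\<Sum>i<Suc n. a i)))
        \<le> (C * (1 + R) + real n * R * R) * norm x ^ 2"
      by (simp add: algebra_simps)
  qed
qed

text \<open>
  A pair \<open>a, e\<close> of parameter lists is balanced if it satisfies the Saalschuetz condition once the
  lower parameter \<open>1\<close>, which accounts for the factor \<open>k!\<close>, is counted among the \<open>e i\<close>.
\<close>

definition balanced :: "(nat \<Rightarrow> complex) \<Rightarrow> (nat \<Rightarrow> complex) \<Rightarrow> bool" where
  "balanced a e \<longleftrightarrow> (\<Sum>i<4. e i) = (\<Sum>i<4. a i) + 2"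

definition hyp_term :: "(nat \<Rightarrow> complex) \<Rightarrow> (nat \<Rightarrow> complex) \<Rightarrow> nat \<Rightarrow> complex" where
  "hyp_term a e k = (\<Prod>i<4. pochhammer (a i) k * rGamma (e i + of_nat k))"

definition param_bound :: "real \<Rightarrow> (nat \<Rightarrow> complex) \<Rightarrow> (nat \<Rightarrow> complex) \<Rightarrow> bool" where
  "param_bound R a e \<longleftrightarrow> (\<forall>i<4. norm (a i) \<le> R \<and> norm (e i) \<le> R)"

text \<open>For \<open>x = 1 / k\<close> the two products over \<open>a\<close> and \<open>e\<close>
  are numerator and denominator of the ratio of consecutive terms. The balance condition says that
  they agree to first order once the numerator carries the extra factor \<open>1 + 2 * x\<close>, so
  the ratio is \<open>1 - 2 / k\<close> up to order \<open>1 / k^2\<close>. The form without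
  division survives zeros of the denominator, and \<open>C\<close> depends on \<open>R\<close>
  alone, which later gives uniformity in the parameters.\<close>

lemma balanced_prod_ratio:
  assumes "R \<ge> 0"
  obtains C where "C \<ge> 0"
    "\<And>a e x. param_bound R a e \<Longrightarrow> balanced a e \<Longrightarrow> norm x \<le> 1 \<Longrightarrow>
       norm ((\<Prod>i<4. 1 + a i * x) * (1 + 2 * x) - (\<Prod>i<4. 1 + e i * x)) \<le> C * norm x ^ 2"
    "\<And>a e x. param_bound R a e \<Longrightarrow> norm x \<le> 1 \<Longrightarrow> norm ((\<Prod>i<4. 1 + e i * x) - 1) \<le> C * norm x"
proof -
  obtain C1 where C1: "C1 \<ge> 0" "\<And>(a :: nat \<Rightarrow> complex) x. (\<forall>i<5. norm (a i) \<le> R + 2) \<Longrightarrow> norm x \<le> 1 \<Longrightarrow>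
           norm ((\<Prod>i<5. 1 + a i * x) - (1 + x * (\<Sum>i<5. a i))) \<le> C1 * norm x ^ 2"
    using prod_one_plus_linear[of "R + 2" 5] assms by auto
  obtain C2 where C2: "C2 \<ge> 0" "\<And>(a :: nat \<Rightarrow> complex) x. (\<forall>i<4. norm (a i) \<le> R) \<Longrightarrow> norm x \<le> 1 \<Longrightarrow>
           norm ((\<Prod>i<4. 1 + a i * x) - (1 + x * (\<Sum>i<4. a i))) \<le> C2 * norm x ^ 2"
    using prod_one_plus_linear[of "R" 4] assms by auto
  show ?thesis
  proof (rule that[of "C1 + C2 + 4 * R"])
    show "0 \<le> C1 + C2 + 4 * R" using C1 C2 assms by simp
    fix a e :: "nat \<Rightarrow> complex" and x :: complex
    assume b: "param_bound R a e" and x: "norm x \<le> 1"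
    have Q: "norm ((\<Prod>i<4. 1 + e i * x) - (1 + x * (\<Sum>i<4. e i))) \<le> C2 * norm x ^ 2"
      using b x C2(2)[of e x] by (simp add: param_bound_def)
    {
      assume bal: "balanced a e"
      \<comment> \<open>The factor \<open>1 + 2 * x\<close> is treated as a fifth upper parameter,
        which makes the two linear coefficients equal.\<close>
      define a' where "a' = a(4 := 2)"
      have e5: "{..<5::nat} = insert 4 {..<4}" by auto
      have "norm ((\<Prod>i<5. 1 + a' i * x) - (1 + x * (\<Sum>i<5. a' i))) \<le> C1 * norm x ^ 2"
        proof (intro C1(2) allI impI)
        fix i :: nat assume "i < 5"
        then have "i < 4 \<or> i = 4" by auto
        then show "norm (a' i) \<le> R + 2"
          using b assms by (auto simp: a'_def param_bound_def intro: order.trans[of _ R])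
      qed (rule x)
      also have "(\<Prod>i<5. 1 + a' i * x) = (\<Prod>i<4. 1 + a i * x) * (1 + 2 * x)"
        by (simp add: e5 a'_def)
      also have "(\<Sum>i<5. a' i) = (\<Sum>i<4. e i)"
        using bal by (simp add: e5 a'_def balanced_def)
      finally have "norm (((\<Prod>i<4. 1 + a i * x) * (1 + 2 * x) - (1 + x * (\<Sum>i<4. e i))) -
           ((\<Prod>i<4. 1 + e i * x) - (1 + x * (\<Sum>i<4. e i)))) \<le> C1 * norm x ^ 2 + C2 * norm x ^ 2"
        using Q norm_triangle_ineq4 by (meson add_mono order.trans)
      also have "\<dots> \<le> (C1 + C2 + 4 * R) * norm x ^ 2"
        using assms by (simp add: algebra_simps)
      finally show "norm ((\<Prod>i<4. 1 + a i * x) * (1 + 2 * x) - (\<Prod>i<4. 1 + e i * x)) \<le> (C1 + C2 + 4 * R) * norm x ^ 2"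
        by simp
    }
    have "norm (\<Sum>i<4. e i) \<le> 4 * R"
      using sum_norm_bound[of "{..<4}" e R] b by (simp add: param_bound_def)
    then have "norm x * norm (\<Sum>i<4. e i) \<le> norm x * (4 * R)" by (intro mult_left_mono) auto
    moreover have "C2 * norm x ^ 2 \<le> C2 * norm x"
      using x C2(1) by (intro mult_left_mono) (auto simp: power2_eq_square mult_left_le)
    moreover have "norm ((\<Prod>i<4. 1 + e i * x) - 1) \<le>
        norm ((\<Prod>i<4. 1 + e i * x) - (1 + x * (\<Sum>i<4. e i))) + norm x * norm (\<Sum>i<4. e i)"
      using norm_triangle_ineq[of "(\<Prod>i<4. 1 + e i * x) - (1 + x * (\<Sum>i<4. e i))" "x * (\<Sum>i<4. e i)"]
      by (simp add: norm_mult)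
    moreover have "0 \<le> C1 * norm x" using C1 by simp
    ultimately have "norm ((\<Prod>i<4. 1 + e i * x) - 1) \<le> C1 * norm x + C2 * norm x + norm x * (4 * R)"
      using Q by linarith
    then show "norm ((\<Prod>i<4. 1 + e i * x) - 1) \<le> (C1 + C2 + 4 * R) * norm x"
      by (simp add: algebra_simps)
  qed
qed

section \<open>Decay, summability and holomorphy of balanced series\<close>

lemma hyp_term_Suc:
  "hyp_term a e (Suc k) * (\<Prod>i<4. e i + of_nat k) = hyp_term a e k * (\<Prod>i<4. a i + of_nat k)"
proof -
  have "rGamma (e i + of_nat (Suc k)) * (e i + of_nat k) = rGamma (e i + of_nat k)" for i
    using rGamma_plus1[of "e i + of_nat k"] by (simp add: ac_simps)
  then show ?thesis
    unfolding hyp_term_def prod.distrib[symmetric] pochhammer_Suc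
    by (intro prod.cong refl) (metis (no_types, lifting) mult.assoc mult.commute)
qed

text \<open>The ratio of consecutive terms is \<open>1 - 2 / k\<close> up to order
  \<open>1 / k^2\<close>. The constant 3/2 lies strictly between 1, the threshold for summability,
  and 2, which leaves room for the error.\<close>

lemma hyp_term_decay:
  assumes "R \<ge> 0"
  obtains N :: nat where "N \<ge> 2"
    "\<And>a e k. param_bound R a e \<Longrightarrow> balanced a e \<Longrightarrow> k \<ge> N \<Longrightarrow>
       norm (hyp_term a e (Suc k)) \<le> (1 - 3 / (2 * real k)) * norm (hyp_term a e k)"
proof -
  obtain C where C: "C \<ge> 0"
    "\<And>a e x. param_bound R a e \<Longrightarrow> balanced a e \<Longrightarrow> norm x \<le> 1 \<Longrightarrow>
       norm ((\<Prod>i<4. 1 + a i * x) * (1 + 2 * x) - (\<Prod>i<4. 1 + e i * x)) \<le> C * norm x ^ 2"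
    "\<And>a e x. param_bound R a e \<Longrightarrow> norm x \<le> 1 \<Longrightarrow> norm ((\<Prod>i<4. 1 + e i * x) - 1) \<le> C * norm x"
    using balanced_prod_ratio[OF assms] by metis
  \<comment> \<open>For \<open>x = 1 / k\<close> this gives \<open>x * (4 * C + 6) \<le> 1\<close>,
    and thereby all three smallness conditions used below: \<open>x\<close> at most 1/6,
    \<open>C * x\<close> at most 1/4, and \<open>2 * C * x + 3 * x\<close> at most 1/2.\<close>
  define N where "N = nat \<lceil>4 * C + 6\<rceil>"
  have N: "4 * C + 6 \<le> real N" unfolding N_def by linarith
  show ?thesis
  proof (rule that[of N])
    show "N \<ge> 2" using N C(1) by linarith
    fix a e :: "nat \<Rightarrow> complex" and k :: nat
    assume b: "param_bound R a e" "balanced a e" and k: "k \<ge> N"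
    have k': "4 * C + 6 \<le> real k" using N k by linarith
    then have k0: "real k > 0" using C(1) by linarith
    define x where "x = 1 / real k"
    have x: "0 < x" "x * (4 * C + 6) \<le> 1" using k' k0 by (auto simp: x_def field_simps)
    have "x * 6 \<le> x * (4 * C + 6)" using x C(1) by (intro mult_left_mono) auto
    then have x1: "x \<le> 1/6" using x by linarith
    define P where "P = (\<Prod>i<4. 1 + a i * of_real x)"
    define Q where "Q = (\<Prod>i<4. 1 + e i * of_real x)"
    have nx: "norm (complex_of_real x) = x" using x by simp
    have 1: "norm (P * (1 + 2 * of_real x) - Q) \<le> C * x ^ 2"
      using C(2)[OF b, of "of_real x"] x x1 unfolding P_def Q_def nx by simp
    have 2: "norm (Q - 1) \<le> C * x"
      using C(3)[OF b(1), of "of_real x"] x x1 unfolding Q_def nx by simp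
    have Cx: "C * x \<le> 1/4" using x(1,2) by (simp add: algebra_simps)
    have Q: "norm Q \<ge> 1/2"
      using 2 Cx norm_triangle_ineq3[of Q 1] by simp
    have "norm P * (1 + 2 * x) = norm (P * (1 + 2 * of_real x))"
    proof -
      have "1 + 2 * complex_of_real x = of_real (1 + 2 * x)" by simp
      then show ?thesis using x(1) by (simp only: norm_mult norm_of_real)
    qed
    also have "\<dots> \<le> norm Q + C * x ^ 2"
      using 1 norm_triangle_ineq2[of "P * (1 + 2 * of_real x)" Q] by linarith
    \<comment> \<open>Since \<open>norm Q\<close> is at least 1/2, the absolute error becomes an
      error relative to \<open>norm Q\<close>.\<close>
    also have "C * x^2 \<le> C * x^2 * (2 * norm Q)"
      using mult_left_mono[of 1 "2 * norm Q" "C * x^2"] Q C(1) by simp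
    also have "norm Q + C * x^2 * (2 * norm Q) = norm Q * (1 + x * (2 * C * x))"
      by (simp add: algebra_simps power2_eq_square)
    also have "\<dots> \<le> norm Q * ((1 - 3/2 * x) * (1 + 2 * x))"
    proof (rule mult_left_mono)
      have "2 * C * x + 3 * x \<le> 1/2" using x(2) by (simp add: algebra_simps)
      then have "x * (2 * C * x) + x * (3 * x) \<le> x * (1/2)"
        unfolding distrib_left[symmetric] using x(1) by (intro mult_left_mono) auto
      moreover have "(1 - 3/2 * x) * (1 + 2 * x) = 1 + x * (1/2) - x * (3 * x)"
        by (simp add: field_simps)
      ultimately show "1 + x * (2 * C * x) \<le> (1 - 3/2 * x) * (1 + 2 * x)" by linarith
    qed simp
    finally have "norm P * (1 + 2 * x) \<le> (norm Q * (1 - 3/2 * x)) * (1 + 2 * x)" by (simp add: mult.assoc)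
    then have PQ: "norm P \<le> norm Q * (1 - 3/2 * x)" using x(1) by simp
    have kx: "c + of_nat k = of_nat k * (1 + c * of_real x)" for c :: complex
      using k0 by (simp add: x_def field_simps)
    have "norm (hyp_term a e (Suc k)) * norm (\<Prod>i<4. e i + of_nat k) =
        norm (hyp_term a e k) * norm (\<Prod>i<4. a i + of_nat k)"
      using hyp_term_Suc[of a e k] by (metis norm_mult)
    then have "norm (hyp_term a e (Suc k)) * norm Q = norm (hyp_term a e k) * norm P"
      using k0 unfolding kx prod.distrib P_def Q_def by (simp add: norm_mult)
    also have "\<dots> \<le> norm (hyp_term a e k) * (norm Q * (1 - 3/2 * x))"
      using PQ by (intro mult_left_mono) auto
    finally have "norm (hyp_term a e (Suc k)) * norm Q \<le> ((1 - 3/2 * x) * norm (hyp_term a e k)) * norm Q"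
      by (simp add: algebra_simps)
    moreover have "norm Q > 0" using Q by linarith
    ultimately show "norm (hyp_term a e (Suc k)) \<le> (1 - 3 / (2 * real k)) * norm (hyp_term a e k)"
      using mult_right_le_imp_le[of "norm (hyp_term a e (Suc k))" "norm Q" "(1 - 3/2 * x) * norm (hyp_term a e k)"]
      by (simp add: x_def)
  qed
qed

text \<open>Raabe's test by telescoping: \<open>g k = 2 * (k - 1) * f k\<close> drops by at least
  \<open>f k\<close> at every step.\<close>

lemma summable_decay:
  fixes f :: "nat \<Rightarrow> real"
  assumes "N \<ge> 2" "\<And>k. f k \<ge> 0" "\<And>k. k \<ge> N \<Longrightarrow> f (Suc k) \<le> (1 - 3 / (2 * real k)) * f k"
  shows "summable f"
proof -
  define g where "g k = 2 * (real k - 1) * f k" for k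
  have step: "f k \<le> g k - g (Suc k)" if "k \<ge> N" for k
  proof -
    have k: "real k > 0" using that assms(1) by linarith
    have "real k * f (Suc k) \<le> real k * ((1 - 3 / (2 * real k)) * f k)"
      using assms(3)[OF that] by (intro mult_left_mono) auto
    also have "\<dots> = (real k - 3/2) * f k" using k by (simp add: field_simps)
    finally show ?thesis by (simp add: g_def algebra_simps)
  qed
  have "summable (\<lambda>k. f (k + N))"
  proof (rule summableI_nonneg_bounded)
    fix n
    have "(\<Sum>k<n. f (k + N)) \<le> g N - g (n + N)"
    proof (induction n)
      case (Suc n)
      then show ?case using step[of "n + N"] by simp
    qed simp
    moreover have "g (n + N) \<ge> 0" using assms(1) by (simp add: g_def assms(2))
    ultimately show "(\<Sum>k<n. f (k + N)) \<le> g N" by simp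
  qed (rule assms(2))
  then show ?thesis by (rule summable_iff_shift[THEN iffD1])
qed

lemma summable_norm_hyp_term:
  assumes "balanced a e"
  shows "summable (\<lambda>k. norm (hyp_term a e k))"
proof -
  define R where "R = (\<Sum>i<4. norm (a i) + norm (e i))"
  have "norm (a i) + norm (e i) \<le> R" if "i < 4" for i
    unfolding R_def by (rule member_le_sum) (use that in auto)
  then have R: "R \<ge> 0" "param_bound R a e"
    by (auto simp: param_bound_def R_def intro: sum_nonneg) (smt (verit) norm_ge_zero)+
  show ?thesis
    using hyp_term_decay[OF R(1)] R(2) assms summable_decay by (metis norm_ge_zero)
qed

lemma holomorphic_pochhammer:
  assumes "f holomorphic_on A"
  shows "(\<lambda>x. pochhammer (f x :: complex) k) holomorphic_on A"
  unfolding pochhammer_prod by (intro holomorphic_intros assms)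

lemma holomorphic_hyp_term:
  assumes "\<And>i. i < 4 \<Longrightarrow> (\<lambda>s. a s i) holomorphic_on A" "\<And>i. i < 4 \<Longrightarrow> (\<lambda>s. e s i) holomorphic_on A"
  shows "(\<lambda>s. hyp_term (a s) (e s) k) holomorphic_on A"
  unfolding hyp_term_def
  by (intro holomorphic_intros holomorphic_pochhammer holomorphic_rGamma' assms) auto

text \<open>On a closed unit ball the parameters are bounded, so one \<open>N\<close> from
  \<open>hyp_term_decay\<close> serves for all of them. The majorant \<open>M\<close> satisfies the
  decay recursion with equality and is summable by the same test, hence the convergence is locally
  uniform.\<close>

lemma holomorphic_suminf_hyp_term:
  assumes a: "\<And>i. i < 4 \<Longrightarrow> (\<lambda>s. a s i) holomorphic_on UNIV"
    and e: "\<And>i. i < 4 \<Longrightarrow> (\<lambda>s. e s i) holomorphic_on UNIV"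
    and bal: "\<And>s. balanced (a s) (e s)"
  shows "(\<lambda>s. \<Sum>k. hyp_term (a s) (e s) k) holomorphic_on UNIV"
proof (rule holomorphic_uniform_sequence[of _ "\<lambda>n s. \<Sum>k<n. hyp_term (a s) (e s) k"])
  show "(\<lambda>s. \<Sum>k<n. hyp_term (a s) (e s) k) holomorphic_on UNIV" for n
    by (intro holomorphic_intros holomorphic_hyp_term a e)
  fix z :: complex
  have bd: "\<exists>B. \<forall>s\<in>cball z 1. norm (f s) \<le> B" if "f holomorphic_on UNIV" for f :: "complex \<Rightarrow> complex"
  proof -
    have "compact (f ` cball z 1)"
      using that by (intro compact_continuous_image holomorphic_on_imp_continuous_on)
        (auto elim: holomorphic_on_subset)
    then have "bounded (f ` cball z 1)" by (rule compact_imp_bounded)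
    then show ?thesis by (auto simp: bounded_iff)
  qed
  have "\<forall>i. \<exists>B. i < 4 \<longrightarrow> (\<forall>s\<in>cball z 1. norm (a s i) \<le> B)"
    "\<forall>i. \<exists>B. i < 4 \<longrightarrow> (\<forall>s\<in>cball z 1. norm (e s i) \<le> B)"
    using bd[OF a] bd[OF e] by blast+
  then obtain B1 B2 where B: "\<And>i s. i < 4 \<Longrightarrow> s \<in> cball z 1 \<Longrightarrow> norm (a s i) \<le> B1 i"
    "\<And>i s. i < 4 \<Longrightarrow> s \<in> cball z 1 \<Longrightarrow> norm (e s i) \<le> B2 i"
    by metis
  define R where "R = (\<Sum>i<4. \<bar>B1 i\<bar> + \<bar>B2 i\<bar>)"
  have R0: "R \<ge> 0" by (auto simp: R_def intro!: sum_nonneg)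
  have "\<bar>B1 i\<bar> + \<bar>B2 i\<bar> \<le> R" if "i < 4" for i
    unfolding R_def by (rule member_le_sum) (use that in auto)
  then have R: "param_bound R (a s) (e s)" if "s \<in> cball z 1" for s
    unfolding param_bound_def
  proof (intro allI impI)
    fix i :: nat assume i: "i < 4"
    then show "norm (a s i) \<le> R \<and> norm (e s i) \<le> R"
      using B[OF i that] \<open>\<And>i. i < 4 \<Longrightarrow> \<bar>B1 i\<bar> + \<bar>B2 i\<bar> \<le> R\<close>[OF i] by linarith
  qed
  obtain N where N: "N \<ge> 2"
    "\<And>a e k. param_bound R a e \<Longrightarrow> balanced a e \<Longrightarrow> k \<ge> N \<Longrightarrow>
       norm (hyp_term a e (Suc k)) \<le> (1 - 3 / (2 * real k)) * norm (hyp_term a e k)"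
    using hyp_term_decay[OF R0] by metis
  obtain C where C: "\<And>s. s \<in> cball z 1 \<Longrightarrow> norm (hyp_term (a s) (e s) N) \<le> C"
    using bd[OF holomorphic_hyp_term[of a _ e N]] a e by blast
  have C0: "C \<ge> 0" by (rule order.trans[OF norm_ge_zero C[of z]]) simp
  define M where "M n = C * (\<Prod>j=N..<n. 1 - 3 / (2 * real j))" for n
  have pos: "1 - 3 / (2 * real j) \<ge> 0" if "j \<ge> N" for j
    using that N(1) by (simp add: field_simps)
  have M: "norm (hyp_term (a s) (e s) n) \<le> M n" if "n \<ge> N" "s \<in> cball z 1" for n s
    using that(1)
  proof (induction n rule: dec_induct)
    case base
    then show ?case using C[OF that(2)] by (simp add: M_def)
  next
    case (step n)
    have "norm (hyp_term (a s) (e s) (Suc n)) \<le> (1 - 3 / (2 * real n)) * norm (hyp_term (a s) (e s) n)"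
      by (rule N(2)[OF R[OF that(2)] bal step(1)])
    also have "\<dots> \<le> (1 - 3 / (2 * real n)) * M n"
      using step pos by (intro mult_left_mono) auto
    finally show ?case using step(1) by (simp add: M_def algebra_simps)
  qed
  have "summable M"
  proof (rule summable_decay[OF N(1)])
    show "M k \<ge> 0" for k unfolding M_def using pos C0 by (intro mult_nonneg_nonneg prod_nonneg) auto
    show "M (Suc k) \<le> (1 - 3 / (2 * real k)) * M k" if "k \<ge> N" for k
      using that by (simp add: M_def algebra_simps)
  qed
  then have "uniform_limit (cball z 1) (\<lambda>n s. \<Sum>k<n. hyp_term (a s) (e s) k)
      (\<lambda>s. \<Sum>k. hyp_term (a s) (e s) k) sequentially"
    using M by (intro Weierstrass_m_test_ev[of _ _ M] eventually_sequentiallyI[of N]) blast+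
  then show "\<exists>d>0. cball z d \<subseteq> UNIV \<and> uniform_limit (cball z d) (\<lambda>n s. \<Sum>k<n. hyp_term (a s) (e s) k)
      (\<lambda>s. \<Sum>k. hyp_term (a s) (e s) k) sequentially"
    by (intro exI[of _ 1]) auto
qed auto

section \<open>A positive triple integral\<close>

text \<open>By \<open>key\<close>, the integral of a nonnegative function is its Henstock-Kurzweil
  value if the function is absolutely integrable, and infinite otherwise. The substitution preserves
  absolute integrability in both directions, so the infinite values match as well.\<close>

lemma nn_integral_change_of_variable:
  fixes f g g' :: "real \<Rightarrow> real"
  assumes [measurable]: "S \<in> sets borel" "g ` S \<in> sets borel" "f \<in> borel_measurable borel"
    and meas: "(\<lambda>x. \<bar>g' x\<bar> * f (g x)) \<in> borel_measurable borel"
    and der: "\<And>x. x \<in> S \<Longrightarrow> (g has_field_derivative g' x) (at x within S)"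
    and inj: "inj_on g S"
    and nonneg: "\<And>x. f x \<ge> 0"
  shows "(\<integral>\<^sup>+x\<in>g ` S. ennreal (f x) \<partial>lborel) = (\<integral>\<^sup>+x\<in>S. ennreal (\<bar>g' x\<bar> * f (g x)) \<partial>lborel)"
proof -
  have key: "(\<integral>\<^sup>+x\<in>A. ennreal (h x) \<partial>lborel) = (if h absolutely_integrable_on A then ennreal (integral A h) else \<infinity>)"
    if [measurable]: "A \<in> sets borel" "h \<in> borel_measurable borel" and h: "\<And>x. h x \<ge> 0" for A and h :: "real \<Rightarrow> real"
  proof -
    have eq: "(\<integral>\<^sup>+x\<in>A. ennreal (h x) \<partial>lborel) = (\<integral>\<^sup>+x. ennreal (indicator A x *\<^sub>R h x) \<partial>lebesgue)"
      by (subst nn_integral_completion) (auto intro!: nn_integral_cong simp: indicator_def)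
    show ?thesis
    proof (cases "h absolutely_integrable_on A")
      case True
      then have "integrable lebesgue (\<lambda>x. indicator A x *\<^sub>R h x)" by (simp add: set_integrable_def)
      then have "(\<integral>\<^sup>+x. ennreal (indicator A x *\<^sub>R h x) \<partial>lebesgue) = ennreal (\<integral>x. indicator A x *\<^sub>R h x \<partial>lebesgue)"
        by (intro nn_integral_eq_integral) (auto simp: h)
      also have "(\<integral>x. indicator A x *\<^sub>R h x \<partial>lebesgue) = integral A h"
        using set_lebesgue_integral_eq_integral(2)[OF True] by (simp add: set_lebesgue_integral_def)
      finally show ?thesis using True eq by simp
    next
      case False
      then have ni: "\<not> integrable lebesgue (\<lambda>x. indicator A x *\<^sub>R h x)" by (simp add: set_integrable_def)
      have "(\<integral>\<^sup>+x. ennreal (indicator A x *\<^sub>R h x) \<partial>lebesgue) = \<infinity>"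
      proof (rule ccontr)
        assume "(\<integral>\<^sup>+x. ennreal (indicator A x *\<^sub>R h x) \<partial>lebesgue) \<noteq> \<infinity>"
        then have "(\<integral>\<^sup>+x. ennreal (norm (indicator A x *\<^sub>R h x)) \<partial>lebesgue) < \<infinity>"
          by (simp add: h less_top[symmetric])
        moreover have "(\<lambda>x. indicator A x *\<^sub>R h x) \<in> borel_measurable lebesgue"
          by (intro measurable_completion) simp
        ultimately show False using ni by (simp add: integrable_iff_bounded)
      qed
      then show ?thesis using False eq by simp
    qed
  qed
  have S: "S \<in> sets lebesgue" by simp
  note cov = has_absolute_integral_change_of_variables_1'[OF S der inj, of f]
  show ?thesis
  proof (cases "f absolutely_integrable_on (g ` S)")
    case True
    then show ?thesis
      using cov[of "integral (g ` S) f"] key[of "g ` S" f] key[of S "\<lambda>x. \<bar>g' x\<bar> * f (g x)"] meas nonneg assms(1-3)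
      by simp
  next
    case False
    then show ?thesis
      using cov[of "integral S (\<lambda>x. \<bar>g' x\<bar> * f (g x))"] key[of "g ` S" f]
        key[of S "\<lambda>x. \<bar>g' x\<bar> * f (g x)"] meas nonneg assms(1-3)
      by simp
  qed
qed

lemma binomial_sums:
  fixes z :: real
  assumes "0 \<le> z" "z < 1"
  shows "(\<lambda>k. pochhammer \<alpha> k / fact k * z ^ k) sums (1 - z) powr (-\<alpha>)"
proof -
  have "((- \<alpha>) gchoose k) * (- z) ^ k = pochhammer \<alpha> k / fact k * z ^ k" for k
  proof -
    have "(-1) ^ k * (- z) ^ k = z ^ k" by (simp flip: power_mult_distrib)
    then show ?thesis by (simp add: gbinomial_pochhammer)
  qed
  then show ?thesis using gen_binomial_real[of "- z" "- \<alpha>"] assms by simp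
qed

lemma nn_integral_Beta:
  assumes "p > 0" "q > 0"
  shows "(\<integral>\<^sup>+x\<in>{0<..<1}. ennreal (x powr (p - 1) * (1 - x) powr (q - 1)) \<partial>lborel) = ennreal (Beta p q)"
proof -
  define f where "f x = x powr (p - 1) * (1 - x) powr (q - 1) * indicator {0<..<1} x" for x :: real
  have "((\<lambda>x. if x \<in> {0<..<1} then x powr (p - 1) * (1 - x) powr (q - 1) else 0) has_integral Beta p q) UNIV"
    using has_integral_Beta_real[OF assms] by (simp only: has_integral_Icc_iff_Ioo has_integral_restrict_UNIV)
  also have "(\<lambda>x. if x \<in> {0<..<1} then x powr (p - 1) * (1 - x) powr (q - 1) else 0) = f"
    by (auto simp: f_def indicator_def)
  finally have "(\<integral>\<^sup>+x. ennreal (f x) \<partial>lborel) = ennreal (Beta p q)"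
    by (intro nn_integral_has_integral_lborel) (auto simp: f_def)
  also have "(\<integral>\<^sup>+x. ennreal (f x) \<partial>lborel) =
     (\<integral>\<^sup>+x\<in>{0<..<1}. ennreal (x powr (p - 1) * (1 - x) powr (q - 1)) \<partial>lborel)"
    by (intro nn_integral_cong) (auto simp: f_def indicator_def)
  finally show ?thesis .
qed

lemma Beta_real_pos: "x > 0 \<Longrightarrow> y > 0 \<Longrightarrow> Beta x y > (0 :: real)"
  by (simp add: Beta_def)

text \<open>With \<open>\<alpha> \<ge> 0\<close> every term of the binomial series is nonnegative,
  so termwise integration raises no question of convergence. The endpoint \<open>v = 1\<close>,
  where both sides may be infinite, is the case behind \<open>suminf_Gauss\<close>.\<close>

lemma nn_integral_Euler_series:
  assumes "\<alpha> \<ge> 0" "b > 0" "c > 0" "0 \<le> v" "v \<le> 1"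
  shows "(\<integral>\<^sup>+x\<in>{0<..<1}. ennreal (x powr (b - 1) * (1 - x) powr (c - 1) * (1 - x * v) powr (-\<alpha>)) \<partial>lborel)
       = (\<Sum>k. ennreal (pochhammer \<alpha> k / fact k * v ^ k * Beta (b + real k) c))"
proof -
  have poch: "pochhammer \<alpha> k \<ge> 0" for k using assms(1) unfolding pochhammer_prod by (intro prod_nonneg) auto
  define F where "F k x = ennreal (pochhammer \<alpha> k / fact k * v ^ k) *
      (ennreal (x powr (b + real k - 1) * (1 - x) powr (c - 1)) * indicator {0<..<1} x)" for k and x :: real
  have [measurable]: "F k \<in> borel_measurable borel" for k unfolding F_def by measurable
  have "(\<integral>\<^sup>+x\<in>{0<..<1}. ennreal (x powr (b - 1) * (1 - x) powr (c - 1) * (1 - x * v) powr (-\<alpha>)) \<partial>lborel)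
      = (\<integral>\<^sup>+x. (\<Sum>k. F k x) \<partial>lborel)"
  proof (rule nn_integral_cong)
    fix x :: real
    show "ennreal (x powr (b - 1) * (1 - x) powr (c - 1) * (1 - x * v) powr (-\<alpha>)) * indicator {0<..<1} x = (\<Sum>k. F k x)"
    proof (cases "x \<in> {0<..<1}")
      case True
      then have x: "0 < x" "x < 1" by auto
      have "x * v \<le> x * 1" using x assms by (intro mult_left_mono) auto
      then have "x * v < 1" using x by linarith
      then have xv: "0 \<le> x * v" "x * v < 1" using x assms by simp_all
      define W where "W = x powr (b - 1) * (1 - x) powr (c - 1)"
      have W: "W \<ge> 0" by (simp add: W_def)
      have "(\<lambda>k. W * (pochhammer \<alpha> k / fact k * (x * v) ^ k)) sums (W * (1 - x * v) powr (-\<alpha>))"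
        by (intro sums_mult binomial_sums xv)
      moreover have "0 \<le> W * (pochhammer \<alpha> k / fact k * (x * v) ^ k)" for k
        using W poch xv(1) by simp
      ultimately have "(\<lambda>k. ennreal (W * (pochhammer \<alpha> k / fact k * (x * v) ^ k)))
          sums ennreal (W * (1 - x * v) powr (-\<alpha>))"
        using W by (intro sums_ennreal[THEN iffD2]) auto
      moreover have "ennreal (W * (pochhammer \<alpha> k / fact k * (x * v) ^ k)) = F k x" for k
      proof -
        have "x powr (b + real k - 1) = x powr (b - 1 + real k)" by (simp add: algebra_simps)
        also have "\<dots> = x powr (b - 1) * x ^ k"
          using x by (simp add: powr_realpow powr_add)
        finally have e: "W * (pochhammer \<alpha> k / fact k * (x * v) ^ k) =
            (pochhammer \<alpha> k / fact k * v ^ k) * (x powr (b + real k - 1) * (1 - x) powr (c - 1))"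
          by (simp add: W_def power_mult_distrib)
        show ?thesis
          unfolding e F_def using True poch[of k] assms by (subst ennreal_mult) auto
      qed
      ultimately show ?thesis using True unfolding W_def by (simp add: sums_iff)
    qed (simp add: F_def)
  qed
  also have "\<dots> = (\<Sum>k. \<integral>\<^sup>+x. F k x \<partial>lborel)"
    by (rule nn_integral_suminf) simp
  also have "\<dots> = (\<Sum>k. ennreal (pochhammer \<alpha> k / fact k * v ^ k * Beta (b + real k) c))"
  proof (rule suminf_cong)
    fix k
    have "(\<integral>\<^sup>+x. F k x \<partial>lborel) = ennreal (pochhammer \<alpha> k / fact k * v ^ k) * ennreal (Beta (b + real k) c)"
      unfolding F_def by (subst nn_integral_cmult) (use nn_integral_Beta[of "b + real k" c] assms in auto)
    also have "\<dots> = ennreal (pochhammer \<alpha> k / fact k * v ^ k * Beta (b + real k) c)"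
      using poch assms by (intro ennreal_mult[symmetric]) (auto intro!: less_imp_le[OF Beta_real_pos])
    finally show "(\<integral>\<^sup>+x. F k x \<partial>lborel) = ennreal (pochhammer \<alpha> k / fact k * v ^ k * Beta (b + real k) c)" .
  qed
  finally show ?thesis .
qed

definition F21 :: "real \<Rightarrow> real \<Rightarrow> real \<Rightarrow> real \<Rightarrow> ennreal" where
  "F21 \<alpha> \<beta> \<gamma> v = (\<Sum>k. ennreal (pochhammer \<alpha> k * pochhammer \<beta> k / (pochhammer \<gamma> k * fact k) * v ^ k))"

lemma F21_commute: "F21 \<alpha> \<beta> \<gamma> v = F21 \<beta> \<alpha> \<gamma> v"
  by (simp add: F21_def mult.commute)

lemma F21_measurable [measurable]: "f \<in> borel_measurable M \<Longrightarrow> (\<lambda>x. F21 \<alpha> \<beta> \<gamma> (f x)) \<in> borel_measurable M"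
  unfolding F21_def by measurable

lemma Gamma_add_nat_real: "x > 0 \<Longrightarrow> Gamma (x + real k) = pochhammer x k * Gamma (x :: real)"
proof -
  assume x: "x > 0"
  then have "x \<notin> \<int>\<^sub>\<le>\<^sub>0" by (auto simp: nonpos_Ints_def)
  then show ?thesis using pochhammer_Gamma[of x k] Gamma_real_pos[OF x] by simp
qed

lemma pochhammer_nonneg_real: "x \<ge> (0 :: real) \<Longrightarrow> pochhammer x k \<ge> 0"
  unfolding pochhammer_prod by (intro prod_nonneg) auto

text \<open>Makes the symmetry of the hypergeometric function in its upper parameters visible.\<close>

lemma nn_integral_Pfaff:
  assumes "\<alpha> \<ge> 0" "b > 0" "c > 0" "\<sigma> > 0"
  shows "(\<integral>\<^sup>+x\<in>{0<..<1}. ennreal (x powr (b - 1) * (1 - x) powr (c - 1) * (1 + x * \<sigma>) powr (-\<alpha>)) \<partial>lborel)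
       = ennreal ((1 + \<sigma>) powr (-\<alpha>) * Beta c b) * F21 \<alpha> c (b + c) (\<sigma> / (1 + \<sigma>))"
proof -
  \<comment> \<open>Reflecting \<open>x\<close> to \<open>1 - x\<close> gives
    \<open>1 + (1 - x) * \<sigma> = (1 + \<sigma>) * (1 - x * v)\<close>, which turns the integral
    into Euler's with argument \<open>v\<close>.\<close>
  define v where "v = \<sigma> / (1 + \<sigma>)"
  have v: "0 \<le> v" "v \<le> 1" using assms by (auto simp: v_def)
  have eq: "pochhammer \<alpha> k / fact k * v ^ k * Beta (c + real k) b =
      Beta c b * (pochhammer \<alpha> k * pochhammer c k / (pochhammer (b + c) k * fact k) * v ^ k)" for k
  proof -
    have "Gamma (c + real k + b) = pochhammer (b + c) k * Gamma (b + c)"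
      using Gamma_add_nat_real[of "b + c" k] assms by (simp add: add_ac)
    then show ?thesis using Gamma_add_nat_real[of c k] assms by (simp add: Beta_def add_ac mult_ac)
  qed
  have "(\<integral>\<^sup>+x\<in>{0<..<1}. ennreal (x powr (b - 1) * (1 - x) powr (c - 1) * (1 + x * \<sigma>) powr (-\<alpha>)) \<partial>lborel)
      = ennreal \<bar>-1\<bar> * (\<integral>\<^sup>+x. ennreal ((1 + -1 * x) powr (b - 1) * (1 - (1 + -1 * x)) powr (c - 1) * (1 + (1 + -1 * x) * \<sigma>) powr (-\<alpha>))
          * indicator {0<..<1} (1 + -1 * x) \<partial>lborel)"
    by (rule nn_integral_real_affine) auto
  also have "\<dots> = (\<integral>\<^sup>+x. ennreal ((1 + \<sigma>) powr (-\<alpha>)) *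
      (ennreal (x powr (c - 1) * (1 - x) powr (b - 1) * (1 - x * v) powr (-\<alpha>)) * indicator {0<..<1} x) \<partial>lborel)"
  proof (simp, intro nn_integral_cong)
    fix x :: real
    have "1 + (1 - x) * \<sigma> = (1 + \<sigma>) * (1 - x * v)"
      using assms by (simp add: v_def field_simps)
    moreover have "1 - x * v \<ge> 0" if "0 < x" "x < 1"
      using v that mult_mono[of x 1 v 1] by simp
    ultimately show "ennreal ((1 - x) powr (b - 1) * x powr (c - 1) * (1 + (1 - x) * \<sigma>) powr - \<alpha>) * indicator {0<..<1} (1 - x)
      = ennreal ((1 + \<sigma>) powr - \<alpha>) *
         (ennreal (x powr (c - 1) * (1 - x) powr (b - 1) * (1 - x * v) powr - \<alpha>) * indicator {0<..<1} x)"
      using assms by (cases "0 < x \<and> x < 1") (auto simp: powr_mult ennreal_mult[symmetric] mult_ac)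
  qed
  also have "\<dots> = ennreal ((1 + \<sigma>) powr (-\<alpha>)) *
      (\<Sum>k. ennreal (pochhammer \<alpha> k / fact k * v ^ k * Beta (c + real k) b))"
    by (subst nn_integral_cmult, simp, subst nn_integral_Euler_series) (use assms v in auto)
  also have "(\<Sum>k. ennreal (pochhammer \<alpha> k / fact k * v ^ k * Beta (c + real k) b)) =
      (\<Sum>k. ennreal (Beta c b * (pochhammer \<alpha> k * pochhammer c k / (pochhammer (b + c) k * fact k) * v ^ k)))"
    by (simp only: eq)
  also have "(\<Sum>k. ennreal (Beta c b * (pochhammer \<alpha> k * pochhammer c k / (pochhammer (b + c) k * fact k) * v ^ k)))
      = ennreal (Beta c b) * F21 \<alpha> c (b + c) v"
    unfolding F21_def
    by (subst ennreal_suminf_cmult[symmetric], intro suminf_cong ennreal_mult)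
      (use assms v Beta_real_pos[of c b] in \<open>auto intro!: mult_nonneg_nonneg divide_nonneg_nonneg pochhammer_nonneg_real\<close>)
  finally show ?thesis
    using assms Beta_real_pos[of c b] by (simp add: v_def ennreal_mult mult.assoc)
qed

section \<open>The triple integral and its symmetric form\<close>

definition D_int :: "real \<Rightarrow> real \<Rightarrow> real \<Rightarrow> real \<Rightarrow> real \<Rightarrow> real \<Rightarrow> ennreal" where
  "D_int u1 u2 u3 u4 u5 u6 = (\<integral>\<^sup>+\<sigma>\<in>{0<..}. ennreal (\<sigma> powr (u1 + u5 - 1)) *
     ((\<integral>\<^sup>+x\<in>{0<..<1}. ennreal (x powr (u5 + u6 - 1) * (1 - x) powr (u1 + u2 - 1) * (1 + x * \<sigma>) powr (-(u2 + u5))) \<partial>lborel) *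
      (\<integral>\<^sup>+y\<in>{0<..<1}. ennreal (y powr (u1 + u3 - 1) * (1 - y) powr (u4 + u5 - 1) * (1 + y * \<sigma>) powr (-(u1 + u4))) \<partial>lborel)) \<partial>lborel)"

text \<open>What remains of \<open>D_int\<close> once the two Beta factors are removed. Exchanging
  \<open>u1\<close> and \<open>u5\<close> exchanges the two upper parameters of each
  \<open>F21\<close> and fixes everything else; this is the purpose of the exponents in
  \<open>D_int\<close>.\<close>

definition D_sym :: "real \<Rightarrow> real \<Rightarrow> real \<Rightarrow> real \<Rightarrow> real \<Rightarrow> real \<Rightarrow> ennreal" where
  "D_sym u1 u2 u3 u4 u5 u6 = (\<integral>\<^sup>+\<sigma>\<in>{0<..}. ennreal (\<sigma> powr (u1 + u5 - 1) * (1 + \<sigma>) powr (-(u1 + u2 + u4 + u5))) *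
     (F21 (u1 + u2) (u2 + u5) (u1 + u2 + u5 + u6) (\<sigma> / (1 + \<sigma>)) *
      F21 (u1 + u4) (u4 + u5) (u1 + u3 + u4 + u5) (\<sigma> / (1 + \<sigma>))) \<partial>lborel)"

lemma D_int_eq_D_sym:
  assumes "u1 > 0" "u2 > 0" "u3 > 0" "u4 > 0" "u5 > 0" "u6 > 0"
  shows "D_int u1 u2 u3 u4 u5 u6 =
    ennreal (Beta (u1 + u2) (u5 + u6) * Beta (u4 + u5) (u1 + u3)) * D_sym u1 u2 u3 u4 u5 u6"
proof -
  have "D_int u1 u2 u3 u4 u5 u6 =
      (\<integral>\<^sup>+\<sigma>. ennreal (Beta (u1 + u2) (u5 + u6) * Beta (u4 + u5) (u1 + u3)) *
       ((ennreal (\<sigma> powr (u1 + u5 - 1) * (1 + \<sigma>) powr (-(u1 + u2 + u4 + u5))) *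
     (F21 (u1 + u2) (u2 + u5) (u1 + u2 + u5 + u6) (\<sigma> / (1 + \<sigma>)) *
      F21 (u1 + u4) (u4 + u5) (u1 + u3 + u4 + u5) (\<sigma> / (1 + \<sigma>)))) * indicator {0<..} \<sigma>) \<partial>lborel)"
    unfolding D_int_def
  proof (rule nn_integral_cong)
    fix \<sigma> :: real
    define B1 where "B1 = Beta (u1 + u2) (u5 + u6)"
    define B2 where "B2 = Beta (u4 + u5) (u1 + u3)"
    have B: "B1 > 0" "B2 > 0" using assms by (auto simp: B1_def B2_def intro!: Beta_real_pos)
    define S1 where "S1 = F21 (u1 + u2) (u2 + u5) (u1 + u2 + u5 + u6) (\<sigma> / (1 + \<sigma>))"
    define S2 where "S2 = F21 (u1 + u4) (u4 + u5) (u1 + u3 + u4 + u5) (\<sigma> / (1 + \<sigma>))"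
    show "ennreal (\<sigma> powr (u1 + u5 - 1)) *
     ((\<integral>\<^sup>+x\<in>{0<..<1}. ennreal (x powr (u5 + u6 - 1) * (1 - x) powr (u1 + u2 - 1) * (1 + x * \<sigma>) powr (-(u2 + u5))) \<partial>lborel) *
      (\<integral>\<^sup>+y\<in>{0<..<1}. ennreal (y powr (u1 + u3 - 1) * (1 - y) powr (u4 + u5 - 1) * (1 + y * \<sigma>) powr (-(u1 + u4))) \<partial>lborel)) * indicator {0<..} \<sigma>
      = ennreal (Beta (u1 + u2) (u5 + u6) * Beta (u4 + u5) (u1 + u3)) *
       ((ennreal (\<sigma> powr (u1 + u5 - 1) * (1 + \<sigma>) powr (-(u1 + u2 + u4 + u5))) *
     (F21 (u1 + u2) (u2 + u5) (u1 + u2 + u5 + u6) (\<sigma> / (1 + \<sigma>)) *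
      F21 (u1 + u4) (u4 + u5) (u1 + u3 + u4 + u5) (\<sigma> / (1 + \<sigma>)))) * indicator {0<..} \<sigma>)"
    proof (cases "\<sigma> > 0")
      case True
      have 1: "(\<integral>\<^sup>+x\<in>{0<..<1}. ennreal (x powr (u5 + u6 - 1) * (1 - x) powr (u1 + u2 - 1) * (1 + x * \<sigma>) powr (-(u2 + u5))) \<partial>lborel)
        = ennreal ((1 + \<sigma>) powr (-(u2 + u5)) * B1) * S1"
        using nn_integral_Pfaff[of "u2 + u5" "u5 + u6" "u1 + u2" \<sigma>] assms True
        by (simp add: B1_def S1_def add_ac F21_commute[of "u1 + u2"])
      have 2: "(\<integral>\<^sup>+y\<in>{0<..<1}. ennreal (y powr (u1 + u3 - 1) * (1 - y) powr (u4 + u5 - 1) * (1 + y * \<sigma>) powr (-(u1 + u4))) \<partial>lborel)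
        = ennreal ((1 + \<sigma>) powr (-(u1 + u4)) * B2) * S2"
        using nn_integral_Pfaff[of "u1 + u4" "u1 + u3" "u4 + u5" \<sigma>] assms True
        by (simp add: B2_def S2_def add_ac)
      have 3: "(1 + \<sigma>) powr (-(u1 + u2 + u4 + u5)) = (1 + \<sigma>) powr (-(u2 + u5)) * (1 + \<sigma>) powr (-(u1 + u4))"
        using True by (simp add: powr_add[symmetric] algebra_simps)
      show ?thesis
        unfolding 1 2 3 S1_def[symmetric] S2_def[symmetric] B1_def[symmetric] B2_def[symmetric]
        using True B by (simp add: ennreal_mult mult_ac)
    qed simp
  qed
  also have "\<dots> = ennreal (Beta (u1 + u2) (u5 + u6) * Beta (u4 + u5) (u1 + u3)) * D_sym u1 u2 u3 u4 u5 u6"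
    unfolding D_sym_def by (rule nn_integral_cmult) measurable
  finally show ?thesis .
qed

lemma D_sym_swap: "D_sym u5 u2 u3 u4 u1 u6 = D_sym u1 u2 u3 u4 u5 u6"
  unfolding D_sym_def by (simp add: add_ac F21_commute[of "u1 + u2"] F21_commute[of "u1 + u4"])

definition Phi :: "real \<Rightarrow> real \<Rightarrow> real \<Rightarrow> real \<Rightarrow> real \<Rightarrow> real \<Rightarrow> real \<Rightarrow> real \<Rightarrow> real \<Rightarrow> real" where
  "Phi u1 u2 u3 u4 u5 u6 \<sigma> x y = \<sigma> powr (u1 + u5 - 1) *
     ((x powr (u5 + u6 - 1) * (1 - x) powr (u1 + u2 - 1) * (1 + x * \<sigma>) powr (-(u2 + u5))) *
      (y powr (u1 + u3 - 1) * (1 - y) powr (u4 + u5 - 1) * (1 + y * \<sigma>) powr (-(u1 + u4))))"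

lemma Phi_nonneg: "Phi u1 u2 u3 u4 u5 u6 \<sigma> x y \<ge> 0"
  by (simp add: Phi_def)

lemma Phi_measurable [measurable (raw)]:
  assumes [measurable]: "f \<in> borel_measurable M" "g \<in> borel_measurable M" "h \<in> borel_measurable M"
  shows "(\<lambda>w. Phi u1 u2 u3 u4 u5 u6 (f w) (g w) (h w)) \<in> borel_measurable M"
  unfolding Phi_def by measurable

definition Phi_int :: "real \<Rightarrow> real \<Rightarrow> real \<Rightarrow> real \<Rightarrow> real \<Rightarrow> real \<Rightarrow> real \<Rightarrow> real \<Rightarrow> ennreal" where
  "Phi_int u1 u2 u3 u4 u5 u6 x y = (\<integral>\<^sup>+\<sigma>\<in>{0<..}. ennreal (Phi u1 u2 u3 u4 u5 u6 \<sigma> x y) \<partial>lborel)"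

lemma Phi_int_measurable [measurable (raw)]:
  assumes [measurable]: "g \<in> borel_measurable M" "h \<in> borel_measurable M"
  shows "(\<lambda>w. Phi_int u1 u2 u3 u4 u5 u6 (g w) (h w)) \<in> borel_measurable M"
  unfolding Phi_int_def by measurable

lemma nn_integral_lborel_swap:
  fixes f :: "real \<Rightarrow> real \<Rightarrow> ennreal"
  assumes "(\<lambda>(x, y). f x y) \<in> borel_measurable (lborel \<Otimes>\<^sub>M lborel)"
  shows "(\<integral>\<^sup>+x. \<integral>\<^sup>+y. f x y \<partial>lborel \<partial>lborel) = (\<integral>\<^sup>+y. \<integral>\<^sup>+x. f x y \<partial>lborel \<partial>lborel)"
  by (rule lborel_pair.Fubini'[symmetric]) (rule assms)

text \<open>Tonelli's theorem moves the \<open>\<sigma>\<close>-integral inside, which prepares the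
  split of the unit square along its diagonal.\<close>

lemma D_int_eq_Phi_int:
  "D_int u1 u2 u3 u4 u5 u6 =
     (\<integral>\<^sup>+x\<in>{0<..<1}. (\<integral>\<^sup>+y\<in>{0<..<1}. Phi_int u1 u2 u3 u4 u5 u6 x y \<partial>lborel) \<partial>lborel)"
proof -
  define F where "F \<sigma> x y = ennreal (Phi u1 u2 u3 u4 u5 u6 \<sigma> x y) * indicator {0<..} \<sigma> * indicator {0<..<1} x * indicator {0<..<1} y" for \<sigma> x y
  have [measurable]: "(\<lambda>w. F (f w) (g w) (h w)) \<in> borel_measurable M"
    if [measurable]: "f \<in> borel_measurable M" "g \<in> borel_measurable M" "h \<in> borel_measurable M"
    for f g h and M :: "'a measure"
    unfolding F_def by measurable
  have "D_int u1 u2 u3 u4 u5 u6 = (\<integral>\<^sup>+\<sigma>. \<integral>\<^sup>+x. \<integral>\<^sup>+y. F \<sigma> x y \<partial>lborel \<partial>lborel \<partial>lborel)"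
    unfolding D_int_def
  proof (rule nn_integral_cong)
    fix \<sigma> :: real
    define X where "X x = ennreal (x powr (u5 + u6 - 1) * (1 - x) powr (u1 + u2 - 1) * (1 + x * \<sigma>) powr (-(u2 + u5))) * indicator {0<..<1} x" for x
    define Y where "Y y = ennreal (y powr (u1 + u3 - 1) * (1 - y) powr (u4 + u5 - 1) * (1 + y * \<sigma>) powr (-(u1 + u4))) * indicator {0<..<1} y" for y
    have [measurable]: "X \<in> borel_measurable borel" "Y \<in> borel_measurable borel"
      unfolding X_def Y_def by measurable
    have F: "F \<sigma> x y = (ennreal (\<sigma> powr (u1 + u5 - 1)) * indicator {0<..} \<sigma>) * (X x * Y y)" for x y
      by (simp add: F_def Phi_def X_def Y_def ennreal_mult mult_ac)
    have "(\<integral>\<^sup>+x. \<integral>\<^sup>+y. F \<sigma> x y \<partial>lborel \<partial>lborel) =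
        (ennreal (\<sigma> powr (u1 + u5 - 1)) * indicator {0<..} \<sigma>) * ((\<integral>\<^sup>+x. X x \<partial>lborel) * (\<integral>\<^sup>+y. Y y \<partial>lborel))"
      unfolding F by (simp add: nn_integral_cmult nn_integral_multc)
    then show "ennreal (\<sigma> powr (u1 + u5 - 1)) *
     ((\<integral>\<^sup>+x\<in>{0<..<1}. ennreal (x powr (u5 + u6 - 1) * (1 - x) powr (u1 + u2 - 1) * (1 + x * \<sigma>) powr (-(u2 + u5))) \<partial>lborel) *
      (\<integral>\<^sup>+y\<in>{0<..<1}. ennreal (y powr (u1 + u3 - 1) * (1 - y) powr (u4 + u5 - 1) * (1 + y * \<sigma>) powr (-(u1 + u4))) \<partial>lborel)) *
      indicator {0<..} \<sigma> = (\<integral>\<^sup>+x. \<integral>\<^sup>+y. F \<sigma> x y \<partial>lborel \<partial>lborel)"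
      by (simp add: X_def Y_def mult_ac)
  qed
  also have "\<dots> = (\<integral>\<^sup>+x. \<integral>\<^sup>+\<sigma>. \<integral>\<^sup>+y. F \<sigma> x y \<partial>lborel \<partial>lborel \<partial>lborel)"
    by (rule nn_integral_lborel_swap) measurable
  also have "\<dots> = (\<integral>\<^sup>+x. \<integral>\<^sup>+y. \<integral>\<^sup>+\<sigma>. F \<sigma> x y \<partial>lborel \<partial>lborel \<partial>lborel)"
    by (intro nn_integral_cong nn_integral_lborel_swap) measurable
  also have "\<dots> = (\<integral>\<^sup>+x\<in>{0<..<1}. (\<integral>\<^sup>+y\<in>{0<..<1}. Phi_int u1 u2 u3 u4 u5 u6 x y \<partial>lborel) \<partial>lborel)"
  proof (rule nn_integral_cong)
    fix x :: real
    have "(\<integral>\<^sup>+\<sigma>. F \<sigma> x y \<partial>lborel) = Phi_int u1 u2 u3 u4 u5 u6 x y * indicator {0<..<1} y * indicator {0<..<1} x" for y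
    proof -
      define G where "G \<sigma> = ennreal (Phi u1 u2 u3 u4 u5 u6 \<sigma> x y) * indicator {0<..} \<sigma>" for \<sigma>
      have "F \<sigma> x y = G \<sigma> * (indicator {0<..<1} y * indicator {0<..<1} x)" for \<sigma>
        by (simp add: F_def G_def mult_ac)
      moreover have "G \<in> borel_measurable borel" unfolding G_def by measurable
      ultimately have "(\<integral>\<^sup>+\<sigma>. F \<sigma> x y \<partial>lborel) = (\<integral>\<^sup>+\<sigma>. G \<sigma> \<partial>lborel) * (indicator {0<..<1} y * indicator {0<..<1} x)"
        by (simp add: nn_integral_multc)
      then show ?thesis by (simp add: Phi_int_def G_def mult.assoc)
    qed
    then show "(\<integral>\<^sup>+y. \<integral>\<^sup>+\<sigma>. F \<sigma> x y \<partial>lborel \<partial>lborel) =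
        (\<integral>\<^sup>+y\<in>{0<..<1}. Phi_int u1 u2 u3 u4 u5 u6 x y \<partial>lborel) * indicator {0<..<1} x"
      by (simp add: nn_integral_multc)
  qed
  finally show ?thesis .
qed

section \<open>Splitting the square along the diagonal\<close>

definition D_low :: "real \<Rightarrow> real \<Rightarrow> real \<Rightarrow> real \<Rightarrow> real \<Rightarrow> real \<Rightarrow> ennreal" where
  "D_low u1 u2 u3 u4 u5 u6 =
     (\<integral>\<^sup>+x\<in>{0<..<1}. (\<integral>\<^sup>+y\<in>{0<..<x}. Phi_int u1 u2 u3 u4 u5 u6 x y \<partial>lborel) \<partial>lborel)"

text \<open>Putting \<open>\<sigma> = 1 / (x * y * s)\<close> turns \<open>1 + x * \<sigma>\<close>
  into \<open>(1 + y * s) / (y * s)\<close> and likewise with \<open>x\<close> and \<open>y\<close>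
  exchanged. The two halves of the integrand trade places, and so do the triples
  \<open>u1, u2, u3\<close> and \<open>u4, u5, u6\<close>.\<close>

lemma Phi_inversion:
  assumes "0 < s" "0 < x" "x < 1" "0 < y" "y < 1"
  shows "\<bar>- (1 / (x * y * s\<^sup>2))\<bar> * Phi u1 u2 u3 u4 u5 u6 (1 / (x * y * s)) x y = Phi u4 u5 u6 u1 u2 u3 s y x"
proof -
  \<comment> \<open>Every power is written as \<open>exp\<close> of a multiple of a logarithm, after
    which the claim is an equality of linear forms in the logarithms.\<close>
  define w where "w = ln (1 + y * s)"
  define w' where "w' = ln (1 + x * s)"
  have ys: "1 + y * s > 0" "1 + x * s > 0" using assms by (simp_all add: add_pos_pos)
  have e1: "1 + x * (1 / (x * y * s)) = (1 + y * s) / (y * s)"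
    "1 + y * (1 / (x * y * s)) = (1 + x * s) / (x * s)"
    using assms by (simp_all add: field_simps)
  have l: "ln (1 / (x * y * s)) = - ln x - ln y - ln s" "ln ((1 + y * s) / (y * s)) = w - ln y - ln s"
    "ln ((1 + x * s) / (x * s)) = w' - ln x - ln s"
    using assms ys by (simp_all add: ln_div ln_mult w_def w'_def)
  have "1 / (x * y * s\<^sup>2) = exp (ln (1 / (x * y * s\<^sup>2)))" using assms by simp
  also have "ln (1 / (x * y * s\<^sup>2)) = - ln x - ln y - 2 * ln s"
    using assms by (simp add: ln_div ln_mult ln_realpow)
  finally have j: "\<bar>- (1 / (x * y * s\<^sup>2))\<bar> = exp (- ln x - ln y - 2 * ln s)" using assms by simp
  have nz: "x \<noteq> 0" "y \<noteq> 0" "s \<noteq> 0" "1 - x \<noteq> 0" "1 - y \<noteq> 0" "1 / (x * y * s) \<noteq> 0"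
    "(1 + y * s) / (y * s) \<noteq> 0" "(1 + x * s) / (x * s) \<noteq> 0" "1 + y * s \<noteq> 0" "1 + x * s \<noteq> 0"
    using assms ys by auto
  show ?thesis
    unfolding Phi_def e1 j powr_def if_not_P[OF nz(1)] if_not_P[OF nz(2)] if_not_P[OF nz(3)] if_not_P[OF nz(4)]
      if_not_P[OF nz(5)] if_not_P[OF nz(6)] if_not_P[OF nz(7)] if_not_P[OF nz(8)] if_not_P[OF nz(9)] if_not_P[OF nz(10)]
      l exp_add[symmetric] w_def[symmetric] w'_def[symmetric]
    by (rule arg_cong[of _ _ exp]) (simp add: algebra_simps)
qed

lemma Phi_int_inversion:
  assumes "0 < x" "x < 1" "0 < y" "y < 1"
  shows "Phi_int u1 u2 u3 u4 u5 u6 x y = Phi_int u4 u5 u6 u1 u2 u3 y x"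
proof -
  define g where "g s = 1 / (x * y * s)" for s :: real
  have "g (g s) = s" "g s > 0" if "s > 0" for s using that assms by (simp_all add: g_def)
  then have img: "g ` {0<..} = {0<..}"
    by (auto simp: image_iff) (metis greaterThan_iff)
  have inj: "inj_on g {0<..}" using \<open>\<And>s. s > 0 \<Longrightarrow> g (g s) = s\<close> by (metis greaterThan_iff inj_onI)
  have der: "(g has_field_derivative - (1 / (x * y * s\<^sup>2))) (at s within {0<..})" if "s \<in> {0<..}" for s
    unfolding g_def using that assms
    by (auto intro!: derivative_eq_intros simp: field_simps power2_eq_square)
  have "(\<integral>\<^sup>+\<sigma>\<in>g ` {0<..}. ennreal (Phi u1 u2 u3 u4 u5 u6 \<sigma> x y) \<partial>lborel) =
      (\<integral>\<^sup>+s\<in>{0<..}. ennreal (\<bar>- (1 / (x * y * s\<^sup>2))\<bar> * Phi u1 u2 u3 u4 u5 u6 (g s) x y) \<partial>lborel)"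
    by (rule nn_integral_change_of_variable[OF _ _ _ _ der inj Phi_nonneg]) (simp_all add: img, simp_all add: g_def)
  also have "\<dots> = Phi_int u4 u5 u6 u1 u2 u3 y x"
    unfolding Phi_int_def
  proof (rule nn_integral_cong)
    fix s :: real
    show "ennreal (\<bar>- (1 / (x * y * s\<^sup>2))\<bar> * Phi u1 u2 u3 u4 u5 u6 (g s) x y) * indicator {0<..} s
      = ennreal (Phi u4 u5 u6 u1 u2 u3 s y x) * indicator {0<..} s"
      using Phi_inversion[of s x y u1 u2 u3 u4 u5 u6] assms by (cases "s > 0") (auto simp: g_def)
  qed
  finally show ?thesis by (simp add: img Phi_int_def)
qed

text \<open>The indicator of the half \<open>y < x\<close> as a weight on the whole plane: both
  halves of the square are then integrals over fixed domains, and the order of integration can be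
  exchanged directly.\<close>

definition triangle :: "real \<Rightarrow> real \<Rightarrow> ennreal" where
  "triangle x y = (if 0 < x \<and> x < 1 \<and> 0 < y \<and> y < x then 1 else 0)"

lemma triangle_measurable [measurable (raw)]:
  assumes [measurable]: "g \<in> borel_measurable M" "h \<in> borel_measurable M"
  shows "(\<lambda>w. triangle (g w) (h w)) \<in> borel_measurable M"
  unfolding triangle_def by measurable

lemma D_low_eq_triangle:
  "D_low u1 u2 u3 u4 u5 u6 = (\<integral>\<^sup>+x. \<integral>\<^sup>+y. Phi_int u1 u2 u3 u4 u5 u6 x y * triangle x y \<partial>lborel \<partial>lborel)"
  unfolding D_low_def
proof (rule nn_integral_cong)
  fix x :: real
  show "(\<integral>\<^sup>+y\<in>{0<..<x}. Phi_int u1 u2 u3 u4 u5 u6 x y \<partial>lborel) * indicator {0<..<1} x =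
      (\<integral>\<^sup>+y. Phi_int u1 u2 u3 u4 u5 u6 x y * triangle x y \<partial>lborel)"
  proof (cases "x \<in> {0<..<1}")
    case True
    then have "triangle x y = indicator {0<..<x} y" for y by (simp add: triangle_def indicator_def)
    then show ?thesis using True by simp
  next
    case False
    then have "triangle x y = 0" for y by (auto simp: triangle_def)
    then show ?thesis using False by simp
  qed
qed

text \<open>The diagonal is a null set, and the inversion of \<open>\<sigma>\<close> carries the
  half \<open>x < y\<close> to the half \<open>y < x\<close> with the two triples exchanged.\<close>

lemma D_int_split: "D_int u1 u2 u3 u4 u5 u6 = D_low u1 u2 u3 u4 u5 u6 + D_low u4 u5 u6 u1 u2 u3"
proof -
  let ?P = "Phi_int u1 u2 u3 u4 u5 u6"
  have "D_int u1 u2 u3 u4 u5 u6 = (\<integral>\<^sup>+x. (\<integral>\<^sup>+y. ?P x y * triangle x y \<partial>lborel) + (\<integral>\<^sup>+y. ?P x y * triangle y x \<partial>lborel) \<partial>lborel)"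
    unfolding D_int_eq_Phi_int
  proof (rule nn_integral_cong)
    fix x :: real
    have "(\<integral>\<^sup>+y\<in>{0<..<1}. ?P x y \<partial>lborel) * indicator {0<..<1} x =
        (\<integral>\<^sup>+y. ?P x y * triangle x y + ?P x y * triangle y x \<partial>lborel)"
    proof (cases "x \<in> {0<..<1}")
      case True
      have "(\<integral>\<^sup>+y\<in>{0<..<1}. ?P x y \<partial>lborel) = (\<integral>\<^sup>+y. ?P x y * triangle x y + ?P x y * triangle y x \<partial>lborel)"
      proof (rule nn_integral_cong_AE)
        show "AE y in lborel. ?P x y * indicator {0<..<1} y = ?P x y * triangle x y + ?P x y * triangle y x"
          using AE_lborel_singleton[of x]
        proof eventually_elim
          case (elim y)
          then have "indicator {0<..<1} y = triangle x y + triangle y x"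
            using True by (auto simp: triangle_def indicator_def)
          then show ?case by (simp only: distrib_left)
        qed
      qed
      then show ?thesis using True by simp
    next
      case False
      then have "triangle x y = 0" "triangle y x = 0" for y by (auto simp: triangle_def)
      then show ?thesis using False by simp
    qed
    also have "\<dots> = (\<integral>\<^sup>+y. ?P x y * triangle x y \<partial>lborel) + (\<integral>\<^sup>+y. ?P x y * triangle y x \<partial>lborel)"
      by (rule nn_integral_add) measurable
    finally show "(\<integral>\<^sup>+y\<in>{0<..<1}. ?P x y \<partial>lborel) * indicator {0<..<1} x =
        (\<integral>\<^sup>+y. ?P x y * triangle x y \<partial>lborel) + (\<integral>\<^sup>+y. ?P x y * triangle y x \<partial>lborel)" .
  qed
  also have "\<dots> = D_low u1 u2 u3 u4 u5 u6 + (\<integral>\<^sup>+x. \<integral>\<^sup>+y. ?P x y * triangle y x \<partial>lborel \<partial>lborel)"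
    unfolding D_low_eq_triangle by (rule nn_integral_add) measurable
  also have "(\<integral>\<^sup>+x. \<integral>\<^sup>+y. ?P x y * triangle y x \<partial>lborel \<partial>lborel) =
      (\<integral>\<^sup>+y. \<integral>\<^sup>+x. ?P x y * triangle y x \<partial>lborel \<partial>lborel)"
    by (rule nn_integral_lborel_swap) measurable
  also have "\<dots> = D_low u4 u5 u6 u1 u2 u3"
    unfolding D_low_eq_triangle
  proof (intro nn_integral_cong)
    fix x y :: real
    show "?P x y * triangle y x = Phi_int u4 u5 u6 u1 u2 u3 y x * triangle y x"
      using Phi_int_inversion[of x y u1 u2 u3 u4 u5 u6] by (auto simp: triangle_def)
  qed
  finally show ?thesis .
qed

section \<open>Evaluation of one half as a hypergeometric series\<close>

lemma Phi_scaling: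
  assumes "0 < x" "x < 1" "0 < z" "z < 1" "0 < \<rho>"
  shows "Phi u1 u2 u3 u4 u5 u6 (\<rho> / x) x (x * z) =
    (z powr (u1 + u3 - 1)) * ((x powr (u3 + u6 - 1) * (1 - x) powr (u1 + u2 - 1) * (1 - x * z) powr (u4 + u5 - 1)) *
     (\<rho> powr (u1 + u5 - 1) * (1 + \<rho>) powr (-(u2 + u5)) * (1 + z * \<rho>) powr (-(u1 + u4))))"
proof -
  have e: "x powr (u3 + u6 - 1) = x powr (u5 + u6 - 1) * x powr (u1 + u3 - 1) / x powr (u1 + u5 - 1)"
    using assms by (simp add: powr_add[symmetric] powr_diff[symmetric] algebra_simps)
  show ?thesis
    unfolding Phi_def e using assms by (simp add: powr_divide powr_mult mult_ac)
qed

text \<open>The substitution \<open>x = (1 - t) / (1 - t * z)\<close> is an involution of the unit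
  interval; this is Euler's transformation for integrals. In \<open>D_low_series\<close> it replaces
  the exponent \<open>u4 + u5 - 1\<close> by \<open>- a\<close>, where \<open>a\<close> is the sum
  of the \<open>u\<close> minus 1. This produces the factor \<open>pochhammer a k\<close> of the
  series in \<open>K\<close>.\<close>

lemma nn_integral_unit_Moebius:
  assumes "0 < z" "z < 1"
  shows "(\<integral>\<^sup>+x\<in>{0<..<1}. ennreal (x powr (p - 1) * (1 - x) powr (q - 1) * (1 - x * z) powr (r - 1)) \<partial>lborel) =
    ennreal ((1 - z) powr (q + r - 1)) *
    (\<integral>\<^sup>+x\<in>{0<..<1}. ennreal (x powr (q - 1) * (1 - x) powr (p - 1) * (1 - x * z) powr (-(p + q + r - 1))) \<partial>lborel)"
proof -
  define g where "g t = (1 - t) / (1 - t * z)" for t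
  define f where "f x = x powr (p - 1) * (1 - x) powr (q - 1) * (1 - x * z) powr (r - 1)" for x
  have den: "1 - t * z > 0" if "t \<in> {0<..<1}" for t
    using mult_strict_mono[of t 1 z 1] that assms by auto
  have comp: "1 - g t = t * (1 - z) / (1 - t * z)" "1 - g t * z = (1 - z) / (1 - t * z)" if "t \<in> {0<..<1}" for t
    using den[OF that] by (simp_all add: g_def field_simps)
  have g01: "g t \<in> {0<..<1}" and inv: "g (g t) = t" if t: "t \<in> {0<..<1}" for t
  proof -
    have "g t > 0" using den[OF t] t by (simp add: g_def)
    moreover have "1 - g t > 0" unfolding comp[OF t] using den[OF t] t assms by simp
    ultimately show "g t \<in> {0<..<1}" by simp
    have "g (g t) = (1 - g t) / (1 - g t * z)" by (simp add: g_def)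
    also have "\<dots> = t" unfolding comp[OF t] using den[OF t] assms by simp
    finally show "g (g t) = t" .
  qed
  have img: "g ` {0<..<1} = {0<..<1}"
    using g01 inv by (auto simp: image_iff simp del: greaterThanLessThan_iff) metis
  have inj: "inj_on g {0<..<1}" using inv by (metis inj_onI)
  have der: "(g has_field_derivative - ((1 - z) / (1 - t * z)\<^sup>2)) (at t within {0<..<1})" if "t \<in> {0<..<1}" for t
  proof -
    have "(g has_field_derivative ((-1) * (1 - t * z) - (1 - t) * (- z)) / ((1 - t * z) * (1 - t * z))) (at t within {0<..<1})"
      unfolding g_def using den[OF that] by (auto intro!: derivative_eq_intros)
    also have "(-1) * (1 - t * z) - (1 - t) * (- z) = - (1 - z)" by (simp add: algebra_simps)
    finally show ?thesis by (simp only: power2_eq_square minus_divide_left)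
  qed
  have [measurable]: "f \<in> borel_measurable borel" "g \<in> borel_measurable borel"
    unfolding f_def g_def by measurable
  have meas: "(\<lambda>t. \<bar>- ((1 - z) / (1 - t * z)\<^sup>2)\<bar> * f (g t)) \<in> borel_measurable borel" by measurable
  have f0: "f x \<ge> 0" for x by (simp add: f_def)
  have "(\<integral>\<^sup>+x\<in>g ` {0<..<1}. ennreal (f x) \<partial>lborel) =
      (\<integral>\<^sup>+t\<in>{0<..<1}. ennreal (\<bar>- ((1 - z) / (1 - t * z)\<^sup>2)\<bar> * f (g t)) \<partial>lborel)"
    by (rule nn_integral_change_of_variable[OF _ _ _ meas der inj f0]) (simp_all add: img)
  also have "\<dots> = (\<integral>\<^sup>+x. ennreal ((1 - z) powr (q + r - 1)) *
    (ennreal (x powr (q - 1) * (1 - x) powr (p - 1) * (1 - x * z) powr (-(p + q + r - 1))) * indicator {0<..<1} x) \<partial>lborel)"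
  proof (rule nn_integral_cong)
    fix t :: real
    show "ennreal (\<bar>- ((1 - z) / (1 - t * z)\<^sup>2)\<bar> * f (g t)) * indicator {0<..<1} t =
      ennreal ((1 - z) powr (q + r - 1)) *
      (ennreal (t powr (q - 1) * (1 - t) powr (p - 1) * (1 - t * z) powr (-(p + q + r - 1))) * indicator {0<..<1} t)"
    proof (cases "t \<in> {0<..<1}")
      case True
      define w where "w = 1 - t * z"
      have w: "w > 0" using den[OF True] by (simp add: w_def)
      have pos: "t > 0" "1 - t > 0" "1 - z > 0" using True assms by auto
      have 1: "\<bar>- ((1 - z) / w\<^sup>2)\<bar> = (1 - z) powr 1 * w powr (-2)"
        using w pos by (simp add: powr_minus_divide powr_numeral)
      have 2: "(1 - z) powr 1 * (1 - z) powr (q - 1) * (1 - z) powr (r - 1) = (1 - z) powr (q + r - 1)"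
        using pos by (simp only: powr_add[symmetric]) (simp add: algebra_simps)
      have 3: "w powr (-2) / (w powr (p - 1) * w powr (q - 1) * w powr (r - 1)) = w powr (-(p + q + r - 1))"
        using w by (simp only: powr_add[symmetric] powr_diff[symmetric]) (simp add: algebra_simps)
      have "f (g t) = ((1 - t) powr (p - 1) / w powr (p - 1)) * (t powr (q - 1) * (1 - z) powr (q - 1) / w powr (q - 1)) *
          ((1 - z) powr (r - 1) / w powr (r - 1))"
        unfolding f_def comp[OF True] w_def[symmetric]
        using pos w by (simp add: g_def w_def[symmetric] powr_divide powr_mult)
      then have "\<bar>- ((1 - z) / w\<^sup>2)\<bar> * f (g t) =
          ((1 - z) powr 1 * (1 - z) powr (q - 1) * (1 - z) powr (r - 1)) *
          (t powr (q - 1) * (1 - t) powr (p - 1) * (w powr (-2) / (w powr (p - 1) * w powr (q - 1) * w powr (r - 1))))"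
        unfolding 1 by (simp add: mult_ac)
      then show ?thesis
        unfolding 2 3 using True by (simp add: w_def ennreal_mult)
    qed simp
  qed
  also have "\<dots> = ennreal ((1 - z) powr (q + r - 1)) *
    (\<integral>\<^sup>+x\<in>{0<..<1}. ennreal (x powr (q - 1) * (1 - x) powr (p - 1) * (1 - x * z) powr (-(p + q + r - 1))) \<partial>lborel)"
    by (rule nn_integral_cmult) measurable
  finally show ?thesis by (simp add: img f_def)
qed

lemma nn_integral_half_line_to_unit:
  assumes "0 < z" "z < 1"
  shows "(\<integral>\<^sup>+\<rho>\<in>{0<..}. ennreal (\<rho> powr (p - 1) * (1 + \<rho>) powr (-q) * (1 + z * \<rho>) powr (-r)) \<partial>lborel) =
    (\<integral>\<^sup>+t\<in>{0<..<1}. ennreal (t powr (p - 1) * (1 - t) powr (q + r - p - 1) * (1 - t * (1 - z)) powr (-r)) \<partial>lborel)"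
proof -
  define g where "g t = t / (1 - t)" for t :: real
  define f where "f \<rho> = \<rho> powr (p - 1) * (1 + \<rho>) powr (-q) * (1 + z * \<rho>) powr (-r)" for \<rho>
  have img: "g ` {0<..<1} = {0<..}"
  proof (intro equalityI subsetI)
    fix y :: real assume "y \<in> {0<..}"
    then have "y = g (y / (1 + y))" "y / (1 + y) \<in> {0<..<1}" by (auto simp: g_def field_simps)
    then show "y \<in> g ` {0<..<1}" by blast
  qed (auto simp: g_def)
  have inj: "inj_on g {0<..<1}" by (auto simp: inj_on_def g_def field_simps)
  have der: "(g has_field_derivative (1 / (1 - t)\<^sup>2)) (at t within {0<..<1})" if "t \<in> {0<..<1}" for t
  proof -
    have "(g has_field_derivative (1 * (1 - t) - t * (-1)) / ((1 - t) * (1 - t))) (at t within {0<..<1})"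
      unfolding g_def using that by (auto intro!: derivative_eq_intros)
    then show ?thesis by (simp add: power2_eq_square)
  qed
  have [measurable]: "f \<in> borel_measurable borel" "g \<in> borel_measurable borel"
    unfolding f_def g_def by measurable
  have meas: "(\<lambda>t. \<bar>1 / (1 - t)\<^sup>2\<bar> * f (g t)) \<in> borel_measurable borel" by measurable
  have f0: "f x \<ge> 0" for x by (simp add: f_def)
  have "(\<integral>\<^sup>+x\<in>g ` {0<..<1}. ennreal (f x) \<partial>lborel) =
      (\<integral>\<^sup>+t\<in>{0<..<1}. ennreal (\<bar>1 / (1 - t)\<^sup>2\<bar> * f (g t)) \<partial>lborel)"
    by (rule nn_integral_change_of_variable[OF _ _ _ meas der inj f0]) (simp_all add: img)
  also have "\<dots> = (\<integral>\<^sup>+t\<in>{0<..<1}. ennreal (t powr (p - 1) * (1 - t) powr (q + r - p - 1) * (1 - t * (1 - z)) powr (-r)) \<partial>lborel)"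
  proof (rule nn_integral_cong)
    fix t :: real
    show "ennreal (\<bar>1 / (1 - t)\<^sup>2\<bar> * f (g t)) * indicator {0<..<1} t =
      ennreal (t powr (p - 1) * (1 - t) powr (q + r - p - 1) * (1 - t * (1 - z)) powr (-r)) * indicator {0<..<1} t"
    proof (cases "t \<in> {0<..<1}")
      case True
      define w where "w = 1 - t"
      have w: "w > 0" and t: "t > 0" using True by (simp_all add: w_def)
      have d: "1 - t * (1 - z) > 0" using mult_strict_mono[of t 1 "1 - z" 1] True assms by auto
      have c: "1 + g t = 1 / w" "1 + z * g t = (1 - t * (1 - z)) / w"
        using w by (simp_all add: g_def w_def field_simps)
      have 1: "\<bar>1 / w\<^sup>2\<bar> = w powr (-2)"
        using w by (simp add: powr_minus_divide powr_numeral)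
      have 2: "w powr (-2) / (w powr (p - 1) * w powr (-q) * w powr (-r)) = w powr (q + r - p - 1)"
        using w by (simp only: powr_add[symmetric] powr_diff[symmetric]) (simp add: algebra_simps)
      have "f (g t) = (t powr (p - 1) / w powr (p - 1)) * (1 / w powr (-q)) * ((1 - t * (1 - z)) powr (-r) / w powr (-r))"
        unfolding f_def c using w d t by (simp add: g_def w_def[symmetric] powr_divide)
      then have "\<bar>1 / w\<^sup>2\<bar> * f (g t) = t powr (p - 1) * (w powr (-2) / (w powr (p - 1) * w powr (-q) * w powr (-r))) *
          (1 - t * (1 - z)) powr (-r)"
        unfolding 1 by simp
      then show ?thesis unfolding 2 by (simp add: w_def)
    qed simp
  qed
  finally show ?thesis by (simp add: img f_def)
qed

text \<open>With \<open>y = x * z\<close> and \<open>\<sigma> = \<rho> / x\<close> the sums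
  \<open>1 + x * \<sigma>\<close> and \<open>1 + y * \<sigma>\<close> become
  \<open>1 + \<rho>\<close> and \<open>1 + z * \<rho>\<close>, so for fixed \<open>z\<close> the
  integrals over \<open>x\<close> and \<open>\<rho>\<close> separate. The Jacobians \<open>x\<close>
  and \<open>1 / x\<close> cancel.\<close>

lemma D_low_eq_unit_integral:
  "D_low u1 u2 u3 u4 u5 u6 = (\<integral>\<^sup>+z\<in>{0<..<1}. ennreal (z powr (u1 + u3 - 1)) *
     ((\<integral>\<^sup>+x\<in>{0<..<1}. ennreal (x powr (u3 + u6 - 1) * (1 - x) powr (u1 + u2 - 1) * (1 - x * z) powr (u4 + u5 - 1)) \<partial>lborel) *
      (\<integral>\<^sup>+\<rho>\<in>{0<..}. ennreal (\<rho> powr (u1 + u5 - 1) * (1 + \<rho>) powr (-(u2 + u5)) * (1 + z * \<rho>) powr (-(u1 + u4))) \<partial>lborel)) \<partial>lborel)"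
proof -
  define X where "X x z = ennreal (x powr (u3 + u6 - 1) * (1 - x) powr (u1 + u2 - 1) * (1 - x * z) powr (u4 + u5 - 1)) * indicator {0<..<1} x" for x z
  define h where "h z = (\<integral>\<^sup>+\<rho>\<in>{0<..}. ennreal (\<rho> powr (u1 + u5 - 1) * (1 + \<rho>) powr (-(u2 + u5)) * (1 + z * \<rho>) powr (-(u1 + u4))) \<partial>lborel)" for z
  define Z where "Z z = ennreal (z powr (u1 + u3 - 1)) * indicator {0<..<1} z" for z :: real
  have [measurable]: "h \<in> borel_measurable borel" "Z \<in> borel_measurable borel"
    unfolding h_def Z_def by measurable
  have [measurable (raw)]: "(\<lambda>w. X (f w) (g w)) \<in> borel_measurable M"
    if [measurable]: "f \<in> borel_measurable M" "g \<in> borel_measurable M" for f g and M :: "'m measure"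
    unfolding X_def by measurable
  have "D_low u1 u2 u3 u4 u5 u6 = (\<integral>\<^sup>+x. \<integral>\<^sup>+z. X x z * (Z z * h z) \<partial>lborel \<partial>lborel)"
    unfolding D_low_def
  proof (rule nn_integral_cong)
    fix x :: real
    show "(\<integral>\<^sup>+y\<in>{0<..<x}. Phi_int u1 u2 u3 u4 u5 u6 x y \<partial>lborel) * indicator {0<..<1} x =
        (\<integral>\<^sup>+z. X x z * (Z z * h z) \<partial>lborel)"
    proof (cases "x \<in> {0<..<1}")
      case True
      then have x: "0 < x" "x < 1" by auto
      have "(\<integral>\<^sup>+y\<in>{0<..<x}. Phi_int u1 u2 u3 u4 u5 u6 x y \<partial>lborel) =
          ennreal \<bar>x\<bar> * (\<integral>\<^sup>+z. Phi_int u1 u2 u3 u4 u5 u6 x (0 + x * z) * indicator {0<..<x} (0 + x * z) \<partial>lborel)"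
        by (rule nn_integral_real_affine) (use x in auto)
      also have "\<dots> = ennreal x * (\<integral>\<^sup>+z. ennreal (1 / x) * (X x z * (Z z * h z)) \<partial>lborel)"
      proof -
        have "Phi_int u1 u2 u3 u4 u5 u6 x (0 + x * z) * indicator {0<..<x} (0 + x * z) =
            ennreal (1 / x) * (X x z * (Z z * h z))" for z
        proof (cases "z \<in> {0<..<1}")
          case z: True
          have "Phi_int u1 u2 u3 u4 u5 u6 x (x * z) =
              ennreal \<bar>1 / x\<bar> * (\<integral>\<^sup>+\<rho>. ennreal (Phi u1 u2 u3 u4 u5 u6 (0 + 1 / x * \<rho>) x (x * z)) * indicator {0<..} (0 + 1 / x * \<rho>) \<partial>lborel)"
            unfolding Phi_int_def by (rule nn_integral_real_affine) (use x in auto)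
          also have "\<dots> = ennreal (1 / x) * (\<integral>\<^sup>+\<rho>. (X x z * Z z) *
             (ennreal (\<rho> powr (u1 + u5 - 1) * (1 + \<rho>) powr (-(u2 + u5)) * (1 + z * \<rho>) powr (-(u1 + u4))) * indicator {0<..} \<rho>) \<partial>lborel)"
          proof -
            have "ennreal (Phi u1 u2 u3 u4 u5 u6 (0 + 1 / x * \<rho>) x (x * z)) * indicator {0<..} (0 + 1 / x * \<rho>) =
                (X x z * Z z) *
               (ennreal (\<rho> powr (u1 + u5 - 1) * (1 + \<rho>) powr (-(u2 + u5)) * (1 + z * \<rho>) powr (-(u1 + u4))) * indicator {0<..} \<rho>)" for \<rho>
            proof (cases "\<rho> > 0")
              case \<rho>: True
              have "Phi u1 u2 u3 u4 u5 u6 (0 + 1 / x * \<rho>) x (x * z) =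
                (z powr (u1 + u3 - 1)) * ((x powr (u3 + u6 - 1) * (1 - x) powr (u1 + u2 - 1) * (1 - x * z) powr (u4 + u5 - 1)) *
                 (\<rho> powr (u1 + u5 - 1) * (1 + \<rho>) powr (-(u2 + u5)) * (1 + z * \<rho>) powr (-(u1 + u4))))"
                using Phi_scaling[of x z \<rho> u1 u2 u3 u4 u5 u6] x z \<rho> by simp
              then show ?thesis using True z \<rho> x unfolding X_def Z_def by (simp add: ennreal_mult mult_ac)
            next
              case False
              then have "0 + 1 / x * \<rho> \<le> 0" using x by (simp add: divide_le_0_iff)
              then show ?thesis using False by simp
            qed
            then show ?thesis using x by simp
          qed
          also have "\<dots> = ennreal (1 / x) * ((X x z * Z z) * h z)"
            unfolding h_def by (subst nn_integral_cmult) simp_all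
          finally show ?thesis using z x by (simp add: mult.assoc)
        next
          case False
          then have "\<not> (0 < x * z \<and> x * z < x)" using x by (auto simp: zero_less_mult_iff)
          then show ?thesis using False by (simp add: Z_def)
        qed
        then show ?thesis using x by simp
      qed
      also have "\<dots> = ennreal x * (ennreal (1 / x) * (\<integral>\<^sup>+z. X x z * (Z z * h z) \<partial>lborel))"
        by (subst nn_integral_cmult) simp_all
      also have "\<dots> = (\<integral>\<^sup>+z. X x z * (Z z * h z) \<partial>lborel)"
        using x by (simp add: mult.assoc[symmetric] ennreal_mult[symmetric])
      finally show ?thesis using True by simp
    qed (simp add: X_def)
  qed
  also have "\<dots> = (\<integral>\<^sup>+z. \<integral>\<^sup>+x. X x z * (Z z * h z) \<partial>lborel \<partial>lborel)"
    by (rule nn_integral_lborel_swap) measurable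
  also have "\<dots> = (\<integral>\<^sup>+z. (\<integral>\<^sup>+x. X x z \<partial>lborel) * (Z z * h z) \<partial>lborel)"
    by (intro nn_integral_cong nn_integral_multc) measurable
  finally show ?thesis unfolding X_def Z_def h_def by (simp add: mult_ac)
qed

text \<open>Gauss's summation theorem, obtained by reading \<open>nn_integral_Euler_series\<close>
  backwards at \<open>v = 1\<close>: there the two powers of \<open>1 - x\<close> merge and leave a
  Beta integral, which converges because \<open>p + u2 - u1 > 0\<close>.\<close>

lemma suminf_Gauss:
  assumes "u1 > 0" "u2 > 0" "u4 > 0" "u5 > 0" "p > 0" "p + u2 - u1 > 0"
  shows "(\<Sum>j. ennreal (pochhammer (u1 + u4) j / fact j * Beta (u1 + u5 + real j) (u2 + u4) *
            Beta p (u1 + u2 + u4 + u5 + real j))) =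
    ennreal (Gamma (u2 + u4) * Gamma (u1 + u5) * Gamma p * Gamma (p + u2 - u1) /
      (Gamma (p + u2 + u4) * Gamma (p + u2 + u5)))"
proof -
  define c where "c = Gamma (u2 + u4) * Gamma p / Gamma (p + u2 + u4)"
  have c: "c \<ge> 0" using assms by (simp add: c_def)
  have "(\<Sum>j. ennreal (pochhammer (u1 + u4) j / fact j * Beta (u1 + u5 + real j) (u2 + u4) *
            Beta p (u1 + u2 + u4 + u5 + real j))) =
     (\<Sum>j. ennreal c * ennreal (pochhammer (u1 + u4) j / fact j * 1 ^ j * Beta (u1 + u5 + real j) (p + u2 + u4)))"
  proof (rule suminf_cong)
    fix j
    define G where "G = Gamma (u1 + u2 + u4 + u5 + real j)"
    have G: "G > 0" using assms by (simp add: G_def)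
    have "Beta (u1 + u5 + real j) (u2 + u4) = Gamma (u1 + u5 + real j) * Gamma (u2 + u4) / G"
      by (simp add: Beta_def G_def add_ac)
    moreover have "Beta p (u1 + u2 + u4 + u5 + real j) = Gamma p * G / Gamma (p + u1 + u2 + u4 + u5 + real j)"
      by (simp add: Beta_def G_def add_ac)
    moreover have "Beta (u1 + u5 + real j) (p + u2 + u4) =
        Gamma (u1 + u5 + real j) * Gamma (p + u2 + u4) / Gamma (p + u1 + u2 + u4 + u5 + real j)"
      by (simp add: Beta_def add_ac)
    moreover have "Gamma (p + u2 + u4) > 0" using assms by simp
    ultimately have e: "pochhammer (u1 + u4) j / fact j * Beta (u1 + u5 + real j) (u2 + u4) *
            Beta p (u1 + u2 + u4 + u5 + real j) =
        c * (pochhammer (u1 + u4) j / fact j * 1 ^ j * Beta (u1 + u5 + real j) (p + u2 + u4))"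
      using G by (simp add: c_def)
    show "ennreal (pochhammer (u1 + u4) j / fact j * Beta (u1 + u5 + real j) (u2 + u4) *
            Beta p (u1 + u2 + u4 + u5 + real j)) =
      ennreal c * ennreal (pochhammer (u1 + u4) j / fact j * 1 ^ j * Beta (u1 + u5 + real j) (p + u2 + u4))"
      by (simp only: e ennreal_mult'[OF c])
  qed
  also have "\<dots> = ennreal c * (\<Sum>j. ennreal (pochhammer (u1 + u4) j / fact j * 1 ^ j * Beta (u1 + u5 + real j) (p + u2 + u4)))"
    by (rule ennreal_suminf_cmult)
  also have "(\<Sum>j. ennreal (pochhammer (u1 + u4) j / fact j * 1 ^ j * Beta (u1 + u5 + real j) (p + u2 + u4))) =
     (\<integral>\<^sup>+x\<in>{0<..<1}. ennreal (x powr (u1 + u5 - 1) * (1 - x) powr (p + u2 + u4 - 1) * (1 - x * 1) powr (-(u1 + u4))) \<partial>lborel)"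
    by (rule nn_integral_Euler_series[symmetric]) (use assms in auto)
  also have "\<dots> = (\<integral>\<^sup>+x\<in>{0<..<1}. ennreal (x powr (u1 + u5 - 1) * (1 - x) powr (p + u2 - u1 - 1)) \<partial>lborel)"
  proof (rule nn_integral_cong)
    fix x :: real
    have "(1 - x) powr (p + u2 + u4 - 1) * (1 - x * 1) powr (-(u1 + u4)) = (1 - x) powr (p + u2 - u1 - 1)" if "x < 1"
      using that by (simp add: powr_add[symmetric]) (simp add: algebra_simps)
    then show "ennreal (x powr (u1 + u5 - 1) * (1 - x) powr (p + u2 + u4 - 1) * (1 - x * 1) powr (-(u1 + u4))) * indicator {0<..<1} x =
        ennreal (x powr (u1 + u5 - 1) * (1 - x) powr (p + u2 - u1 - 1)) * indicator {0<..<1} x"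
      by (cases "x < 1") (simp_all add: mult.assoc)
  qed
  also have "\<dots> = ennreal (Beta (u1 + u5) (p + u2 - u1))"
    by (rule nn_integral_Beta) (use assms in auto)
  also have "ennreal c * \<dots> = ennreal (c * Beta (u1 + u5) (p + u2 - u1))"
    using c by (simp add: ennreal_mult')
  finally show ?thesis by (simp add: c_def Beta_def algebra_simps)
qed

text \<open>The \<open>k\<close>-th term of the first series of \<open>K\<close> in the variables
  \<open>u\<close>. Exchanging the triples \<open>u1, u2, u3\<close> and \<open>u4, u5, u6\<close>
  gives that of the second series.\<close>

definition K_term :: "real \<Rightarrow> real \<Rightarrow> real \<Rightarrow> real \<Rightarrow> real \<Rightarrow> real \<Rightarrow> nat \<Rightarrow> real" where
  "K_term u1 u2 u3 u4 u5 u6 k =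
     pochhammer (u1 + u2 + u3 + u4 + u5 + u6 - 1) k * pochhammer (u2 + u3) k * pochhammer (u1 + u3) k * pochhammer (u1 + u2) k /
     (fact k * Gamma (u1 + u2 + u3 + u4 + real k) * Gamma (u1 + u2 + u3 + u5 + real k) * Gamma (u1 + u2 + u3 + u6 + real k))"

text \<open>For fixed \<open>z\<close> the \<open>x\<close>-integral is a power series in
  \<open>z\<close> and the \<open>\<rho>\<close>-integral one in \<open>1 - z\<close>. Each product
  of powers integrates over \<open>z\<close> to a Beta value, and the sum over \<open>j\<close> is
  then evaluated by \<open>suminf_Gauss\<close>. The bound on the sum of the \<open>u\<close> makes
  \<open>a\<close>, and hence every coefficient \<open>C k\<close>, nonnegative.\<close>

lemma D_low_series:
  assumes pos: "u1 > 0" "u2 > 0" "u3 > 0" "u4 > 0" "u5 > 0" "u6 > 0" and sum: "u1 + u2 + u3 + u4 + u5 + u6 \<ge> 1"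
  shows "D_low u1 u2 u3 u4 u5 u6 = (\<Sum>k. ennreal (
    (Gamma (u1 + u2) * Gamma (u1 + u3) * Gamma (u2 + u3) * Gamma (u1 + u5) * Gamma (u2 + u4) * Gamma (u3 + u6)) *
     K_term u1 u2 u3 u4 u5 u6 k))"
proof -
  define a where "a = u1 + u2 + u3 + u4 + u5 + u6 - 1"
  have a: "a \<ge> 0" using sum by (simp add: a_def)
  define q where "q = u1 + u2 + u4 + u5"
  define C where "C k = pochhammer a k / fact k * Beta (u1 + u2 + real k) (u3 + u6)" for k
  define E where "E j = pochhammer (u1 + u4) j / fact j * Beta (u1 + u5 + real j) (u2 + u4)" for j
  have C: "C k \<ge> 0" for k using a pos
    by (auto simp: C_def intro!: mult_nonneg_nonneg divide_nonneg_nonneg pochhammer_nonneg_real less_imp_le[OF Beta_real_pos])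
  have E: "E j \<ge> 0" for j using pos
    by (auto simp: E_def intro!: mult_nonneg_nonneg divide_nonneg_nonneg pochhammer_nonneg_real less_imp_le[OF Beta_real_pos])
  define b where "b k j z = ennreal (C k * E j) * (ennreal (z powr (u1 + u3 + real k - 1) * (1 - z) powr (q + real j - 1)) * indicator {0<..<1} z)"
    for k j and z :: real
  have [measurable]: "b k j \<in> borel_measurable borel" for k j unfolding b_def by measurable
  have "D_low u1 u2 u3 u4 u5 u6 = (\<integral>\<^sup>+z. (\<Sum>k. \<Sum>j. b k j z) \<partial>lborel)"
    unfolding D_low_eq_unit_integral
  proof (rule nn_integral_cong)
    fix z :: real
    let ?psi = "\<integral>\<^sup>+x\<in>{0<..<1}. ennreal (x powr (u3 + u6 - 1) * (1 - x) powr (u1 + u2 - 1) * (1 - x * z) powr (u4 + u5 - 1)) \<partial>lborel"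
    let ?h = "\<integral>\<^sup>+\<rho>\<in>{0<..}. ennreal (\<rho> powr (u1 + u5 - 1) * (1 + \<rho>) powr (-(u2 + u5)) * (1 + z * \<rho>) powr (-(u1 + u4))) \<partial>lborel"
    show "ennreal (z powr (u1 + u3 - 1)) * (?psi * ?h) * indicator {0<..<1} z = (\<Sum>k. \<Sum>j. b k j z)"
    proof (cases "z \<in> {0<..<1}")
      case True
      then have z: "0 < z" "z < 1" by auto
      have psi: "?psi = ennreal ((1 - z) powr (q - 1)) * (\<Sum>k. ennreal (C k * z ^ k))"
      proof -
        have "?psi = ennreal ((1 - z) powr (u1 + u2 + (u4 + u5) - 1)) *
            (\<integral>\<^sup>+x\<in>{0<..<1}. ennreal (x powr (u1 + u2 - 1) * (1 - x) powr (u3 + u6 - 1) * (1 - x * z) powr (-a)) \<partial>lborel)"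
          using nn_integral_unit_Moebius[OF z, of "u3 + u6" "u1 + u2" "u4 + u5"] by (simp add: a_def algebra_simps)
        also have "(\<integral>\<^sup>+x\<in>{0<..<1}. ennreal (x powr (u1 + u2 - 1) * (1 - x) powr (u3 + u6 - 1) * (1 - x * z) powr (-a)) \<partial>lborel)
            = (\<Sum>k. ennreal (pochhammer a k / fact k * z ^ k * Beta (u1 + u2 + real k) (u3 + u6)))"
          by (rule nn_integral_Euler_series) (use a z pos in auto)
        finally show ?thesis by (simp add: q_def C_def mult_ac add_ac)
      qed
      have h: "?h = (\<Sum>j. ennreal (E j * (1 - z) ^ j))"
      proof -
        have "?h = (\<integral>\<^sup>+t\<in>{0<..<1}. ennreal (t powr (u1 + u5 - 1) * (1 - t) powr (u2 + u4 - 1) * (1 - t * (1 - z)) powr (-(u1 + u4))) \<partial>lborel)"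
          using nn_integral_half_line_to_unit[OF z, of "u1 + u5" "u2 + u5" "u1 + u4"] by (simp add: algebra_simps)
        also have "\<dots> = (\<Sum>j. ennreal (pochhammer (u1 + u4) j / fact j * (1 - z) ^ j * Beta (u1 + u5 + real j) (u2 + u4)))"
          by (rule nn_integral_Euler_series) (use z pos in auto)
        finally show ?thesis by (simp add: E_def mult_ac)
      qed
      define w where "w = z powr (u1 + u3 - 1) * (1 - z) powr (q - 1)"
      have w: "w \<ge> 0" by (simp add: w_def)
      have bkj: "b k j z = ennreal w * (ennreal (C k * z ^ k) * ennreal (E j * (1 - z) ^ j))" for k j
      proof -
        have "z powr (u1 + u3 + real k - 1) = z powr (u1 + u3 - 1) * z ^ k"
          "(1 - z) powr (q + real j - 1) = (1 - z) powr (q - 1) * (1 - z) ^ j"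
          using z by (simp_all add: powr_realpow[symmetric] powr_add[symmetric] algebra_simps)
        then show ?thesis
          using z C[of k] E[of j] True by (simp add: b_def w_def ennreal_mult[symmetric] mult_ac)
      qed
      have "(\<Sum>k. \<Sum>j. b k j z) = ennreal w * ((\<Sum>k. ennreal (C k * z ^ k)) * (\<Sum>j. ennreal (E j * (1 - z) ^ j)))"
        unfolding bkj by (simp only: ennreal_suminf_cmult ennreal_suminf_multc)
      then show ?thesis using True unfolding psi h w_def by (simp add: ennreal_mult mult_ac)
    qed (simp add: b_def)
  qed
  also have "\<dots> = (\<Sum>k. \<integral>\<^sup>+z. (\<Sum>j. b k j z) \<partial>lborel)"
    by (rule nn_integral_suminf) measurable
  also have "\<dots> = (\<Sum>k. \<Sum>j. \<integral>\<^sup>+z. b k j z \<partial>lborel)"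
    by (intro suminf_cong nn_integral_suminf) measurable
  also have "\<dots> = (\<Sum>k. \<Sum>j. ennreal (C k) * ennreal (E j * Beta (u1 + u3 + real k) (q + real j)))"
  proof (intro suminf_cong)
    fix k j
    have "(\<integral>\<^sup>+z. b k j z \<partial>lborel) = ennreal (C k * E j) * ennreal (Beta (u1 + u3 + real k) (q + real j))"
      unfolding b_def using pos
      by (subst nn_integral_cmult, simp, subst nn_integral_Beta) (auto simp: q_def intro!: add_pos_nonneg)
    also have "\<dots> = ennreal (C k) * ennreal (E j * Beta (u1 + u3 + real k) (q + real j))"
      using C[of k] E[of j] by (simp add: ennreal_mult' mult.assoc)
    finally show "(\<integral>\<^sup>+z. b k j z \<partial>lborel) = ennreal (C k) * ennreal (E j * Beta (u1 + u3 + real k) (q + real j))" .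
  qed
  also have "\<dots> = (\<Sum>k. ennreal (C k) * ennreal (Gamma (u2 + u4) * Gamma (u1 + u5) * Gamma (u1 + u3 + real k) * Gamma (u2 + u3 + real k) /
      (Gamma (u1 + u2 + u3 + u4 + real k) * Gamma (u1 + u2 + u3 + u5 + real k))))"
  proof (rule suminf_cong)
    fix k
    have "(\<Sum>j. ennreal (E j * Beta (u1 + u3 + real k) (q + real j))) =
       ennreal (Gamma (u2 + u4) * Gamma (u1 + u5) * Gamma (u1 + u3 + real k) * Gamma (u2 + u3 + real k) /
      (Gamma (u1 + u2 + u3 + u4 + real k) * Gamma (u1 + u2 + u3 + u5 + real k)))"
      using suminf_Gauss[of u1 u2 u4 u5 "u1 + u3 + real k"] pos by (simp add: E_def q_def algebra_simps)
    then show "(\<Sum>j. ennreal (C k) * ennreal (E j * Beta (u1 + u3 + real k) (q + real j))) = ennreal (C k) *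
      ennreal (Gamma (u2 + u4) * Gamma (u1 + u5) * Gamma (u1 + u3 + real k) * Gamma (u2 + u3 + real k) /
      (Gamma (u1 + u2 + u3 + u4 + real k) * Gamma (u1 + u2 + u3 + u5 + real k)))"
      by (simp add: ennreal_suminf_cmult)
  qed
  also have "\<dots> = (\<Sum>k. ennreal (
    (Gamma (u1 + u2) * Gamma (u1 + u3) * Gamma (u2 + u3) * Gamma (u1 + u5) * Gamma (u2 + u4) * Gamma (u3 + u6)) *
     K_term u1 u2 u3 u4 u5 u6 k))"
  proof (rule suminf_cong)
    fix k
    have "C k * (Gamma (u2 + u4) * Gamma (u1 + u5) * Gamma (u1 + u3 + real k) * Gamma (u2 + u3 + real k) /
      (Gamma (u1 + u2 + u3 + u4 + real k) * Gamma (u1 + u2 + u3 + u5 + real k))) =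
      (Gamma (u1 + u2) * Gamma (u1 + u3) * Gamma (u2 + u3) * Gamma (u1 + u5) * Gamma (u2 + u4) * Gamma (u3 + u6)) *
       K_term u1 u2 u3 u4 u5 u6 k"
      unfolding K_term_def a_def[symmetric] using Gamma_add_nat_real[of "u1 + u2" k] Gamma_add_nat_real[of "u1 + u3" k] Gamma_add_nat_real[of "u2 + u3" k] pos
      by (simp add: C_def Beta_def add_ac mult_ac)
    then show "ennreal (C k) * ennreal (Gamma (u2 + u4) * Gamma (u1 + u5) * Gamma (u1 + u3 + real k) * Gamma (u2 + u3 + real k) /
      (Gamma (u1 + u2 + u3 + u4 + real k) * Gamma (u1 + u2 + u3 + u5 + real k))) =
      ennreal ((Gamma (u1 + u2) * Gamma (u1 + u3) * Gamma (u2 + u3) * Gamma (u1 + u5) * Gamma (u2 + u4) * Gamma (u3 + u6)) *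
       K_term u1 u2 u3 u4 u5 u6 k)"
      using C[of k] by (simp add: ennreal_mult'[symmetric])
  qed
  finally show ?thesis .
qed

section \<open>The hidden symmetry of K\<close>

definition params4 :: "complex \<Rightarrow> complex \<Rightarrow> complex \<Rightarrow> complex \<Rightarrow> nat \<Rightarrow> complex" where
  "params4 a b c d i = [a, b, c, d] ! i"

lemma lessThan_4: "{..<4::nat} = {0, 1, 2, 3}"
  by auto

lemma less_4_iff: "i < 4 \<longleftrightarrow> i = 0 \<or> i = 1 \<or> i = 2 \<or> i = (3::nat)"
  by auto

lemma params4_simps [simp]: "params4 a b c d 0 = a" "params4 a b c d (Suc 0) = b" "params4 a b c d 2 = c" "params4 a b c d 3 = d"
  by (simp_all add: params4_def)

lemma balanced_params4: "balanced (params4 a b c d) (params4 1 e f g) \<longleftrightarrow> e + f + g - a - b - c - d = 1"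
proof -
  have "balanced (params4 a b c d) (params4 1 e f g) \<longleftrightarrow> 1 + e + f + g = a + b + c + d + 2"
    by (simp add: balanced_def lessThan_4 add_ac)
  also have "\<dots> \<longleftrightarrow> e + f + g - a - b - c - d = 1"
    by (rule iffI) (algebra+)
  finally show ?thesis .
qed

lemma hyp_term_params4:
  "hyp_term (params4 a b c d) (params4 1 e f g) k = pochhammer a k * pochhammer b k * pochhammer c k * pochhammer d k / fact k *
          (rGamma (of_nat k + e) * rGamma (of_nat k + f) * rGamma (of_nat k + g))"
proof -
  have "rGamma (1 + of_nat k :: complex) = 1 / fact k"
    by (simp add: rGamma_inverse_Gamma Gamma_fact field_simps)
  then show ?thesis by (simp add: hyp_term_def lessThan_4 mult_ac add_ac)
qed

lemma reg_F43_eq_hyp_term: "reg_F43 a b c d e f g = (\<Sum>k. hyp_term (params4 a b c d) (params4 1 e f g) k)"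
  by (simp add: reg_F43_def hyp_term_params4)

lemma reg_F43_holomorphic:
  assumes "a holomorphic_on UNIV" "b holomorphic_on UNIV" "c holomorphic_on UNIV" "d holomorphic_on UNIV"
    "e holomorphic_on UNIV" "f holomorphic_on UNIV" "g holomorphic_on UNIV"
    and "\<And>s. e s + f s + g s - a s - b s - c s - d s = 1"
  shows "(\<lambda>s. reg_F43 (a s) (b s) (c s) (d s) (e s) (f s) (g s)) holomorphic_on UNIV"
  unfolding reg_F43_eq_hyp_term
  by (rule holomorphic_suminf_hyp_term) (use assms in \<open>auto simp: less_4_iff balanced_params4\<close>)

definition Kf :: "complex \<Rightarrow> complex \<Rightarrow> complex \<Rightarrow> complex \<Rightarrow> complex \<Rightarrow> complex \<Rightarrow> complex \<Rightarrow> complex" where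
  "Kf a b c d e f g =
     reg_F43 a b c d e f g * (rGamma (1 + a - e) * rGamma (1 + a - f) * rGamma (1 + a - g)) +
     reg_F43 a (1 + a - e) (1 + a - f) (1 + a - g) (1 + a - b) (1 + a - c) (1 + a - d) *
       (rGamma b * rGamma c * rGamma d)"

lemma K_eq_Kf: "K (vector [a, b, c, d, e, f, g]) = Kf a b c d e f g"
  by (simp add: K_def Kf_def Let_def)

lemma Kf_holomorphic:
  assumes "a holomorphic_on UNIV" "b holomorphic_on UNIV" "c holomorphic_on UNIV" "d holomorphic_on UNIV"
    "e holomorphic_on UNIV" "f holomorphic_on UNIV" "g holomorphic_on UNIV"
    and bal: "\<And>s. e s + f s + g s - a s - b s - c s - d s = 1"
  shows "(\<lambda>s. Kf (a s) (b s) (c s) (d s) (e s) (f s) (g s)) holomorphic_on UNIV"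
proof -
  have "(1 + a s - b s) + (1 + a s - c s) + (1 + a s - d s) - a s - (1 + a s - e s) - (1 + a s - f s) - (1 + a s - g s) = 1" for s
    using bal[of s] by (simp add: algebra_simps)
  then show ?thesis
    unfolding Kf_def
    by (intro holomorphic_intros reg_F43_holomorphic holomorphic_rGamma' assms)
qed

lemma Kf_commute:
  "Kf a b c d e f g = Kf a b d c e f g" "Kf a b c d e f g = Kf a b c d f e g" "Kf a b c d e f g = Kf a b c d e g f"
proof -
  have 1: "reg_F43 a b c d e f g = reg_F43 a b d c e f g" "reg_F43 a b c d e f g = reg_F43 a c b d e f g"
    "reg_F43 a b c d e f g = reg_F43 a b c d f e g" "reg_F43 a b c d e f g = reg_F43 a b c d e g f" for a b c d e f g
    by (simp_all add: reg_F43_def mult_ac)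
  show "Kf a b c d e f g = Kf a b d c e f g"
    unfolding Kf_def using 1(1)[of a b c d e f g] 1(4)[of a "1 + a - e" "1 + a - f" "1 + a - g" "1 + a - b" "1 + a - c" "1 + a - d"]
    by (simp add: mult_ac)
  show "Kf a b c d e f g = Kf a b c d f e g"
    unfolding Kf_def using 1(3)[of a b c d e f g] 1(2)[of a "1 + a - e" "1 + a - f" "1 + a - g" "1 + a - b" "1 + a - c" "1 + a - d"]
    by (simp add: mult_ac)
  show "Kf a b c d e f g = Kf a b c d e g f"
    unfolding Kf_def using 1(4)[of a b c d e f g] 1(1)[of a "1 + a - e" "1 + a - f" "1 + a - g" "1 + a - b" "1 + a - c" "1 + a - d"]
    by (simp add: mult_ac)
qed

definition K_sym :: "complex \<Rightarrow> complex \<Rightarrow> complex \<Rightarrow> complex \<Rightarrow> complex \<Rightarrow> complex \<Rightarrow> complex" where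
  "K_sym u1 u2 u3 u4 u5 u6 = Kf (u1 + u2 + u3 + u4 + u5 + u6 - 1) (u2 + u3) (u1 + u3) (u1 + u2)
     (u1 + u2 + u3 + u4) (u1 + u2 + u3 + u5) (u1 + u2 + u3 + u6)"

lemma K_sym_holomorphic:
  assumes "u1 holomorphic_on UNIV" "u2 holomorphic_on UNIV" "u3 holomorphic_on UNIV" "u4 holomorphic_on UNIV"
    "u5 holomorphic_on UNIV" "u6 holomorphic_on UNIV"
  shows "(\<lambda>s. K_sym (u1 s) (u2 s) (u3 s) (u4 s) (u5 s) (u6 s)) holomorphic_on UNIV"
  unfolding K_sym_def by (intro Kf_holomorphic holomorphic_intros assms) (simp add: algebra_simps)

section \<open>The symmetry for positive real parameters\<close>

definition K_sym_real :: "real \<Rightarrow> real \<Rightarrow> real \<Rightarrow> real \<Rightarrow> real \<Rightarrow> real \<Rightarrow> real" where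
  "K_sym_real u1 u2 u3 u4 u5 u6 = (\<Sum>k. K_term u1 u2 u3 u4 u5 u6 k) / (Gamma (u4 + u5) * Gamma (u4 + u6) * Gamma (u5 + u6)) +
     (\<Sum>k. K_term u4 u5 u6 u1 u2 u3 k) / (Gamma (u1 + u2) * Gamma (u1 + u3) * Gamma (u2 + u3))"

lemma rGamma_of_real: "rGamma (of_real x :: complex) = of_real (inverse (Gamma x))"
  by (simp add: rGamma_inverse_Gamma Gamma_complex_of_real)

text \<open>The sum of the \<open>u\<close> enters as a separate \<open>s\<close>, so that both
  orders of the two triples yield literally the same first argument \<open>s - 1\<close>.\<close>

lemma
  assumes "u1 + u2 + u3 + u4 + u5 + u6 = s"
  shows summable_K_term: "summable (K_term u1 u2 u3 u4 u5 u6)"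
    and reg_F43_of_real: "reg_F43 (of_real (s - 1)) (of_real (u2 + u3)) (of_real (u1 + u3)) (of_real (u1 + u2))
      (of_real (u1 + u2 + u3 + u4)) (of_real (u1 + u2 + u3 + u5)) (of_real (u1 + u2 + u3 + u6)) =
      of_real (\<Sum>k. K_term u1 u2 u3 u4 u5 u6 k)"
proof -
  define h where "h = hyp_term (params4 (of_real (s - 1)) (of_real (u2 + u3)) (of_real (u1 + u3)) (of_real (u1 + u2)))
      (params4 1 (of_real (u1 + u2 + u3 + u4)) (of_real (u1 + u2 + u3 + u5)) (of_real (u1 + u2 + u3 + u6)))"
  have r: "rGamma (of_nat k + of_real x :: complex) = of_real (inverse (Gamma (x + real k)))" for x k
    using rGamma_of_real[of "x + real k"] by (simp add: add.commute)
  have h: "h k = of_real (K_term u1 u2 u3 u4 u5 u6 k)" for k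
    unfolding h_def hyp_term_params4 r pochhammer_of_real K_term_def assms
    by (simp add: field_simps)
  have "summable (\<lambda>k. norm (h k))"
    unfolding h_def by (rule summable_norm_hyp_term) (auto simp: balanced_params4 algebra_simps assms[symmetric])
  then have s: "summable (\<lambda>k. norm (K_term u1 u2 u3 u4 u5 u6 k))" by (simp add: h)
  then show *: "summable (K_term u1 u2 u3 u4 u5 u6)" by (simp add: summable_norm_cancel)
  show "reg_F43 (of_real (s - 1)) (of_real (u2 + u3)) (of_real (u1 + u3)) (of_real (u1 + u2))
      (of_real (u1 + u2 + u3 + u4)) (of_real (u1 + u2 + u3 + u5)) (of_real (u1 + u2 + u3 + u6)) =
      of_real (\<Sum>k. K_term u1 u2 u3 u4 u5 u6 k)"
    unfolding reg_F43_eq_hyp_term h_def[symmetric] suminf_of_real[OF *] using h by (intro suminf_cong)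
qed

lemma K_sym_of_real:
  "K_sym (of_real u1) (of_real u2) (of_real u3) (of_real u4) (of_real u5) (of_real u6) = of_real (K_sym_real u1 u2 u3 u4 u5 u6)"
proof -
  define s where "s = u1 + u2 + u3 + u4 + u5 + u6"
  have s2: "u4 + u5 + u6 + u1 + u2 + u3 = s" by (simp add: s_def)
  have a: "complex_of_real u1 + of_real u2 + of_real u3 + of_real u4 + of_real u5 + of_real u6 - 1 = of_real (s - 1)"
    by (simp add: s_def)
  have e: "1 + complex_of_real (s - 1) - of_real (u1 + u2 + u3 + u4) = of_real (u5 + u6)"
    "1 + complex_of_real (s - 1) - of_real (u1 + u2 + u3 + u5) = of_real (u4 + u6)"
    "1 + complex_of_real (s - 1) - of_real (u1 + u2 + u3 + u6) = of_real (u4 + u5)"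
    "1 + complex_of_real (s - 1) - of_real (u2 + u3) = of_real (u4 + u5 + u6 + u1)"
    "1 + complex_of_real (s - 1) - of_real (u1 + u3) = of_real (u4 + u5 + u6 + u2)"
    "1 + complex_of_real (s - 1) - of_real (u1 + u2) = of_real (u4 + u5 + u6 + u3)"
    by (simp_all add: s_def)
  show ?thesis
    unfolding K_sym_def a
    unfolding of_real_add[symmetric]
    unfolding Kf_def e reg_F43_of_real[OF s_def[symmetric]] reg_F43_of_real[OF s2] rGamma_of_real
    by (simp add: K_sym_real_def field_simps)
qed

lemma K_term_nonneg:
  assumes "u1 > 0" "u2 > 0" "u3 > 0" "u4 > 0" "u5 > 0" "u6 > 0" "u1 + u2 + u3 + u4 + u5 + u6 \<ge> 1"
  shows "K_term u1 u2 u3 u4 u5 u6 k \<ge> 0"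
  unfolding K_term_def using assms
  by (intro divide_nonneg_nonneg mult_nonneg_nonneg pochhammer_nonneg_real less_imp_le[OF Gamma_real_pos])
    (auto intro!: add_pos_nonneg)

text \<open>The product \<open>C\<close> over the pairs 15, 24, 36 is invariant under exchange of
  the triples, so both halves of \<open>D_int\<close> carry it. One half has the further factor
  \<open>A\<close>, the other \<open>B\<close>, and dividing by \<open>A * B * C\<close> leaves
  exactly the Gamma factors with which the two series enter \<open>K\<close>.\<close>

lemma D_int_eq_K_sym_real:
  assumes pos: "u1 > 0" "u2 > 0" "u3 > 0" "u4 > 0" "u5 > 0" "u6 > 0" and sum: "u1 + u2 + u3 + u4 + u5 + u6 \<ge> 1"
  shows "D_int u1 u2 u3 u4 u5 u6 = ennreal (Gamma (u1 + u2) * Gamma (u1 + u3) * Gamma (u2 + u3) *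
     (Gamma (u4 + u5) * Gamma (u4 + u6) * Gamma (u5 + u6)) * (Gamma (u1 + u5) * Gamma (u2 + u4) * Gamma (u3 + u6)) *
     K_sym_real u1 u2 u3 u4 u5 u6)"
proof -
  have low: "D_low v1 v2 v3 v4 v5 v6 = ennreal ((Gamma (v1 + v2) * Gamma (v1 + v3) * Gamma (v2 + v3) *
      (Gamma (v1 + v5) * Gamma (v2 + v4) * Gamma (v3 + v6))) * (\<Sum>k. K_term v1 v2 v3 v4 v5 v6 k))"
    and low0: "(\<Sum>k. K_term v1 v2 v3 v4 v5 v6 k) \<ge> 0"
    if v: "v1 > 0" "v2 > 0" "v3 > 0" "v4 > 0" "v5 > 0" "v6 > 0" "v1 + v2 + v3 + v4 + v5 + v6 \<ge> 1" for v1 v2 v3 v4 v5 v6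
  proof -
    define G where "G = Gamma (v1 + v2) * Gamma (v1 + v3) * Gamma (v2 + v3) * Gamma (v1 + v5) * Gamma (v2 + v4) * Gamma (v3 + v6)"
    have G: "G \<ge> 0" using v by (simp add: G_def)
    note K0 = K_term_nonneg[OF v]
    have sm: "summable (K_term v1 v2 v3 v4 v5 v6)" by (rule summable_K_term[OF refl])
    have "D_low v1 v2 v3 v4 v5 v6 = (\<Sum>k. ennreal (G * K_term v1 v2 v3 v4 v5 v6 k))"
      unfolding G_def by (rule D_low_series[OF v])
    also have "\<dots> = ennreal (\<Sum>k. G * K_term v1 v2 v3 v4 v5 v6 k)"
      by (rule suminf_ennreal2) (use G K0 sm in \<open>auto intro: summable_mult\<close>)
    also have "(\<Sum>k. G * K_term v1 v2 v3 v4 v5 v6 k) = G * (\<Sum>k. K_term v1 v2 v3 v4 v5 v6 k)"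
      by (rule suminf_mult[OF sm])
    finally show "D_low v1 v2 v3 v4 v5 v6 = ennreal ((Gamma (v1 + v2) * Gamma (v1 + v3) * Gamma (v2 + v3) *
      (Gamma (v1 + v5) * Gamma (v2 + v4) * Gamma (v3 + v6))) * (\<Sum>k. K_term v1 v2 v3 v4 v5 v6 k))"
      by (simp add: G_def mult_ac)
    show "(\<Sum>k. K_term v1 v2 v3 v4 v5 v6 k) \<ge> 0" by (rule suminf_nonneg[OF sm K0])
  qed
  define A where "A = Gamma (u1 + u2) * Gamma (u1 + u3) * Gamma (u2 + u3)"
  define B where "B = Gamma (u4 + u5) * Gamma (u4 + u6) * Gamma (u5 + u6)"
  define C where "C = Gamma (u1 + u5) * Gamma (u2 + u4) * Gamma (u3 + u6)"
  have ABC: "A > 0" "B > 0" "C > 0" using pos by (simp_all add: A_def B_def C_def)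
  define R1 where "R1 = (\<Sum>k. K_term u1 u2 u3 u4 u5 u6 k)"
  define R2 where "R2 = (\<Sum>k. K_term u4 u5 u6 u1 u2 u3 k)"
  have R: "R1 \<ge> 0" "R2 \<ge> 0" unfolding R1_def R2_def using low0 pos sum by auto
  have "D_int u1 u2 u3 u4 u5 u6 = ennreal (A * C * R1) + ennreal (B * C * R2)"
    unfolding D_int_split using low[of u1 u2 u3 u4 u5 u6] low[of u4 u5 u6 u1 u2 u3] pos sum
    by (simp add: A_def B_def C_def R1_def R2_def add_ac mult_ac)
  also have "\<dots> = ennreal (A * C * R1 + B * C * R2)"
    using R ABC by (simp add: ennreal_plus)
  also have "A * C * R1 + B * C * R2 = A * B * C * (R1 / B + R2 / A)"
    using ABC by (simp add: field_simps)
  also have "R1 / B + R2 / A = K_sym_real u1 u2 u3 u4 u5 u6"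
    by (simp add: K_sym_real_def R1_def R2_def A_def B_def)
  finally show ?thesis by (simp only: A_def B_def C_def)
qed

lemma K_sym_real_nonneg:
  assumes pos: "u1 > 0" "u2 > 0" "u3 > 0" "u4 > 0" "u5 > 0" "u6 > 0" and sum: "u1 + u2 + u3 + u4 + u5 + u6 \<ge> 1"
  shows "K_sym_real u1 u2 u3 u4 u5 u6 \<ge> 0"
  unfolding K_sym_real_def using assms
  by (intro add_nonneg_nonneg divide_nonneg_nonneg suminf_nonneg summable_K_term[OF refl] K_term_nonneg)
    (auto intro!: mult_nonneg_nonneg less_imp_le[OF Gamma_real_pos])

text \<open>The Gamma factors that change under the exchange, \<open>Q\<close> into
  \<open>Q'\<close>, are the numerators of the Beta factors relating \<open>D_int\<close> to
  \<open>D_sym\<close>. Cross-multiplication cancels them without dividing by \<open>M\<close> in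
  \<open>ennreal\<close>; nonnegativity of \<open>x\<close> and \<open>y\<close> then allows the
  return to the reals.\<close>

lemma K_sym_real_swap:
  assumes pos: "u1 > 0" "u2 > 0" "u3 > 0" "u4 > 0" "u5 > 0" "u6 > 0" and sum: "u1 + u2 + u3 + u4 + u5 + u6 \<ge> 1"
  shows "K_sym_real u5 u2 u3 u4 u1 u6 = K_sym_real u1 u2 u3 u4 u5 u6"
proof -
  define P where "P = Gamma (u2 + u3) * Gamma (u4 + u6) * Gamma (u1 + u5) * Gamma (u2 + u4) * Gamma (u3 + u6)"
  define Q where "Q = Gamma (u1 + u2) * Gamma (u5 + u6) * Gamma (u4 + u5) * Gamma (u1 + u3)"
  define Q' where "Q' = Gamma (u2 + u5) * Gamma (u1 + u6) * Gamma (u1 + u4) * Gamma (u3 + u5)"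
  define N where "N = Gamma (u1 + u2 + u5 + u6) * Gamma (u1 + u3 + u4 + u5)"
  have p: "P > 0" "Q > 0" "Q' > 0" "N > 0" using pos by (simp_all add: P_def Q_def Q'_def N_def)
  define x where "x = K_sym_real u1 u2 u3 u4 u5 u6"
  define y where "y = K_sym_real u5 u2 u3 u4 u1 u6"
  define M where "M = D_sym u1 u2 u3 u4 u5 u6"
  have xy: "x \<ge> 0" "y \<ge> 0" unfolding x_def y_def using K_sym_real_nonneg pos sum by auto
  have B: "Beta (u1 + u2) (u5 + u6) * Beta (u4 + u5) (u1 + u3) = Q / N"
    "Beta (u5 + u2) (u1 + u6) * Beta (u4 + u1) (u5 + u3) = Q' / N"
    by (simp_all add: Beta_def Q_def Q'_def N_def add_ac mult_ac)
  have 1: "ennreal (P * Q * x) = ennreal (Q / N) * M"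
    using D_int_eq_K_sym_real[OF pos sum] D_int_eq_D_sym[OF pos] unfolding B
    by (simp add: M_def x_def P_def Q_def mult_ac)
  have 2: "ennreal (P * Q' * y) = ennreal (Q' / N) * M"
    using D_int_eq_K_sym_real[of u5 u2 u3 u4 u1 u6] D_int_eq_D_sym[of u5 u2 u3 u4 u1 u6] pos sum D_sym_swap[of u5 u2 u3 u4 u1 u6]
    unfolding B by (simp add: M_def y_def P_def Q'_def mult_ac add_ac)
  have "ennreal (P * Q * x * (Q' / N)) = ennreal (Q' / N) * ennreal (P * Q * x)"
    using p xy by (simp add: ennreal_mult[symmetric] mult_ac)
  also have "\<dots> = ennreal (Q / N) * (ennreal (Q' / N) * M)" unfolding 1 by (simp add: mult_ac)
  also have "\<dots> = ennreal (Q / N) * ennreal (P * Q' * y)" by (simp only: 2)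
  also have "\<dots> = ennreal (P * Q' * y * (Q / N))"
    using p xy by (simp add: ennreal_mult[symmetric] mult_ac)
  finally have "P * Q * x * (Q' / N) = P * Q' * y * (Q / N)"
    using p xy by (subst (asm) ennreal_inj) auto
  then show ?thesis using p by (simp add: x_def y_def)
qed

section \<open>Analytic continuation of the symmetry\<close>

lemma entire_zero_on_ray:
  fixes f :: "complex \<Rightarrow> complex"
  assumes "f holomorphic_on UNIV" "\<And>r :: real. r > 1 \<Longrightarrow> f (of_real r) = 0"
  shows "f z = 0"
proof (rule analytic_continuation[of f UNIV "complex_of_real ` {1<..}" 2])
  show "2 islimpt complex_of_real ` {1<..}"
    unfolding islimpt_approachable
  proof (intro allI impI)
    fix \<epsilon> :: real assume "\<epsilon> > 0"
    then show "\<exists>x'\<in>complex_of_real ` {1<..}. x' \<noteq> 2 \<and> dist x' 2 < \<epsilon>"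
      by (intro bexI[of _ "of_real (2 + \<epsilon> / 2)"] imageI) (simp_all add: dist_norm)
  qed
qed (use assms in auto)

text \<open>The identity theorem releases one variable at a time from the real ray above 1. On that
  ray all variables are positive and their sum exceeds 1, as \<open>K_sym_real_swap\<close>
  requires.\<close>

lemma K_sym_swap: "K_sym u5 u2 u3 u4 u1 u6 = K_sym u1 u2 u3 u4 u5 u6"
proof -
  define d where "d u1 u2 u3 u4 u5 u6 = K_sym u5 u2 u3 u4 u1 u6 - K_sym u1 u2 u3 u4 u5 u6" for u1 u2 u3 u4 u5 u6
  note hol = holomorphic_intros K_sym_holomorphic
  have 0: "d (of_real v1) (of_real v2) (of_real v3) (of_real v4) (of_real v5) (of_real v6) = 0"
    if "v1 > 1" "v2 > 1" "v3 > 1" "v4 > 1" "v5 > 1" "v6 > (1::real)" for v1 v2 v3 v4 v5 v6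
    unfolding d_def K_sym_of_real using K_sym_real_swap[of v1 v2 v3 v4 v5 v6] that by simp
  have 1: "d z (of_real v2) (of_real v3) (of_real v4) (of_real v5) (of_real v6) = 0"
    if "v2 > 1" "v3 > 1" "v4 > 1" "v5 > 1" "v6 > (1::real)" for z v2 v3 v4 v5 v6
    by (rule entire_zero_on_ray[where f = "\<lambda>z. d z _ _ _ _ _"]) (use 0 that in \<open>auto simp: d_def intro!: hol\<close>)
  have 2: "d u1 z (of_real v3) (of_real v4) (of_real v5) (of_real v6) = 0"
    if "v3 > 1" "v4 > 1" "v5 > 1" "v6 > (1::real)" for u1 z v3 v4 v5 v6
    by (rule entire_zero_on_ray[where f = "\<lambda>z. d _ z _ _ _ _"]) (use 1 that in \<open>auto simp: d_def intro!: hol\<close>)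
  have 3: "d u1 u2 z (of_real v4) (of_real v5) (of_real v6) = 0"
    if "v4 > 1" "v5 > 1" "v6 > (1::real)" for u1 u2 z v4 v5 v6
    by (rule entire_zero_on_ray[where f = "\<lambda>z. d _ _ z _ _ _"]) (use 2 that in \<open>auto simp: d_def intro!: hol\<close>)
  have 4: "d u1 u2 u3 z (of_real v5) (of_real v6) = 0"
    if "v5 > 1" "v6 > (1::real)" for u1 u2 u3 z v5 v6
    by (rule entire_zero_on_ray[where f = "\<lambda>z. d _ _ _ z _ _"]) (use 3 that in \<open>auto simp: d_def intro!: hol\<close>)
  have 5: "d u1 u2 u3 u4 z (of_real v6) = 0"
    if "v6 > (1::real)" for u1 u2 u3 u4 z v6
    by (rule entire_zero_on_ray[where f = "\<lambda>z. d _ _ _ _ z _"]) (use 4 that in \<open>auto simp: d_def intro!: hol\<close>)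
  have 6: "d u1 u2 u3 u4 u5 z = 0" for u1 u2 u3 u4 u5 z
    by (rule entire_zero_on_ray[where f = "\<lambda>z. d _ _ _ _ _ z"]) (use 5 in \<open>auto simp: d_def intro!: hol\<close>)
  show ?thesis using 6[of u1 u2 u3 u4 u5 u6] by (simp add: d_def)
qed

lemma Kf_cong:
  "a = a' \<Longrightarrow> b = b' \<Longrightarrow> c = c' \<Longrightarrow> d = d' \<Longrightarrow> e = e' \<Longrightarrow> f = f' \<Longrightarrow> g = g' \<Longrightarrow>
    Kf a b c d e f g = Kf a' b' c' d' e' f' g'"
  by simp

text \<open>This is the exchange of \<open>u1\<close> with the variable attached to
  \<open>g\<close>, followed by a return to the original parameters. It fixes \<open>a\<close>,
  \<open>b\<close> and \<open>g\<close>.\<close>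

lemma Kf_swap:
  assumes "e + f + g - a - b - c - d = 1"
  shows "Kf a b c d e f g = Kf a b (g - d) (g - c) (e + g - c - d) (f + g - c - d) g"
proof -
  \<comment> \<open>The half-sums solve \<open>b = u2 + u3\<close>, \<open>c = u1 + u3\<close>,
    \<open>d = u1 + u2\<close>; the remaining three variables are then \<open>e - s\<close>,
    \<open>f - s\<close> and \<open>g - s\<close>.\<close>
  define u1 where "u1 = (c + d - b) / 2"
  define u2 where "u2 = (b + d - c) / 2"
  define u3 where "u3 = (b + c - d) / 2"
  define s where "s = (b + c + d) / 2"
  have a: "a = e + f + g - b - c - d - 1" using assms by (simp add: algebra_simps)
  have u: "u2 + u3 = b" "u1 + u3 = c" "u1 + u2 = d" "u1 + u2 + u3 = s"
    by (simp_all add: u1_def u2_def u3_def s_def field_simps)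
  have l: "u1 + u2 + u3 + (e - s) + (g - s) + (f - s) - 1 = a" "u1 + u2 + u3 + (e - s) = e"
    "u1 + u2 + u3 + (g - s) = g" "u1 + u2 + u3 + (f - s) = f"
    unfolding u(4) a by (simp_all add: s_def field_simps)
  have r: "(g - s) + u2 + u3 + (e - s) + u1 + (f - s) - 1 = a" "(g - s) + u3 = g - d" "(g - s) + u2 = g - c"
    "(g - s) + u2 + u3 + (e - s) = e + g - c - d" "(g - s) + u2 + u3 + u1 = g" "(g - s) + u2 + u3 + (f - s) = f + g - c - d"
    unfolding a by (simp_all add: u1_def u2_def u3_def s_def field_simps)
  have "Kf a b c d e f g = Kf a b c d e g f" by (rule Kf_commute(3))
  also have "\<dots> = K_sym u1 u2 u3 (e - s) (g - s) (f - s)"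
    unfolding K_sym_def by (intro Kf_cong l[symmetric] u(1-3)[symmetric])
  also have "\<dots> = K_sym (g - s) u2 u3 (e - s) u1 (f - s)" by (rule K_sym_swap)
  also have "\<dots> = Kf a b (g - d) (g - c) (e + g - c - d) g (f + g - c - d)"
    unfolding K_sym_def by (intro Kf_cong r u)
  also have "\<dots> = Kf a b (g - d) (g - c) (e + g - c - d) (f + g - c - d) g"
    by (rule Kf_commute(3))
  finally show ?thesis .
qed

section \<open>Bilateral sums and trigonometric polynomials\<close>

definition per_term :: "(nat \<Rightarrow> complex) \<Rightarrow> (nat \<Rightarrow> complex) \<Rightarrow> complex \<Rightarrow> complex" where
  "per_term a e s = (\<Prod>i<4. rGamma (1 - a i - s) * rGamma (e i + s))"

text \<open>The index 0 occurs in both one-sided sums, hence the subtraction.\<close>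

definition per_sum :: "(nat \<Rightarrow> complex) \<Rightarrow> (nat \<Rightarrow> complex) \<Rightarrow> complex \<Rightarrow> complex" where
  "per_sum a e s = (\<Sum>k. per_term a e (s + of_nat k)) + (\<Sum>k. per_term a e (s - of_nat k)) - per_term a e s"

text \<open>Reflection in \<open>s\<close> reduces every statement about the backward half of the
  bilateral sum to the forward half, with balanced parameters again.\<close>

lemma per_term_reflect: "per_term a e (- s) = per_term (\<lambda>i. 1 - e i) (\<lambda>i. 1 - a i) s"
  by (simp add: per_term_def mult.commute)

lemma balanced_reflect: "balanced a e \<Longrightarrow> balanced (\<lambda>i. 1 - e i) (\<lambda>i. 1 - a i)"
  by (simp add: balanced_def sum_subtractf)

lemma balanced_shift: "balanced a e \<Longrightarrow> balanced (\<lambda>i. a i + s) (\<lambda>i. e i + s)"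
  by (simp add: balanced_def sum.distrib)

lemma rGamma_minus_nat: "rGamma (z - of_nat k) = (-1) ^ k * pochhammer (1 - z) k * rGamma (z :: complex)"
proof -
  have "pochhammer (z - of_nat k) k = (-1) ^ k * pochhammer (1 - z) k"
    using pochhammer_minus[of "of_nat k - z" k] by simp
  then show ?thesis using pochhammer_rGamma[of "z - of_nat k" k] by simp
qed

text \<open>Moving \<open>k\<close> out of \<open>rGamma (1 - a i - s - k)\<close> produces a
  Pochhammer symbol and a sign \<open>(-1) ^ k\<close>; the four signs cancel.\<close>

lemma per_term_add_nat:
  "per_term a e (s + of_nat k) = (\<Prod>i<4. rGamma (1 - a i - s)) * hyp_term (\<lambda>i. a i + s) (\<lambda>i. e i + s) k"
proof -
  have 1: "rGamma (1 - a i - (s + of_nat k)) * rGamma (e i + (s + of_nat k)) =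
      (-1) ^ k * (rGamma (1 - a i - s) * (pochhammer (a i + s) k * rGamma (e i + s + of_nat k)))" for i
    using rGamma_minus_nat[of "1 - a i - s" k] by (simp add: algebra_simps)
  have "(\<Prod>i<4::nat. (-1) ^ k) = (1 :: complex)"
    by (simp add: power_mult[symmetric] minus_one_power_iff)
  then show ?thesis
    unfolding per_term_def hyp_term_def 1 prod.distrib by simp
qed

lemma per_term_diff_nat:
  "per_term a e (s - of_nat k) = (\<Prod>i<4. rGamma (e i + s)) * hyp_term (\<lambda>i. 1 - e i - s) (\<lambda>i. 1 - a i - s) k"
  using per_term_add_nat[of "\<lambda>i. 1 - e i" "\<lambda>i. 1 - a i" "- s" k] per_term_reflect[of a e "- s + of_nat k"]
  by simp

lemma summable_per_term:
  assumes "balanced a e"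
  shows "summable (\<lambda>k. norm (per_term a e (s + of_nat k)))" "summable (\<lambda>k. norm (per_term a e (s - of_nat k)))"
proof -
  have 1: "summable (\<lambda>k. norm (per_term a e (s + of_nat k)))" if "balanced a e" for a e s
    unfolding per_term_add_nat norm_mult
    by (intro summable_mult summable_norm_hyp_term balanced_shift that)
  show "summable (\<lambda>k. norm (per_term a e (s + of_nat k)))" by (rule 1[OF assms])
  have "per_term a e (s - of_nat k) = per_term (\<lambda>i. 1 - e i) (\<lambda>i. 1 - a i) (- s + of_nat k)" for k
    using per_term_reflect[of a e "- s + of_nat k"] by simp
  then show "summable (\<lambda>k. norm (per_term a e (s - of_nat k)))"
    using 1[OF balanced_reflect[OF assms], of "- s"] by simp
qed

lemma per_term_holomorphic:
  "per_term a e holomorphic_on UNIV"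
  unfolding per_term_def[abs_def] by (intro holomorphic_intros holomorphic_rGamma')

text \<open>Extracting the reciprocal Gammas independent of \<open>k\<close> from each half leaves a
  balanced series whose parameters are entire in \<open>s\<close>.\<close>

lemma per_sum_holomorphic:
  assumes "balanced a e"
  shows "per_sum a e holomorphic_on UNIV"
proof -
  have 1: "(\<Sum>k. per_term a e (s + of_nat k)) = (\<Prod>i<4. rGamma (1 - a i - s)) * (\<Sum>k. hyp_term (\<lambda>i. a i + s) (\<lambda>i. e i + s) k)" for s
    unfolding per_term_add_nat
    by (rule suminf_mult[OF summable_norm_cancel[OF summable_norm_hyp_term[OF balanced_shift[OF assms]]]])
  have bal: "balanced (\<lambda>i. 1 - e i - s) (\<lambda>i. 1 - a i - s)" for s
    using balanced_shift[OF balanced_reflect[OF assms], of "- s"] by simp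
  have 2: "(\<Sum>k. per_term a e (s - of_nat k)) = (\<Prod>i<4. rGamma (e i + s)) * (\<Sum>k. hyp_term (\<lambda>i. 1 - e i - s) (\<lambda>i. 1 - a i - s) k)" for s
    unfolding per_term_diff_nat
    by (rule suminf_mult[OF summable_norm_cancel[OF summable_norm_hyp_term[OF bal]]])
  show ?thesis
    unfolding per_sum_def[abs_def] 1 2
    by (intro holomorphic_intros holomorphic_rGamma' holomorphic_suminf_hyp_term balanced_shift[OF assms] bal
        per_term_holomorphic)
qed

lemma per_sum_periodic:
  assumes "balanced a e"
  shows "per_sum a e (s + 1) = per_sum a e s"
proof -
  note sm = summable_norm_cancel[OF summable_per_term(1)[OF assms]] summable_norm_cancel[OF summable_per_term(2)[OF assms]]
  have "(\<Sum>k. per_term a e (s + of_nat k)) = per_term a e s + (\<Sum>k. per_term a e (s + 1 + of_nat k))"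
    using suminf_split_head[OF sm(1)[of s]] by (simp add: add_ac)
  moreover have "(\<Sum>k. per_term a e (s + 1 - of_nat k)) = per_term a e (s + 1) + (\<Sum>k. per_term a e (s - of_nat k))"
    using suminf_split_head[OF sm(2)[of "s + 1"]] by (simp add: algebra_simps)
  ultimately show ?thesis by (simp add: per_sum_def)
qed

lemma per_term_Suc: "per_term a e (s + 1) * (\<Prod>i<4. e i + s) = per_term a e s * (\<Prod>i<4. a i + s)"
proof -
  have "rGamma (1 - a i - (s + 1)) * rGamma (e i + (s + 1)) * (e i + s) =
      - 1 * (rGamma (1 - a i - s) * rGamma (e i + s) * (a i + s))" for i
  proof -
    have e: "- a i - s + 1 = 1 - a i - s" "1 - a i - (s + 1) = - a i - s" by simp_all
    have x: "rGamma (1 - a i - (s + 1)) = (- a i - s) * rGamma (1 - a i - s)"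
      using rGamma_plus1[of "- a i - s"] unfolding e by simp
    have y: "rGamma (e i + (s + 1)) * (e i + s) = rGamma (e i + s)"
      using rGamma_plus1[of "e i + s"] by (simp add: add.assoc mult.commute)
    show ?thesis unfolding mult.assoc x y by (simp add: algebra_simps)
  qed
  then have "(\<Prod>i<4. rGamma (1 - a i - (s + 1)) * rGamma (e i + (s + 1)) * (e i + s)) =
      (\<Prod>i<4. - 1 * (rGamma (1 - a i - s) * rGamma (e i + s) * (a i + s)))" by simp
  then show ?thesis unfolding per_term_def prod.distrib by simp
qed

section \<open>Growth of the bilateral sum\<close>

lemma norm_sin_le_exp: "norm (sin z) \<le> exp \<bar>Im z\<bar>"
proof -
  have "norm (sin z) = norm (exp (\<i> * z) - exp (- (\<i> * z))) / 2"
    by (simp add: sin_exp_eq norm_divide norm_mult)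
  also have "\<dots> \<le> (norm (exp (\<i> * z)) + norm (exp (- (\<i> * z)))) / 2"
    by (intro divide_right_mono norm_triangle_ineq4) auto
  also have "\<dots> \<le> (exp \<bar>Im z\<bar> + exp \<bar>Im z\<bar>) / 2"
    by (intro divide_right_mono add_mono) auto
  finally show ?thesis by simp
qed

text \<open>By Gauss's product, \<open>rGamma_series z n\<close> tends to \<open>rGamma z\<close>.
  The quotients for \<open>a i + s\<close> and \<open>e i + s\<close> contribute powers of
  \<open>n\<close> whose exponents add up to 2 by balance, and the reflection formula turns the
  limit into sines. The shift to \<open>Suc n\<close> is that of the Pochhammer symbol in
  \<open>rGamma_series\<close>.\<close>

lemma per_term_limit:
  assumes "balanced a e" and nz: "\<And>i. i < 4 \<Longrightarrow> Im (e i + s) \<noteq> 0"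
  shows "(\<lambda>n. of_nat n ^ 2 * per_term a e (s + of_nat (Suc n))) \<longlonglongrightarrow> (\<Prod>i<4. sin (of_real pi * (a i + s)) / of_real pi)"
proof -
  have rnz: "rGamma (e i + s) \<noteq> 0" if "i < 4" for i
  proof
    assume "rGamma (e i + s) = 0"
    then obtain n where "e i + s = of_int n" by (auto simp: rGamma_eq_zero_iff elim!: nonpos_Ints_cases)
    then have "Im (e i + s) = Im (of_int n)" by (simp only:)
    then show False using nz[OF that] by simp
  qed
  have pnz: "pochhammer (e i + s) n \<noteq> 0" if "i < 4" for i n
  proof
    assume "pochhammer (e i + s) n = 0"
    then obtain k where "e i + s = - of_nat k" by (auto simp: pochhammer_eq_0_iff)
    then have "Im (e i + s) = Im (- of_nat k)" by (simp only:)
    then show False using nz[OF that] by simp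
  qed
  define A where "A n = (\<Prod>i<4. rGamma (1 - a i - s)) *
     (\<Prod>i<4. rGamma (e i + s) * (rGamma_series (a i + s) n / rGamma_series (e i + s) n))" for n
  have "A \<longlonglongrightarrow> (\<Prod>i<4. rGamma (1 - a i - s)) * (\<Prod>i<4. rGamma (e i + s) * (rGamma (a i + s) / rGamma (e i + s)))"
    unfolding A_def by (intro tendsto_intros rGamma_series_LIMSEQ rnz) auto
  also have "(\<Prod>i<4. rGamma (1 - a i - s)) * (\<Prod>i<4. rGamma (e i + s) * (rGamma (a i + s) / rGamma (e i + s))) =
      (\<Prod>i<4. rGamma (1 - a i - s) * rGamma (a i + s))"
    unfolding prod.distrib[symmetric] using rnz by (intro prod.cong) auto
  also have "\<dots> = (\<Prod>i<4. sin (of_real pi * (a i + s)) / of_real pi)"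
    using rGamma_reflection_complex[of "a i + s" for i] by (intro prod.cong) (simp_all add: algebra_simps)
  finally have lim: "A \<longlonglongrightarrow> (\<Prod>i<4. sin (of_real pi * (a i + s)) / of_real pi)" .
  have "eventually (\<lambda>n. A n = of_nat n ^ 2 * per_term a e (s + of_nat (Suc n))) sequentially"
    using eventually_gt_at_top[of 0]
  proof eventually_elim
    case (elim n)
    define X where "X z = exp (z * of_real (ln (real n)))" for z :: complex
    have X: "X u \<noteq> 0" for u by (simp add: X_def)
    have "rGamma (e i + s) * (rGamma_series (a i + s) n / rGamma_series (e i + s) n) =
        (X (e i) / X (a i)) * (pochhammer (a i + s) (Suc n) * rGamma (e i + s + of_nat (Suc n)))" if "i < 4" for i
    proof -
      have "rGamma (e i + s) = pochhammer (e i + s) (Suc n) * rGamma (e i + s + of_nat (Suc n))"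
        by (rule pochhammer_rGamma)
      moreover have "X (e i + s) / X (a i + s) = X (e i) / X (a i)"
        by (simp add: X_def exp_add[symmetric] exp_diff[symmetric] algebra_simps)
      moreover have "rGamma_series (a i + s) n / rGamma_series (e i + s) n =
          pochhammer (a i + s) (Suc n) / pochhammer (e i + s) (Suc n) * (X (e i + s) / X (a i + s))"
        by (simp add: rGamma_series_def X_def)
      ultimately show ?thesis using pnz[OF that, of "Suc n"] by simp
    qed
    then have "(\<Prod>i<4. rGamma (e i + s) * (rGamma_series (a i + s) n / rGamma_series (e i + s) n)) =
        (\<Prod>i<4. (X (e i) / X (a i)) * (pochhammer (a i + s) (Suc n) * rGamma (e i + s + of_nat (Suc n))))"
      by (intro prod.cong) auto
    also have "\<dots> = (\<Prod>i<4. X (e i) / X (a i)) * hyp_term (\<lambda>i. a i + s) (\<lambda>i. e i + s) (Suc n)"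
      by (simp only: prod.distrib hyp_term_def)
    also have "(\<Prod>i<4. X (e i) / X (a i)) = exp (\<Sum>i<4. (e i - a i) * of_real (ln (real n)))"
    proof -
      have "X (e i) / X (a i) = exp ((e i - a i) * of_real (ln (real n)))" for i
        by (simp only: X_def exp_diff[symmetric] left_diff_distrib)
      then show ?thesis by (simp add: exp_sum)
    qed
    also have "(\<Sum>i<4. (e i - a i) * of_real (ln (real n))) = 2 * of_real (ln (real n))"
      using assms(1) by (simp add: balanced_def sum_subtractf sum_distrib_right[symmetric])
    also have "exp (2 * complex_of_real (ln (real n))) = of_nat n ^ 2"
      using elim by (simp add: exp_double exp_of_real)
    finally show ?case by (simp add: A_def per_term_add_nat del: of_nat_Suc)
  qed
  then show ?thesis using lim by (rule Lim_transform_eventually[rotated])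
qed

text \<open>For \<open>m \<ge> 1\<close> the squared norm is bounded below by half a product of two
  consecutive members of an arithmetic progression, so the reciprocals telescope. The term
  \<open>m = 0\<close>, for which \<open>Re s\<close> may be negative, is estimated by
  \<open>Im s\<close> alone. The decay in \<open>Im s\<close> is what later excludes frequency
  two.\<close>

lemma sum_inverse_squares_le:
  assumes "Re s \<ge> -1" "\<bar>Im s\<bar> \<ge> 2"
  shows "(\<Sum>m<n. 1 / norm (s + of_nat m) ^ 2) \<le> 4 / (\<bar>Im s\<bar> - 1)"
proof -
  define y where "y = \<bar>Im s\<bar>"
  have y: "y \<ge> 2" using assms by (simp add: y_def)
  have t: "1 / norm (s + of_nat (Suc m)) ^ 2 \<le> 2 * (1 / (real m + y - 1) - 1 / (real (Suc m) + y - 1))" for m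
  proof -
    have m0: "real m + y - 1 > 0" using y by linarith
    have "(real m + y - 1) * (real m + y) \<le> (real m + y)\<^sup>2"
      using y by (simp add: power2_eq_square mult_right_mono)
    also have "\<dots> \<le> 2 * ((real m)\<^sup>2 + y\<^sup>2)"
      using sum_squares_bound[of "real m" y] by (simp add: power2_sum)
    also have "(real m)\<^sup>2 \<le> (Re s + real (Suc m))\<^sup>2"
      using assms(1) by (intro power_mono) auto
    finally have "(real m + y - 1) * (real m + y) \<le> 2 * ((Re s + real (Suc m))\<^sup>2 + y\<^sup>2)" by simp
    also have "(Re s + real (Suc m))\<^sup>2 + y\<^sup>2 = norm (s + of_nat (Suc m)) ^ 2"
      by (simp add: cmod_power2 y_def)
    finally have le: "(real m + y - 1) * (real m + y) \<le> 2 * norm (s + of_nat (Suc m)) ^ 2" .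
    have "1 / norm (s + of_nat (Suc m)) ^ 2 = 2 / (2 * norm (s + of_nat (Suc m)) ^ 2)" by simp
    also have "\<dots> \<le> 2 / ((real m + y - 1) * (real m + y))"
    proof (rule divide_left_mono[OF le])
      have "0 < (real m + y - 1) * (real m + y)" using m0 y by (intro mult_pos_pos) auto
      moreover from this have "0 < 2 * norm (s + of_nat (Suc m)) ^ 2" using le by linarith
      ultimately show "0 < (2 * norm (s + of_nat (Suc m)) ^ 2) * ((real m + y - 1) * (real m + y))"
        by (rule mult_pos_pos[rotated])
    qed simp
    also have "\<dots> = 2 * (1 / (real m + y - 1) - 1 / (real (Suc m) + y - 1))"
      using m0 y by (simp add: field_simps)
    finally show ?thesis .
  qed
  have 1: "(\<Sum>m<n. 1 / norm (s + of_nat (Suc m)) ^ 2) \<le> 2 / (y - 1)" for n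
  proof -
    have "(\<Sum>m<n. 1 / norm (s + of_nat (Suc m)) ^ 2) \<le> (\<Sum>m<n. 2 * (1 / (real m + y - 1) - 1 / (real (Suc m) + y - 1)))"
      by (intro sum_mono t)
    also have "\<dots> = 2 * (1 / (y - 1) - 1 / (real n + y - 1))"
      unfolding sum_distrib_left[symmetric] by (subst sum_lessThan_telescope') simp
    also have "\<dots> = 2 / (y - 1) - 2 * (1 / (real n + y - 1))" by simp
    also have "\<dots> \<le> 2 / (y - 1)"
    proof -
      have "1 / (real n + y - 1) \<ge> 0" using y by simp
      then show ?thesis by linarith
    qed
    finally show ?thesis .
  qed
  have "(\<Sum>m<n. 1 / norm (s + of_nat m) ^ 2) \<le> (\<Sum>m<Suc n. 1 / norm (s + of_nat m) ^ 2)" by simp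
  also have "\<dots> = 1 / norm s ^ 2 + (\<Sum>m<n. 1 / norm (s + of_nat (Suc m)) ^ 2)"
    by (subst sum.lessThan_Suc_shift) simp
  also have "1 / norm s ^ 2 \<le> 2 / (y - 1)"
  proof -
    have "y \<le> norm s" by (simp add: y_def abs_Im_le_cmod)
    then have "y * y \<le> norm s ^ 2" using y by (simp add: power2_eq_square mult_mono)
    moreover have "0 < y * y" using y by simp
    ultimately have "1 / norm s ^ 2 \<le> 1 / (y * y)" by (intro frac_le) auto
    also have "\<dots> \<le> 2 / (y - 1)"
    proof -
      have "y \<le> y * y" using y mult_left_mono[of 1 y y] by simp
      then have "y - 1 \<le> y * y" using y by linarith
      then show ?thesis using y by (intro frac_le) auto
    qed
    finally show ?thesis .
  qed
  also have "2 / (y - 1) + (\<Sum>m<n. 1 / norm (s + of_nat (Suc m)) ^ 2) \<le> 4 / (y - 1)"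
    using 1[of n] by simp
  finally show ?thesis by (simp add: y_def)
qed

text \<open>The factor \<open>s * (s + 1)\<close> in \<open>T\<close> absorbs the drift
  \<open>1 - 2 / s\<close> of \<open>per_term\<close>, so that \<open>T s\<close> and
  \<open>T (s + 1)\<close> differ by a factor \<open>1 + O(1 / norm s ^ 2)\<close>. Iterating to
  infinity costs only a bounded exponential, by \<open>sum_inverse_squares_le\<close>, and the limit
  of \<open>T (s + n)\<close> is a product of four sines divided by powers of
  \<open>pi\<close>.\<close>

lemma per_term_bound:
  assumes bal: "balanced a e"
  obtains C R where "C \<ge> 0" "R \<ge> 2"
    "\<And>s. Re s \<ge> -1 \<Longrightarrow> \<bar>Im s\<bar> \<ge> R \<Longrightarrow> norm (per_term a e s) \<le> C * exp (4 * pi * \<bar>Im s\<bar>) * (1 / norm s ^ 2)"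
proof -
  define R1 where "R1 = (\<Sum>i<4. norm (a i) + norm (e i))"
  have le: "norm (a i) + norm (e i) \<le> R1" if "i < 4" for i
    unfolding R1_def by (rule member_le_sum) (use that in auto)
  have R1: "R1 \<ge> 0" by (auto simp: R1_def intro!: sum_nonneg)
  have pb: "param_bound R1 a e"
    unfolding param_bound_def
  proof (intro allI impI conjI)
    fix i :: nat assume i: "i < 4"
    show "norm (a i) \<le> R1" "norm (e i) \<le> R1"
      using le[OF i] norm_ge_zero[of "a i"] norm_ge_zero[of "e i"] by linarith+
  qed
  obtain C where C: "C \<ge> 0"
    "\<And>x. norm x \<le> 1 \<Longrightarrow> norm ((\<Prod>i<4. 1 + a i * x) * (1 + 2 * x) - (\<Prod>i<4. 1 + e i * x)) \<le> C * norm x ^ 2"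
    "\<And>x. norm x \<le> 1 \<Longrightarrow> norm ((\<Prod>i<4. 1 + e i * x) - 1) \<le> C * norm x"
    using balanced_prod_ratio[OF R1] pb bal by metis
  \<comment> \<open>The summand \<open>8 * C\<close> makes \<open>C / norm s\<close> at most 1/8,
    \<open>R1\<close> keeps \<open>e i + s\<close> off the real axis as
    \<open>per_term_limit\<close> requires, and 2 is the threshold of
    \<open>sum_inverse_squares_le\<close>.\<close>
  define R where "R = 2 + 8 * C + R1"
  have R: "R \<ge> 2" using C(1) R1 by (simp add: R_def)
  define T where "T s = per_term a e s * (s * (s + 1))" for s
  have step: "norm (T s) \<le> norm (T (s + 1)) * exp (2 * C * (1 / norm s ^ 2))" if s: "\<bar>Im s\<bar> \<ge> R" for s
  proof -
    have ns: "norm s \<ge> R" using s abs_Im_le_cmod[of s] by linarith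
    then have ns0: "norm s > 0" using R by linarith
    then have s0: "s \<noteq> 0" by auto
    define x where "x = 1 / s"
    have nx: "norm x = 1 / norm s" by (simp add: x_def norm_divide)
    have x1: "norm x \<le> 1" using ns R ns0 by (simp add: nx)
    have "8 * C \<le> norm s" using ns R1 by (simp add: R_def)
    then have Cx: "C * norm x \<le> 1/8" using ns0 by (simp add: nx field_simps)
    have "norm x ^ 2 \<le> norm x" using x1 by (simp add: power2_eq_square mult_left_le)
    then have "C * norm x ^ 2 \<le> C * norm x" using C(1) by (rule mult_left_mono)
    then have Cx2: "C * norm x ^ 2 \<le> 1/8" using Cx by linarith
    define M where "M = (\<Prod>i<4. 1 + a i * x) * (1 + 2 * x)"
    define Q where "Q = (\<Prod>i<4. 1 + e i * x)"
    have MQ: "norm (M - Q) \<le> C * norm x ^ 2" and Q1: "norm (Q - 1) \<le> C * norm x"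
      using C(2,3)[OF x1] by (simp_all add: M_def Q_def)
    have "norm (1 :: complex) \<le> norm M + norm (M - Q) + norm (Q - 1)"
      using norm_triangle_ineq4[of "M - (M - Q)" "Q - 1"] norm_triangle_ineq4[of M "M - Q"] by simp
    then have M: "norm M \<ge> 1/2" using MQ Q1 Cx Cx2 by simp
    have "norm Q \<le> norm M + C * norm x ^ 2" using MQ norm_triangle_ineq3[of M Q] by linarith
    also have "C * norm x ^ 2 * 1 \<le> C * norm x ^ 2 * (2 * norm M)"
      using M C(1) by (intro mult_left_mono) auto
    then have "norm M + C * norm x ^ 2 \<le> norm M * (1 + 2 * C * (1 / norm s ^ 2))"
      by (simp add: nx algebra_simps power_divide)
    also have "\<dots> \<le> norm M * exp (2 * C * (1 / norm s ^ 2))"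
      by (intro mult_left_mono exp_ge_add_one_self) auto
    finally have QM: "norm Q \<le> norm M * exp (2 * C * (1 / norm s ^ 2))" .
    have sx: "c + s = s * (1 + c * x)" for c using s0 by (simp add: x_def field_simps)
    have f1: "per_term a e (s + 1) * Q = per_term a e s * (\<Prod>i<4. 1 + a i * x)"
      using per_term_Suc[of a e s] s0 unfolding sx prod.distrib by (simp add: Q_def)
    have f2: "s * (1 + 2 * x) = s + 2" using s0 by (simp add: x_def field_simps)
    have "T s * M = (per_term a e s * (\<Prod>i<4. 1 + a i * x)) * (s * (1 + 2 * x)) * (s + 1)"
      by (simp add: T_def M_def mult_ac)
    also have "\<dots> = T (s + 1) * Q"
      unfolding f2 f1[symmetric] by (simp add: T_def mult_ac add_ac)
    finally have "T s * M = T (s + 1) * Q" .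
    then have "norm (T s) * norm M = norm (T (s + 1)) * norm Q" by (metis norm_mult)
    also have "\<dots> \<le> norm (T (s + 1)) * (norm M * exp (2 * C * (1 / norm s ^ 2)))"
      using QM by (intro mult_left_mono) auto
    finally have "norm (T s) * norm M \<le> (norm (T (s + 1)) * exp (2 * C * (1 / norm s ^ 2))) * norm M"
      by (simp add: mult_ac)
    moreover have "norm M > 0" using M by linarith
    ultimately show ?thesis by (rule mult_right_le_imp_le)
  qed
  have iter: "norm (T s) \<le> norm (T (s + of_nat n)) * exp (2 * C * (\<Sum>m<n. 1 / norm (s + of_nat m) ^ 2))"
    if "\<bar>Im s\<bar> \<ge> R" for s n
  proof (induction n)
    case (Suc n)
    have "norm (T s) \<le> norm (T (s + of_nat n)) * exp (2 * C * (\<Sum>m<n. 1 / norm (s + of_nat m) ^ 2))"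
      by (rule Suc)
    also have "\<dots> \<le> (norm (T (s + of_nat n + 1)) * exp (2 * C * (1 / norm (s + of_nat n) ^ 2))) * exp (2 * C * (\<Sum>m<n. 1 / norm (s + of_nat m) ^ 2))"
      using step[of "s + of_nat n"] that by (intro mult_right_mono) auto
    also have "\<dots> = norm (T (s + of_nat (Suc n))) * exp (2 * C * (\<Sum>m<Suc n. 1 / norm (s + of_nat m) ^ 2))"
      by (simp add: exp_add[symmetric] algebra_simps)
    finally show ?case .
  qed simp
  have Tb: "norm (T s) \<le> exp (8 * C) * (exp (4 * pi * R1) * exp (4 * pi * \<bar>Im s\<bar>))"
    if s: "Re s \<ge> -1" "\<bar>Im s\<bar> \<ge> R" for s
  proof -
    define L where "L = (\<Prod>i<4. sin (of_real pi * (a i + s)) / complex_of_real pi)"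
    have nz: "Im (e i + s) \<noteq> 0" if "i < 4" for i
    proof -
      have "\<bar>Im (e i)\<bar> \<le> R1" using pb that abs_Im_le_cmod[of "e i"] unfolding param_bound_def by (meson order.trans)
      then have "\<bar>Im (e i)\<bar> < \<bar>Im s\<bar>" using s(2) C(1) by (simp add: R_def)
      then show ?thesis by auto
    qed
    have "(\<lambda>n. (of_nat n ^ 2 * per_term a e (s + of_nat (Suc n))) * (((s + 1) / of_nat n + 1) * ((s + 2) / of_nat n + 1)))
        \<longlonglongrightarrow> L * ((0 + 1) * (0 + 1))"
      unfolding L_def by (intro tendsto_intros per_term_limit[OF bal nz] lim_const_over_n)
    moreover have "eventually (\<lambda>n. (of_nat n ^ 2 * per_term a e (s + of_nat (Suc n))) * (((s + 1) / of_nat n + 1) * ((s + 2) / of_nat n + 1))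
        = T (s + of_nat (Suc n))) sequentially"
      using eventually_gt_at_top[of 0]
    proof eventually_elim
      case (elim n)
      then have "(of_nat n :: complex) \<noteq> 0" by simp
      then have "of_nat n ^ 2 * (((s + 1) / of_nat n + 1) * ((s + 2) / of_nat n + 1)) = (s + of_nat (Suc n)) * (s + of_nat (Suc n) + 1)"
        by (simp add: field_simps power2_eq_square)
      then show ?case by (simp add: T_def mult.assoc)
    qed
    ultimately have "(\<lambda>n. T (s + of_nat (Suc n))) \<longlonglongrightarrow> L"
      by (auto intro: Lim_transform_eventually)
    then have lim: "(\<lambda>n. exp (8 * C) * norm (T (s + of_nat (Suc n)))) \<longlonglongrightarrow> exp (8 * C) * norm L"
      by (intro tendsto_intros)
    have bd: "norm (T s) \<le> exp (8 * C) * norm (T (s + of_nat (Suc n)))" for n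
    proof -
      have "(\<Sum>m<Suc n. 1 / norm (s + of_nat m) ^ 2) \<le> 4 / (\<bar>Im s\<bar> - 1)"
        using s R by (intro sum_inverse_squares_le) auto
      also have "\<dots> \<le> 4" using s(2) R by (simp add: divide_le_eq)
      finally have "2 * C * (\<Sum>m<Suc n. 1 / norm (s + of_nat m) ^ 2) \<le> 2 * C * 4"
        using C(1) by (intro mult_left_mono) auto
      then have "exp (2 * C * (\<Sum>m<Suc n. 1 / norm (s + of_nat m) ^ 2)) \<le> exp (8 * C)" by simp
      then have "norm (T (s + of_nat (Suc n))) * exp (2 * C * (\<Sum>m<Suc n. 1 / norm (s + of_nat m) ^ 2)) \<le>
          norm (T (s + of_nat (Suc n))) * exp (8 * C)" by (rule mult_left_mono) simp
      then show ?thesis using iter[OF s(2), of "Suc n"] by (simp add: mult.commute)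
    qed
    have "norm (T s) \<le> exp (8 * C) * norm L"
      by (rule LIMSEQ_le_const[OF lim]) (use bd in blast)
    also have "norm L \<le> (\<Prod>i<4::nat. exp (pi * R1) * exp (pi * \<bar>Im s\<bar>))"
      unfolding L_def prod_norm[symmetric]
    proof (intro prod_mono conjI)
      fix i :: nat assume "i \<in> {..<4}"
      then have "\<bar>Im (a i)\<bar> \<le> R1" using pb abs_Im_le_cmod[of "a i"] unfolding param_bound_def by (meson order.trans lessThan_iff)
      then have "pi * \<bar>Im (a i + s)\<bar> \<le> pi * (R1 + \<bar>Im s\<bar>)" by (intro mult_left_mono) auto
      then have "exp (pi * \<bar>Im (a i + s)\<bar>) \<le> exp (pi * R1) * exp (pi * \<bar>Im s\<bar>)"
        by (simp only: exp_add[symmetric] distrib_left exp_le_cancel_iff)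
      moreover have "\<bar>Im (of_real pi * z)\<bar> = pi * \<bar>Im z\<bar>" for z by (simp add: abs_mult)
      note this[of "a i + s"]
      ultimately have "exp \<bar>Im (of_real pi * (a i + s))\<bar> \<le> exp (pi * R1) * exp (pi * \<bar>Im s\<bar>)"
        by (simp only:)
      moreover have "norm (sin (of_real pi * (a i + s)) / complex_of_real pi) \<le> norm (sin (of_real pi * (a i + s))) / 1"
        using pi_ge_two by (simp only: norm_divide norm_of_real) (intro divide_left_mono, auto)
      ultimately show "norm (sin (of_real pi * (a i + s)) / complex_of_real pi) \<le> exp (pi * R1) * exp (pi * \<bar>Im s\<bar>)"
        using norm_sin_le_exp[of "of_real pi * (a i + s)"] by simp
    qed simp
    also have "\<dots> = exp (4 * pi * R1) * exp (4 * pi * \<bar>Im s\<bar>)"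
      by (simp add: power_mult_distrib exp_of_nat_mult[symmetric] mult_ac)
    finally show ?thesis by simp
  qed
  show ?thesis
  proof (rule that[of "2 * exp (8 * C) * exp (4 * pi * R1)" R])
    fix s assume s: "Re s \<ge> -1" "\<bar>Im s\<bar> \<ge> R"
    have ns: "norm s \<ge> 2" using s R abs_Im_le_cmod[of s] by linarith
    have "norm s \<le> 2 * norm (s + 1)" using norm_triangle_ineq4[of "s + 1" 1] ns by simp
    then have "norm s * norm s \<le> norm s * (2 * norm (s + 1))" by (intro mult_left_mono) auto
    then have "norm (per_term a e s) * norm s ^ 2 \<le> norm (per_term a e s) * (norm s * (2 * norm (s + 1)))"
      by (intro mult_left_mono) (auto simp: power2_eq_square)
    also have "\<dots> = 2 * norm (T s)" by (simp add: T_def norm_mult)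
    also have "\<dots> \<le> 2 * (exp (8 * C) * (exp (4 * pi * R1) * exp (4 * pi * \<bar>Im s\<bar>)))"
      using Tb[OF s] by simp
    finally have le: "norm (per_term a e s) * norm s ^ 2 \<le> 2 * (exp (8 * C) * (exp (4 * pi * R1) * exp (4 * pi * \<bar>Im s\<bar>)))" .
    show "norm (per_term a e s) \<le> 2 * exp (8 * C) * exp (4 * pi * R1) * exp (4 * pi * \<bar>Im s\<bar>) * (1 / norm s ^ 2)"
    proof -
      have "s \<noteq> 0" using ns by auto
      then have "norm s ^ 2 > 0" by simp
      then show ?thesis using le by (simp add: pos_le_divide_eq mult_ac)
    qed
  qed (use R in auto)
qed

text \<open>In the strip both \<open>s\<close> and \<open>- s\<close> have real part at least -1, so
  \<open>per_term_bound\<close> applies to the forward half and, after reflection, to the backward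
  half.\<close>

lemma per_sum_bound:
  assumes bal: "balanced a e"
  obtains C R where "C \<ge> 0" "R \<ge> 2"
    "\<And>s. \<bar>Re s\<bar> \<le> 1 \<Longrightarrow> \<bar>Im s\<bar> \<ge> R \<Longrightarrow> norm (per_sum a e s) \<le> C * exp (4 * pi * \<bar>Im s\<bar>) / (\<bar>Im s\<bar> - 1)"
proof -
  obtain C1 R1 where 1: "C1 \<ge> 0" "R1 \<ge> 2"
    "\<And>s. Re s \<ge> -1 \<Longrightarrow> \<bar>Im s\<bar> \<ge> R1 \<Longrightarrow> norm (per_term a e s) \<le> C1 * exp (4 * pi * \<bar>Im s\<bar>) * (1 / norm s ^ 2)"
    using per_term_bound[OF bal] by metis
  let ?a = "\<lambda>i. 1 - e i" and ?e = "\<lambda>i. 1 - a i"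
  obtain C2 R2 where 2: "C2 \<ge> 0" "R2 \<ge> 2"
    "\<And>s. Re s \<ge> -1 \<Longrightarrow> \<bar>Im s\<bar> \<ge> R2 \<Longrightarrow> norm (per_term ?a ?e s) \<le> C2 * exp (4 * pi * \<bar>Im s\<bar>) * (1 / norm s ^ 2)"
    using per_term_bound[OF balanced_reflect[OF bal]] by metis
  have key: "(\<Sum>k. norm (per_term a' e' (s + of_nat k))) \<le> C * exp (4 * pi * \<bar>Im s\<bar>) * (4 / (\<bar>Im s\<bar> - 1))"
    if bal': "balanced a' e'" and s: "Re s \<ge> -1" "\<bar>Im s\<bar> \<ge> R" "R \<ge> 2" and C: "C \<ge> 0"
      and b: "\<And>s. Re s \<ge> -1 \<Longrightarrow> \<bar>Im s\<bar> \<ge> R \<Longrightarrow> norm (per_term a' e' s) \<le> C * exp (4 * pi * \<bar>Im s\<bar>) * (1 / norm s ^ 2)"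
    for a' e' s R C
  proof (rule suminf_le_const[OF summable_per_term(1)[OF bal']])
    fix n
    have "(\<Sum>k<n. norm (per_term a' e' (s + of_nat k))) \<le> (\<Sum>k<n. C * exp (4 * pi * \<bar>Im s\<bar>) * (1 / norm (s + of_nat k) ^ 2))"
    proof (rule sum_mono)
      fix k
      show "norm (per_term a' e' (s + of_nat k)) \<le> C * exp (4 * pi * \<bar>Im s\<bar>) * (1 / norm (s + of_nat k) ^ 2)"
        using b[of "s + of_nat k"] s by simp
    qed
    also have "\<dots> = C * exp (4 * pi * \<bar>Im s\<bar>) * (\<Sum>k<n. 1 / norm (s + of_nat k) ^ 2)"
      by (rule sum_distrib_left[symmetric])
    also have "\<dots> \<le> C * exp (4 * pi * \<bar>Im s\<bar>) * (4 / (\<bar>Im s\<bar> - 1))"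
      using s C by (intro mult_left_mono sum_inverse_squares_le) auto
    finally show "(\<Sum>k<n. norm (per_term a' e' (s + of_nat k))) \<le> C * exp (4 * pi * \<bar>Im s\<bar>) * (4 / (\<bar>Im s\<bar> - 1))" .
  qed
  \<comment> \<open>The forward sum also bounds the subtracted term \<open>per_term a e s\<close>,
    which is why the contribution \<open>4 * C1\<close> is counted twice.\<close>
  show ?thesis
  proof (rule that[of "8 * C1 + 4 * C2" "max R1 R2"])
    fix s assume s: "\<bar>Re s\<bar> \<le> 1" "\<bar>Im s\<bar> \<ge> max R1 R2"
    have "(\<Sum>k. norm (per_term a e (s + of_nat k))) \<le> C1 * exp (4 * pi * \<bar>Im s\<bar>) * (4 / (\<bar>Im s\<bar> - 1))"
      using s 1 by (intro key[OF bal, of s R1]) auto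
    moreover have "(\<Sum>k. norm (per_term a e (s - of_nat k))) \<le> C2 * exp (4 * pi * \<bar>Im s\<bar>) * (4 / (\<bar>Im s\<bar> - 1))"
    proof -
      have "per_term a e (s - of_nat k) = per_term ?a ?e (- s + of_nat k)" for k
        using per_term_reflect[of a e "- s + of_nat k"] by simp
      then show ?thesis using key[OF balanced_reflect[OF bal], of "- s" R2 C2] s 2 by simp
    qed
    moreover have "norm (per_term a e s) \<le> (\<Sum>k. norm (per_term a e (s + of_nat k)))"
      using sum_le_suminf[OF summable_per_term(1)[OF bal, of s], of "{0}"] by simp
    moreover have "norm (\<Sum>k. per_term a e (s + of_nat k)) \<le> (\<Sum>k. norm (per_term a e (s + of_nat k)))"
      by (rule summable_norm[OF summable_per_term(1)[OF bal]])
    moreover have "norm (\<Sum>k. per_term a e (s - of_nat k)) \<le> (\<Sum>k. norm (per_term a e (s - of_nat k)))"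
      by (rule summable_norm[OF summable_per_term(2)[OF bal]])
    moreover have "norm (per_sum a e s) \<le> norm (\<Sum>k. per_term a e (s + of_nat k)) + norm (\<Sum>k. per_term a e (s - of_nat k)) + norm (per_term a e s)"
      unfolding per_sum_def by (meson norm_triangle_ineq norm_triangle_ineq4 add_right_mono order.trans)
    ultimately have "norm (per_sum a e s) \<le> 2 * (C1 * exp (4 * pi * \<bar>Im s\<bar>) * (4 / (\<bar>Im s\<bar> - 1))) + C2 * exp (4 * pi * \<bar>Im s\<bar>) * (4 / (\<bar>Im s\<bar> - 1))"
      by linarith
    also have "\<dots> = (8 * C1 + 4 * C2) * exp (4 * pi * \<bar>Im s\<bar>) / (\<bar>Im s\<bar> - 1)"
      by (simp add: algebra_simps add_divide_distrib)
    finally show "norm (per_sum a e s) \<le> (8 * C1 + 4 * C2) * exp (4 * pi * \<bar>Im s\<bar>) / (\<bar>Im s\<bar> - 1)" .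
  qed (use 1 2 in auto)
qed

section \<open>Periodic entire functions of bounded growth\<close>

text \<open>
  In terms of \<open>w = exp (2 pi i s)\<close> the growth condition says \<open>F w = o(\<bar>w\<bar>\<^sup>2)\<close> at infinity and
  \<open>F w = o(\<bar>w\<bar>\<^sup>-\<^sup>2)\<close> at zero, so \<open>w\<^sup>2 F w\<close> extends to a polynomial of degree at most 3 without constant term.
\<close>

lemma periodic_entire_trig_polynomial:
  fixes E :: "complex \<Rightarrow> complex"
  assumes hol: "E holomorphic_on UNIV" and per: "\<And>s. E (s + 1) = E s" and C: "C \<ge> 0" and R: "R \<ge> 2"
    and bound: "\<And>s. \<bar>Re s\<bar> \<le> 1 \<Longrightarrow> \<bar>Im s\<bar> \<ge> R \<Longrightarrow> norm (E s) \<le> C * exp (4 * pi * \<bar>Im s\<bar>) / (\<bar>Im s\<bar> - 1)"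
  obtains \<alpha> \<beta> \<gamma> where "\<And>s. E s = \<alpha> * exp (2 * of_real pi * \<i> * s) + \<beta> + \<gamma> * exp (- (2 * of_real pi * \<i> * s))"
proof -
  define c where "c = 2 * complex_of_real pi * \<i>"
  have c0: "c \<noteq> 0" by (simp add: c_def)
  have pern: "E (s + of_nat n) = E s" for s n
  proof (induction n)
    case (Suc n)
    then show ?case using per[of "s + of_nat n"] by (simp add: add_ac)
  qed simp
  have peri: "E (s + of_int n) = E s" for s n
  proof (cases "n \<ge> 0")
    case True
    then show ?thesis using pern[of s "nat n"] by simp
  next
    case False
    then show ?thesis using pern[of "s + of_int n" "nat (- n)"] by simp
  qed
  have exp_eqD: "E (z / c) = E (z' / c)" if "exp z = exp z'" for z z'
  proof -
    obtain n :: int where "z = z' + (of_int (2 * n) * pi) * \<i>" using \<open>exp z = exp z'\<close> by (auto simp: exp_eq)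
    then have "z / c = z' / c + of_int n" by (simp add: c_def field_simps)
    then show ?thesis by (simp only: peri)
  qed
  \<comment> \<open>By \<open>exp_eqD\<close> the choice of branch of the logarithm does not affect
    \<open>E (Ln w / c)\<close>. The value 0 at the origin is the limit established in
    \<open>at0\<close>.\<close>
  define G where "G w = (if w = 0 then 0 else w ^ 2 * E (Ln w / c))" for w
  have G_bound: "norm (G w) \<le> norm w ^ 2 * (C * exp (2 * \<bar>ln (norm w)\<bar>) / (\<bar>ln (norm w)\<bar> / (2 * pi) - 1))"
    if w: "w \<noteq> 0" "\<bar>ln (norm w)\<bar> / (2 * pi) \<ge> R" for w
  proof -
    have im: "Im (Ln w / c) = - ln (norm w) / (2 * pi)" and re: "Re (Ln w / c) = Im (Ln w) / (2 * pi)"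
      using w by (simp_all add: c_def Im_divide Re_divide power2_eq_square)
    have "\<bar>Im (Ln w)\<bar> \<le> pi" using mpi_less_Im_Ln[OF w(1)] Im_Ln_le_pi[OF w(1)] by linarith
    then have "\<bar>Re (Ln w / c)\<bar> \<le> 1" unfolding re by (simp add: abs_divide divide_le_eq)
    moreover have "\<bar>Im (Ln w / c)\<bar> = \<bar>ln (norm w)\<bar> / (2 * pi)" unfolding im by (simp add: abs_divide)
    ultimately have "norm (E (Ln w / c)) \<le> C * exp (4 * pi * (\<bar>ln (norm w)\<bar> / (2 * pi))) / (\<bar>ln (norm w)\<bar> / (2 * pi) - 1)"
      using bound[of "Ln w / c"] w by simp
    also have "4 * pi * (\<bar>ln (norm w)\<bar> / (2 * pi)) = 2 * \<bar>ln (norm w)\<bar>" by simp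
    finally have b: "norm (E (Ln w / c)) \<le> C * exp (2 * \<bar>ln (norm w)\<bar>) / (\<bar>ln (norm w)\<bar> / (2 * pi) - 1)" .
    show ?thesis
      using w mult_left_mono[OF b, of "norm w ^ 2"] by (simp add: G_def norm_mult norm_power)
  qed
  have hol1: "G holomorphic_on {w. w \<notin> \<real>\<^sub>\<le>\<^sub>0}"
  proof -
    have "(E \<circ> (\<lambda>w. Ln w / c)) holomorphic_on {w. w \<notin> \<real>\<^sub>\<le>\<^sub>0}"
      by (rule holomorphic_on_compose_gen[OF _ hol]) (auto intro!: holomorphic_intros simp: c0)
    then have "(\<lambda>w. w ^ 2 * (E \<circ> (\<lambda>w. Ln w / c)) w) holomorphic_on {w. w \<notin> \<real>\<^sub>\<le>\<^sub>0}"
      by (intro holomorphic_intros)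
    then show ?thesis
      by (rule holomorphic_transform) (auto simp: G_def)
  qed
  \<comment> \<open>Across the cut of \<open>Ln\<close> the branch
    \<open>Ln (- w) + \<i> * pi\<close> represents the same function, again by periodicity.\<close>
  have hol2: "G holomorphic_on {w. - w \<notin> \<real>\<^sub>\<le>\<^sub>0}"
  proof -
    have "(E \<circ> (\<lambda>w. (Ln (- w) + \<i> * of_real pi) / c)) holomorphic_on {w. - w \<notin> \<real>\<^sub>\<le>\<^sub>0}"
      by (rule holomorphic_on_compose_gen[OF _ hol]) (auto intro!: holomorphic_intros simp: c0)
    then have "(\<lambda>w. w ^ 2 * (E \<circ> (\<lambda>w. (Ln (- w) + \<i> * of_real pi) / c)) w) holomorphic_on {w. - w \<notin> \<real>\<^sub>\<le>\<^sub>0}"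
      by (intro holomorphic_intros)
    then show ?thesis
    proof (rule holomorphic_transform)
      fix w :: complex assume "w \<in> {w. - w \<notin> \<real>\<^sub>\<le>\<^sub>0}"
      then have "w \<noteq> 0" by auto
      then have "exp (Ln (- w) + \<i> * of_real pi) = exp (Ln w)" by (simp add: exp_add)
      then show "w ^ 2 * (E \<circ> (\<lambda>w. (Ln (- w) + \<i> * of_real pi) / c)) w = G w"
        using \<open>w \<noteq> 0\<close> exp_eqD by (simp add: G_def)
    qed
  qed
  have op: "open {w. w \<notin> (\<real>\<^sub>\<le>\<^sub>0 :: complex set)}" "open {w. - w \<notin> (\<real>\<^sub>\<le>\<^sub>0 :: complex set)}"
  proof -
    show 1: "open {w. w \<notin> (\<real>\<^sub>\<le>\<^sub>0 :: complex set)}"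
      using closed_nonpos_Reals_complex by (simp add: closed_def Compl_eq)
    have "{w. - w \<notin> (\<real>\<^sub>\<le>\<^sub>0 :: complex set)} = uminus -` {w. w \<notin> \<real>\<^sub>\<le>\<^sub>0}" by auto
    then show "open {w. - w \<notin> (\<real>\<^sub>\<le>\<^sub>0 :: complex set)}"
      using open_vimage[OF 1, of uminus] by (simp add: continuous_on_minus)
  qed
  have "UNIV - {0} = {w. w \<notin> \<real>\<^sub>\<le>\<^sub>0} \<union> {w. - w \<notin> (\<real>\<^sub>\<le>\<^sub>0 :: complex set)}"
    by (auto simp: complex_nonpos_Reals_iff complex_eq_iff)
  then have hol0: "G holomorphic_on UNIV - {0}"
    using holomorphic_on_Un[OF hol1 hol2 op] by simp
  \<comment> \<open>Near 0 the factor \<open>norm w ^ 2\<close> exactly cancels the exponential in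
    \<open>G_bound\<close>; convergence to 0 comes from the logarithmic denominator alone.\<close>
  have at0: "G \<midarrow>0\<rightarrow> 0"
  proof (rule Lim_null_comparison)
    have f: "filterlim norm (at_right 0) (at (0 :: complex))"
      by (auto simp: filterlim_at eventually_at_filter intro!: tendsto_norm_zero tendsto_ident_at)
    have "((\<lambda>r::real. 1 / (- ln r / (2 * pi) - 1)) \<longlongrightarrow> 0) (at_right 0)" by real_asymp
    then have "((\<lambda>r. C * (1 / (- ln r / (2 * pi) - 1))) \<longlongrightarrow> 0) (at_right 0)" by (rule tendsto_mult_right_zero)
    then show "((\<lambda>w. C * (1 / (- ln (norm w) / (2 * pi) - 1))) \<longlongrightarrow> 0) (at (0 :: complex))"
      by (rule filterlim_compose[OF _ f])
    have "eventually (\<lambda>r::real. - ln r / (2 * pi) \<ge> R) (at_right 0)" by real_asymp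
    then have "eventually (\<lambda>w::complex. - ln (norm w) / (2 * pi) \<ge> R) (at 0)"
      by (rule eventually_compose_filterlim[OF _ f])
    moreover have "eventually (\<lambda>w::complex. w \<noteq> 0) (at 0)" by (simp add: eventually_at_filter)
    ultimately show "eventually (\<lambda>w. norm (G w) \<le> C * (1 / (- ln (norm w) / (2 * pi) - 1))) (at 0)"
    proof eventually_elim
      case (elim w)
      then have "- ln (norm w) \<ge> 0" using R by (smt (verit) divide_neg_pos pi_gt_zero)
      then have l: "\<bar>ln (norm w)\<bar> = - ln (norm w)" by simp
      have "exp (2 * \<bar>ln (norm w)\<bar>) = inverse (norm w ^ 2)"
        unfolding l using elim by (simp add: exp_minus exp_double)
      then have eq: "norm w ^ 2 * (C * exp (2 * \<bar>ln (norm w)\<bar>) / (\<bar>ln (norm w)\<bar> / (2 * pi) - 1)) =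
          C * (1 / (- ln (norm w) / (2 * pi) - 1))"
        unfolding l using elim by simp
      have "norm (G w) \<le> norm w ^ 2 * (C * exp (2 * \<bar>ln (norm w)\<bar>) / (\<bar>ln (norm w)\<bar> / (2 * pi) - 1))"
        by (rule G_bound) (use elim l in simp_all)
      then show ?case unfolding eq .
    qed
  qed
  have "isCont G 0" using at0 by (simp add: isCont_def G_def)
  moreover have "continuous_on (UNIV - {0}) G" by (rule holomorphic_on_imp_continuous_on[OF hol0])
  ultimately have "continuous_on UNIV G"
    by (auto simp: continuous_on_eq_continuous_at continuous_on_eq_continuous_at[OF open_delete] isCont_def)
  then have holG: "G holomorphic_on UNIV"
    using hol0 by (intro no_isolated_singularity[of UNIV G "{0}"]) auto
  have big: "norm (G w) \<le> norm w ^ 4 * (C * (1 / (ln (norm w) / (2 * pi) - 1)))" "norm (G w) \<le> C * norm w ^ 4"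
    if w: "norm w \<ge> exp (2 * pi * R)" for w
  proof -
    have w0: "norm w > 0" using w by (smt (verit) exp_gt_zero)
    then have "ln (norm w) \<ge> 2 * pi * R" using w by (simp add: ln_ge_iff)
    then have lR: "ln (norm w) / (2 * pi) \<ge> R" by (simp add: field_simps)
    then have "ln (norm w) \<ge> 0" using R by (smt (verit) divide_neg_pos pi_gt_zero)
    then have l: "\<bar>ln (norm w)\<bar> = ln (norm w)" by simp
    have e: "exp (2 * ln (norm w)) = norm w ^ 2" using w0 by (simp add: exp_double)
    show 1: "norm (G w) \<le> norm w ^ 4 * (C * (1 / (ln (norm w) / (2 * pi) - 1)))"
      using G_bound[of w] w0 lR unfolding l e by (simp add: power_numeral_reduce mult_ac)
    have "C * (1 / (ln (norm w) / (2 * pi) - 1)) \<le> C * 1"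
    proof (rule mult_left_mono[OF _ C])
      have "ln (norm w) / (2 * pi) - 1 \<ge> 1" using lR R by linarith
      then show "1 / (ln (norm w) / (2 * pi) - 1) \<le> 1"
        using frac_le[of 1 1 1 "ln (norm w) / (2 * pi) - 1"] by simp
    qed
    then have "norm w ^ 4 * (C * (1 / (ln (norm w) / (2 * pi) - 1))) \<le> norm w ^ 4 * (C * 1)"
      by (rule mult_left_mono) simp
    then show "norm (G w) \<le> C * norm w ^ 4" using 1 by (simp add: mult.commute)
  qed
  define d where "d k = (deriv ^^ k) G 0 / fact k" for k
  have "G w = (\<Sum>k\<le>4. d k * w ^ k)" for w
    unfolding d_def by (rule Liouville_polynomial[OF holG big(2)])
  moreover have "{..4::nat} = {0, 1, 2, 3, 4}" by auto
  ultimately have Gp: "G w = d 0 + d 1 * w + d 2 * w ^ 2 + d 3 * w ^ 3 + d 4 * w ^ 4" for w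
    by (simp add: add_ac)
  have d0: "d 0 = 0" using Gp[of 0] by (simp add: G_def)
  \<comment> \<open>Liouville's theorem only bounds the degree by 4; the logarithmic gain in
    \<open>big(1)\<close> removes the top coefficient.\<close>
  have d4: "d 4 = 0"
  proof -
    have "((\<lambda>r::real. d 1 * of_real (1 / r ^ 3) + d 2 * of_real (1 / r ^ 2) + d 3 * of_real (1 / r) + d 4) \<longlongrightarrow>
        d 1 * of_real 0 + d 2 * of_real 0 + d 3 * of_real 0 + d 4) at_top"
      by (intro tendsto_intros; real_asymp)
    moreover have "eventually (\<lambda>r::real. d 1 * of_real (1 / r ^ 3) + d 2 * of_real (1 / r ^ 2) + d 3 * of_real (1 / r) + d 4
        = G (of_real r) / of_real r ^ 4) at_top"
      using eventually_gt_at_top[of 0]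
    proof eventually_elim
      case (elim r)
      then show ?case unfolding Gp d0 by (simp add: field_simps power_numeral_reduce)
    qed
    ultimately have "((\<lambda>r::real. G (of_real r) / of_real r ^ 4) \<longlongrightarrow> d 4) at_top"
      by (auto intro: Lim_transform_eventually)
    moreover have "((\<lambda>r::real. G (of_real r) / of_real r ^ 4) \<longlongrightarrow> 0) at_top"
    proof (rule Lim_null_comparison)
      have "((\<lambda>r::real. 1 / (ln r / (2 * pi) - 1)) \<longlongrightarrow> 0) at_top" by real_asymp
      then show "((\<lambda>r::real. C * (1 / (ln r / (2 * pi) - 1))) \<longlongrightarrow> 0) at_top" by (rule tendsto_mult_right_zero)
      show "eventually (\<lambda>r::real. norm (G (of_real r) / of_real r ^ 4) \<le> C * (1 / (ln r / (2 * pi) - 1))) at_top"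
        using eventually_ge_at_top[of "exp (2 * pi * R)"]
      proof eventually_elim
        case (elim r)
        then have r: "r > 0" by (smt (verit) exp_gt_zero)
        then show ?case using big(1)[of "of_real r"] elim by (simp add: norm_divide norm_power divide_le_eq mult.commute)
      qed
    qed
    ultimately show ?thesis by (intro tendsto_unique[OF trivial_limit_at_top_linorder])
  qed
  show ?thesis
  proof (rule that[of "d 3" "d 2" "d 1"])
    fix s
    define w where "w = exp (c * s)"
    have w0: "w \<noteq> 0" by (simp add: w_def)
    have "E (Ln w / c) = E (c * s / c)" by (rule exp_eqD) (simp add: w_def)
    then have "w ^ 2 * E s = G w" using w0 c0 by (simp add: G_def)
    also have "\<dots> = w ^ 2 * (d 3 * w + d 2 + d 1 * inverse w)"
      unfolding Gp d0 d4 using w0 by (simp add: field_simps power_numeral_reduce)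
    finally have "E s = d 3 * w + d 2 + d 1 * inverse w" using w0 by simp
    then show "E s = d 3 * exp (2 * of_real pi * \<i> * s) + d 2 + d 1 * exp (- (2 * of_real pi * \<i> * s))"
      by (simp add: w_def c_def exp_minus)
  qed
qed

section \<open>The three-term relation\<close>

definition exp_i_pi :: "complex \<Rightarrow> complex" where "exp_i_pi z = exp (\<i> * of_real pi * z)"

lemma exp_i_pi_nonzero [simp]: "exp_i_pi z \<noteq> 0" by (simp add: exp_i_pi_def)
lemma exp_i_pi_add: "exp_i_pi (z + w) = exp_i_pi z * exp_i_pi w" by (simp add: exp_i_pi_def distrib_left exp_add)
lemma exp_i_pi_diff: "exp_i_pi (z - w) = exp_i_pi z / exp_i_pi w" by (simp add: exp_i_pi_def right_diff_distrib exp_diff)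
lemma exp_i_pi_minus: "exp_i_pi (- z) = 1 / exp_i_pi z" by (simp add: exp_i_pi_def exp_minus field_simps)
lemma exp_i_pi_1: "exp_i_pi 1 = -1" by (simp add: exp_i_pi_def mult.commute)

definition cospi :: "complex \<Rightarrow> complex" where "cospi z = cos (of_real pi * z)"

lemma sinpi_exp_i_pi: "sinpi z = (exp_i_pi z - 1 / exp_i_pi z) / (2 * \<i>)"
  by (simp add: sinpi_def sin_exp_eq exp_i_pi_def exp_minus field_simps)
lemma cospi_exp_i_pi: "cospi z = (exp_i_pi z + 1 / exp_i_pi z) / 2"
  by (simp add: cospi_def cos_exp_eq exp_i_pi_def exp_minus field_simps)

lemma exp_i_pi_double: "exp_i_pi (2 * a) = exp_i_pi a ^ 2"
  by (simp add: exp_i_pi_def exp_double[symmetric] mult_ac)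

text \<open>
  The bracket in \<^const>\<open>gamma_raw\<close> divided by \<open>sin \<pi>(c - b)\<close>, as the product-to-sum formulas give it.
\<close>

definition gamma_factor :: "complex \<Rightarrow> complex \<Rightarrow> complex \<Rightarrow> complex \<Rightarrow> complex \<Rightarrow> complex \<Rightarrow> complex \<Rightarrow> complex" where
  "gamma_factor a b c d e f g = (cospi (f - g) * sinpi (2 * a - e) + cospi (e - b - c) * sinpi (a + d - e) + cospi (b - c) * sinpi (a - d)) / 2"

lemma i_times_i: "\<i> * \<i> = -1" by simp

text \<open>These rules turn each identity between sines and cosines into a rational identity in the
  exponentials of the free parameters, with \<open>g\<close> eliminated by the balance condition
  where it occurs. After clearing denominators \<open>algebra\<close> decides it, given
  \<open>i_times_i\<close>.\<close>

lemmas exp_i_pi_simps = sinpi_exp_i_pi cospi_exp_i_pi exp_i_pi_add exp_i_pi_diff exp_i_pi_minus exp_i_pi_1 exp_i_pi_double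

text \<open>Lagrange interpolation with nodes \<open>0\<close>, \<open>- b\<close>,
  \<open>- a\<close> in the span of \<open>1\<close> and
  \<open>exp (\<plusminus> 2 \<pi> \<i> z)\<close>: a product of two sines shifted in
  \<open>z\<close> lies in this span and vanishes at two prescribed nodes. The common denominator is
  multiplied out.\<close>

lemma trig_polynomial_Lagrange:
  "sinpi a * sinpi b * sinpi (a - b) * (\<alpha> * exp_i_pi z ^ 2 + \<beta> + \<gamma> * (1 / exp_i_pi z) ^ 2) =
    (\<alpha> + \<beta> + \<gamma>) * sinpi (z + a) * sinpi (z + b) * sinpi (a - b)
    - (\<alpha> * (1 / exp_i_pi b) ^ 2 + \<beta> + \<gamma> * exp_i_pi b ^ 2) * sinpi z * sinpi (z + a) * sinpi a
    + (\<alpha> * (1 / exp_i_pi a) ^ 2 + \<beta> + \<gamma> * exp_i_pi a ^ 2) * sinpi z * sinpi (z + b) * sinpi b"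
proof -
  define A B Z where "A = exp_i_pi a" and "B = exp_i_pi b" and "Z = exp_i_pi z"
  have nz: "A \<noteq> 0" "B \<noteq> 0" "Z \<noteq> 0" by (simp_all add: A_def B_def Z_def)
  show ?thesis unfolding exp_i_pi_simps A_def[symmetric] B_def[symmetric] Z_def[symmetric]
    using nz by (simp add: divide_simps) algebra
qed

text \<open>Used for the coefficient of \<open>E (- b)\<close>, both as it stands and with
  \<open>e\<close> and \<open>f\<close> exchanged.\<close>

lemma gamma_factor_product_form:
  assumes "e + f + g - a - b - c - d = 1"
  shows "sinpi (e - a - b) * sinpi (g - b) * sinpi (f - a) - sinpi (a - b) * sinpi (f - c) * sinpi (f - d) = - gamma_factor a b c d e f g"
proof -
  have g: "g = 1 + a + b + c + d - e - f" using assms by algebra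
  define A B C D E F where "A = exp_i_pi a" and "B = exp_i_pi b" and "C = exp_i_pi c" and "D = exp_i_pi d" and "E = exp_i_pi e" and "F = exp_i_pi f"
  have nz: "A \<noteq> 0" "B \<noteq> 0" "C \<noteq> 0" "D \<noteq> 0" "E \<noteq> 0" "F \<noteq> 0"
    by (simp_all add: A_def B_def C_def D_def E_def F_def)
  show ?thesis unfolding gamma_factor_def g exp_i_pi_simps A_def[symmetric] B_def[symmetric] C_def[symmetric] D_def[symmetric] E_def[symmetric] F_def[symmetric]
    using nz by (simp add: divide_simps) (insert i_times_i, algebra)
qed

text \<open>Makes the coefficient of \<open>E 0\<close> vanish.\<close>

lemma gamma_factor_antisym:
  assumes "e + f + g - a - b - c - d = 1"
  shows "gamma_factor a b c d f e g - gamma_factor a b c d e f g + sinpi (f - e) * sinpi a * sinpi (g - a) = 0"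
proof -
  have g: "g = 1 + a + b + c + d - e - f" using assms by algebra
  define A B C D E F where "A = exp_i_pi a" and "B = exp_i_pi b" and "C = exp_i_pi c" and "D = exp_i_pi d" and "E = exp_i_pi e" and "F = exp_i_pi f"
  have nz: "A \<noteq> 0" "B \<noteq> 0" "C \<noteq> 0" "D \<noteq> 0" "E \<noteq> 0" "F \<noteq> 0"
    by (simp_all add: A_def B_def C_def D_def E_def F_def)
  show ?thesis unfolding gamma_factor_def g exp_i_pi_simps A_def[symmetric] B_def[symmetric] C_def[symmetric] D_def[symmetric] E_def[symmetric] F_def[symmetric]
    using nz by (simp add: divide_simps) (insert i_times_i, algebra)
qed

text \<open>Exhibits the factor \<open>sinpi (c - b)\<close> of the bracket, so that the
  singularities of \<open>gamma_raw\<close> are removable with \<open>gamma_factor\<close> as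
  quotient.\<close>

lemma gamma_bracket:
  assumes "e + f + g - a - b - c - d = 1"
  shows "sinpi (a - c) * sinpi (e - a - b) * sinpi (f - b) * sinpi (g - b) -
      sinpi (a - b) * sinpi (e - a - c) * sinpi (f - c) * sinpi (g - c) = sinpi (c - b) * gamma_factor a b c d e f g"
proof -
  have g: "g = 1 + a + b + c + d - e - f" using assms by algebra
  define A B C D E F where "A = exp_i_pi a" and "B = exp_i_pi b" and "C = exp_i_pi c" and "D = exp_i_pi d" and "E = exp_i_pi e" and "F = exp_i_pi f"
  have nz: "A \<noteq> 0" "B \<noteq> 0" "C \<noteq> 0" "D \<noteq> 0" "E \<noteq> 0" "F \<noteq> 0"
    by (simp_all add: A_def B_def C_def D_def E_def F_def)
  show ?thesis unfolding gamma_factor_def g exp_i_pi_simps A_def[symmetric] B_def[symmetric] C_def[symmetric] D_def[symmetric] E_def[symmetric] F_def[symmetric]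
    using nz by (simp add: divide_simps) (insert i_times_i, algebra)
qed

text \<open>Makes the coefficient of \<open>E (- a)\<close> vanish.\<close>

lemma gamma_factor_elimination:
  assumes "e + f + g - a - b - c - d = 1"
  shows "sinpi (f - b) * gamma_factor a b c d f e g * sinpi (e - a - b) - sinpi (e - b) * gamma_factor a b c d e f g * sinpi (f - a - b) +
     sinpi (f - e) * sinpi a * sinpi (a - b) * sinpi (g - c) * sinpi (g - d) = 0"
proof -
  have g: "g = 1 + a + b + c + d - e - f" using assms by algebra
  define A B C D E F where "A = exp_i_pi a" and "B = exp_i_pi b" and "C = exp_i_pi c" and "D = exp_i_pi d" and "E = exp_i_pi e" and "F = exp_i_pi f"
  have nz: "A \<noteq> 0" "B \<noteq> 0" "C \<noteq> 0" "D \<noteq> 0" "E \<noteq> 0" "F \<noteq> 0"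
    by (simp_all add: A_def B_def C_def D_def E_def F_def)
  show ?thesis unfolding gamma_factor_def g exp_i_pi_simps A_def[symmetric] B_def[symmetric] C_def[symmetric] D_def[symmetric] E_def[symmetric] F_def[symmetric]
    using nz by (simp add: divide_simps) (insert i_times_i, algebra)
qed

text \<open>The elimination, with all sines as independent variables: \<open>x0\<close>,
  \<open>xa\<close>, \<open>xb\<close>, \<open>xe\<close>, \<open>xf\<close> stand for
  \<open>E\<close> at \<open>0\<close>, \<open>- a\<close>, \<open>- b\<close>,
  \<open>e - a - b\<close>, \<open>f - a - b\<close>. Substituting the interpolation formulas
  \<open>xe\<close> and \<open>xf\<close> leaves a linear form in \<open>x0\<close>,
  \<open>xa\<close>, \<open>xb\<close>; \<open>i1\<close>, \<open>i3\<close> and the pair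
  \<open>i2\<close>, \<open>i2'\<close> annihilate its coefficients.\<close>

lemma three_term_combination:
  fixes sa sb sab sea sfa seb sfb sgb sga seab sfab sfe sfc sfd sec sed sgc sgd ge gf x0 xa xb xe xf :: complex
  assumes xe: "sa * sb * sab * xe = x0 * seb * sea * sab - xb * seab * seb * sa + xa * seab * sea * sb"
    and xf: "sa * sb * sab * xf = x0 * sfb * sfa * sab - xb * sfab * sfb * sa + xa * sfab * sfa * sb"
    and i1: "gf - ge + sfe * sa * sga = 0"
    and i2: "seab * sgb * sfa - sab * sfc * sfd = - ge" and i2': "sfab * sgb * sea - sab * sec * sed = - gf"
    and i3: "sfb * gf * seab - seb * ge * sfab + sfe * sa * sab * sgc * sgd = 0"
  shows "sa * sb * sab * (sfb * gf * (xe * sb * sgb * sfa + xb * seb * sfc * sfd) - seb * ge * (xf * sb * sgb * sea + xb * sfb * sec * sed) +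
     sfe * sea * sfa * sgb * (x0 * sga * sfb * seb + xa * sb * sgc * sgd)) = 0"
proof -
  have "sa * sb * sab * (sfb * gf * (xe * sb * sgb * sfa + xb * seb * sfc * sfd) - seb * ge * (xf * sb * sgb * sea + xb * sfb * sec * sed) +
     sfe * sea * sfa * sgb * (x0 * sga * sfb * seb + xa * sb * sgc * sgd)) =
     sfb * gf * ((sa * sb * sab * xe) * sb * sgb * sfa + xb * seb * (sa * sb) * (sab * sfc * sfd)) -
     seb * ge * ((sa * sb * sab * xf) * sb * sgb * sea + xb * sfb * (sa * sb) * (sab * sec * sed)) +
     sa * sb * sab * sfe * sea * sfa * sgb * (x0 * sga * sfb * seb + xa * sb * sgc * sgd)"
    by algebra
  also have "\<dots> = x0 * sab * seb * sfb * sea * sfa * sb * sgb * (gf - ge + sfe * sa * sga)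
     - xb * sa * sb * seb * sfb * (gf * (seab * sgb * sfa - sab * sfc * sfd) - ge * (sfab * sgb * sea - sab * sec * sed))
     + xa * sea * sfa * sb * sb * sgb * (sfb * gf * seab - seb * ge * sfab + sfe * sa * sab * sgc * sgd)"
    unfolding xe xf by algebra
  also have "\<dots> = 0" unfolding i1 i2 i2' i3 by algebra
  finally show ?thesis .
qed

section \<open>Values of the bilateral sum and assembly of the relation\<close>

lemma sinpi_eq_0_iff: "sinpi z = 0 \<longleftrightarrow> z \<in> \<int>"
proof -
  have "sinpi z = 0 \<longleftrightarrow> (\<exists>n::int. of_real pi * z = of_real (n * pi))"
    unfolding sinpi_def by (rule sin_eq_0)
  also have "\<dots> \<longleftrightarrow> (\<exists>n::int. z = of_int n)"
    by (simp add: mult.commute[of _ "of_real pi :: complex"])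
  finally show ?thesis by (auto simp: Ints_def)
qed

lemma sinpi_rGamma: "sinpi z = of_real pi * (rGamma z * rGamma (1 - z))"
  by (simp add: sinpi_def rGamma_reflection_complex)

lemma sinpi_reflect: "sinpi (1 - z) = sinpi z"
  by (simp add: sinpi_rGamma mult.commute)

lemma per_term_params4:
  "per_term (params4 a b c d) (params4 h e f g) s =
     rGamma (1 - a - s) * rGamma (1 - b - s) * rGamma (1 - c - s) * rGamma (1 - d - s) *
     (rGamma (h + s) * rGamma (e + s) * rGamma (f + s) * rGamma (g + s))"
  by (simp add: per_term_def lessThan_4 mult_ac)

text \<open>The lower parameter 1 contributes \<open>rGamma (1 - k)\<close>, which vanishes for
  every positive \<open>k\<close>: at \<open>s = 0\<close> the backward half reduces to its first
  term.\<close>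

lemma per_sum_0:
  assumes "e + f + g - a - b - c - d = 1"
  shows "per_sum (params4 a b c d) (params4 1 e f g) 0 =
    rGamma (1 - a) * rGamma (1 - b) * rGamma (1 - c) * rGamma (1 - d) * reg_F43 a b c d e f g"
proof -
  have bal: "balanced (params4 a b c d) (params4 1 e f g)" using assms by (simp add: balanced_params4)
  have "per_term (params4 a b c d) (params4 1 e f g) (0 - of_nat k) = 0" if "k \<noteq> 0" for k
  proof -
    have "1 + (0 - of_nat k) = (- of_nat (k - 1) :: complex)" using that by (simp add: of_nat_diff)
    then have "rGamma (1 + (0 - of_nat k) :: complex) = 0" by (simp add: rGamma_eq_zero_iff)
    then show ?thesis by (simp add: per_term_params4)
  qed
  then have "(\<Sum>k. per_term (params4 a b c d) (params4 1 e f g) (0 - of_nat k)) = per_term (params4 a b c d) (params4 1 e f g) 0"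
    using suminf_finite[of "{0}" "\<lambda>k. per_term (params4 a b c d) (params4 1 e f g) (0 - of_nat k)"] by simp
  then have "per_sum (params4 a b c d) (params4 1 e f g) 0 = (\<Sum>k. per_term (params4 a b c d) (params4 1 e f g) (0 + of_nat k))"
    by (simp add: per_sum_def)
  also have "\<dots> = (\<Sum>k. (rGamma (1 - a) * rGamma (1 - b) * rGamma (1 - c) * rGamma (1 - d)) * hyp_term (params4 a b c d) (params4 1 e f g) k)"
    unfolding per_term_add_nat by (simp add: lessThan_4 mult_ac)
  also have "\<dots> = (rGamma (1 - a) * rGamma (1 - b) * rGamma (1 - c) * rGamma (1 - d)) * reg_F43 a b c d e f g"
    unfolding reg_F43_eq_hyp_term
    by (rule suminf_mult[OF summable_norm_cancel[OF summable_norm_hyp_term[OF bal]]])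
  finally show ?thesis .
qed

text \<open>At \<open>s = - a\<close> the upper parameter \<open>a\<close> cuts off the forward half
  instead. Reflection about this point reduces to \<open>per_sum_0\<close> for the parameters of the
  second series in \<open>K\<close>.\<close>

lemma per_sum_neg:
  assumes "e + f + g - a - b - c - d = 1"
  shows "per_sum (params4 a b c d) (params4 1 e f g) (- a) =
    rGamma (1 - a) * rGamma (e - a) * rGamma (f - a) * rGamma (g - a) *
     reg_F43 a (1 + a - e) (1 + a - f) (1 + a - g) (1 + a - b) (1 + a - c) (1 + a - d)"
proof -
  let ?T = "per_term (params4 a b c d) (params4 1 e f g)"
  let ?U = "per_term (params4 a (1 + a - e) (1 + a - f) (1 + a - g)) (params4 1 (1 + a - b) (1 + a - c) (1 + a - d))"
  have U: "?T (- a + t) = ?U (- t)" for t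
    unfolding per_term_params4 by (simp add: algebra_simps)
  have U1: "?T (- a - t) = ?U t" for t using U[of "- t"] by simp
  have "per_sum (params4 a b c d) (params4 1 e f g) (- a) =
      per_sum (params4 a (1 + a - e) (1 + a - f) (1 + a - g)) (params4 1 (1 + a - b) (1 + a - c) (1 + a - d)) 0"
    unfolding per_sum_def U U1 using U[of 0] by simp
  also have "\<dots> = rGamma (1 - a) * rGamma (1 - (1 + a - e)) * rGamma (1 - (1 + a - f)) * rGamma (1 - (1 + a - g)) *
     reg_F43 a (1 + a - e) (1 + a - f) (1 + a - g) (1 + a - b) (1 + a - c) (1 + a - d)"
    by (rule per_sum_0) (use assms in algebra)
  finally show ?thesis by simp
qed

lemma per_sum_shiftI:
  assumes "\<And>s. per_term a e s = per_term a' e' (s + t)"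
  shows "per_sum a e s = per_sum a' e' (s + t)"
  unfolding per_sum_def assms by (simp add: algebra_simps)

text \<open>The two series in \<open>K\<close> are the values of \<open>E\<close> at
  \<open>0\<close> and \<open>- a\<close> up to reciprocal Gammas. Multiplying by the missing ones
  lets the reflection formula produce sines, and no division restricts the parameters.\<close>

lemma Kf_eq_per_sum:
  assumes "e + f + g - a - b - c - d = 1"
  shows "of_real pi ^ 3 * (rGamma (1 - a) * rGamma (1 - b) * rGamma (1 - c) * rGamma (1 - d) *
      rGamma (e - a) * rGamma (f - a) * rGamma (g - a)) * Kf a b c d e f g =
    per_sum (params4 a b c d) (params4 1 e f g) 0 * (sinpi (e - a) * sinpi (f - a) * sinpi (g - a)) +
    per_sum (params4 a b c d) (params4 1 e f g) (- a) * (sinpi b * sinpi c * sinpi d)"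
proof -
  have s: "sinpi (z - a) = of_real pi * (rGamma (z - a) * rGamma (1 + a - z))" for z
    using sinpi_rGamma[of "z - a"] by (simp add: algebra_simps)
  show ?thesis
    unfolding per_sum_0[OF assms] per_sum_neg[OF assms] s sinpi_rGamma[of b] sinpi_rGamma[of c] sinpi_rGamma[of d] Kf_def
    by algebra
qed

lemma per_sum_Lagrange:
  assumes "balanced a e"
  shows "sinpi x * sinpi y * sinpi (x - y) * per_sum a e z =
    per_sum a e 0 * sinpi (z + x) * sinpi (z + y) * sinpi (x - y)
    - per_sum a e (- y) * sinpi z * sinpi (z + x) * sinpi x
    + per_sum a e (- x) * sinpi z * sinpi (z + y) * sinpi y"
proof -
  obtain C R where CR: "C \<ge> 0" "R \<ge> 2"
    "\<And>s. \<bar>Re s\<bar> \<le> 1 \<Longrightarrow> \<bar>Im s\<bar> \<ge> R \<Longrightarrow> norm (per_sum a e s) \<le> C * exp (4 * pi * \<bar>Im s\<bar>) / (\<bar>Im s\<bar> - 1)"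
    using per_sum_bound[OF assms] by metis
  obtain \<alpha> \<beta> \<gamma> where *: "\<And>s. per_sum a e s = \<alpha> * exp (2 * of_real pi * \<i> * s) + \<beta> + \<gamma> * exp (- (2 * of_real pi * \<i> * s))"
    using periodic_entire_trig_polynomial[OF per_sum_holomorphic[OF assms] per_sum_periodic[OF assms] CR] by metis
  have x: "exp (2 * of_real pi * \<i> * s) = exp_i_pi s ^ 2" for s
    by (simp add: exp_i_pi_def exp_double[symmetric] mult_ac)
  have p: "per_sum a e s = \<alpha> * exp_i_pi s ^ 2 + \<beta> + \<gamma> * (1 / exp_i_pi s) ^ 2" for s
    unfolding * exp_minus x by (simp add: power_one_over inverse_eq_divide)
  have "exp_i_pi 0 = 1" by (simp add: exp_i_pi_def)
  then show ?thesis
    using trig_polynomial_Lagrange[of x y \<alpha> z \<beta> \<gamma>] unfolding p exp_i_pi_minus by simp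
qed

text \<open>Here \<open>gamma\<close> is replaced by its continuous form, so the expression is
  entire along every complex line on which the balance condition holds.\<close>

definition relation_lhs :: "complex \<Rightarrow> complex \<Rightarrow> complex \<Rightarrow> complex \<Rightarrow> complex \<Rightarrow> complex \<Rightarrow> complex \<Rightarrow> complex" where
  "relation_lhs a b c d e f g =
     sinpi a * sinpi (f - e) * sinpi (g - c) * sinpi (g - d) *
       (rGamma (1 + b - e) * rGamma (e - a) * rGamma (1 + b - f) * rGamma (1 + b - g) * rGamma (g - a) * rGamma (f - a)) *
       Kf a b c d e f g +
     sinpi (f - b) * gamma_factor a b c d f e g *
       (rGamma a * rGamma (1 + b - e) * rGamma (f - c) * rGamma (f - d) * rGamma (g - c) * rGamma (g - d)) *
       Kf (e - a) (e - b) (e - c) (e - d) (1 + e - f) (1 + e - g) e -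
     sinpi (e - b) * gamma_factor a b c d e f g *
       (rGamma a * rGamma (1 + b - f) * rGamma (e - c) * rGamma (e - d) * rGamma (g - c) * rGamma (g - d)) *
       Kf (f - a) (f - b) (f - c) (f - d) (1 + f - g) f (1 + f - e)"

text \<open>\<open>Kf_swap\<close> is applied with \<open>1 + e - f\<close> in the role of
  \<open>g\<close>. The resulting parameters are those of the common \<open>E\<close> shifted by
  \<open>e - a - b\<close>, and the two points \<open>0\<close> and \<open>- (e - a)\<close> move to
  \<open>e - a - b\<close> and \<open>- b\<close>. Since the common list is symmetric in
  \<open>e\<close> and \<open>f\<close>, exchanging these two letters gives the formula for
  \<open>n8\<close>.\<close>

lemma Kf_n4_eq_per_sum:
  assumes bal: "e + f + g - a - b - c - d = 1"
  shows "of_real pi ^ 3 * (rGamma (1 + a - e) * rGamma (1 + b - e) * rGamma (f - c) * rGamma (f - d) *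
      rGamma (1 - b) * rGamma (g - b) * rGamma (1 + a - f)) * Kf (e - a) (e - b) (e - c) (e - d) (1 + e - g) e (1 + e - f) =
    per_sum (params4 a b (g - d) (g - c)) (params4 1 (1 + a + b - f) (1 + a + b - e) g) (e - a - b) * (sinpi b * sinpi (g - b) * sinpi (f - a)) +
    per_sum (params4 a b (g - d) (g - c)) (params4 1 (1 + a + b - f) (1 + a + b - e) g) (- b) * (sinpi (e - b) * sinpi (f - c) * sinpi (f - d))"
proof -
  have g: "g = 1 + a + b + c + d - e - f" using bal by algebra
  let ?A = "params4 a b (g - d) (g - c)" and ?E = "params4 1 (1 + a + b - f) (1 + a + b - e) g"
  let ?A' = "params4 (e - a) (e - b) (1 + d - f) (1 + c - f)" and ?E' = "params4 1 (1 + e - a - b) (1 + c + d - f) (1 + e - f)"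
  have "Kf (e - a) (e - b) (e - c) (e - d) (1 + e - g) e (1 + e - f) =
      Kf (e - a) (e - b) (1 + e - f - (e - d)) (1 + e - f - (e - c)) (1 + e - g + (1 + e - f) - (e - c) - (e - d))
        (e + (1 + e - f) - (e - c) - (e - d)) (1 + e - f)"
    by (rule Kf_swap) (use bal in algebra)
  also have "\<dots> = Kf (e - a) (e - b) (1 + d - f) (1 + c - f) (1 + e - a - b) (1 + c + d - f) (1 + e - f)"
    unfolding g by (intro Kf_cong) (simp_all add: algebra_simps)
  finally have K: "Kf (e - a) (e - b) (e - c) (e - d) (1 + e - g) e (1 + e - f) =
      Kf (e - a) (e - b) (1 + d - f) (1 + c - f) (1 + e - a - b) (1 + c + d - f) (1 + e - f)" .
  have "per_term ?A' ?E' s = per_term ?A ?E (s + (e - a - b))" for s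
    unfolding per_term_params4 g by (simp add: algebra_simps)
  then have p: "per_sum ?A' ?E' s = per_sum ?A ?E (s + (e - a - b))" for s
    by (rule per_sum_shiftI)
  have p0: "per_sum ?A' ?E' 0 = per_sum ?A ?E (e - a - b)" "per_sum ?A' ?E' (- (e - a)) = per_sum ?A ?E (- b)"
    unfolding p by (rule arg_cong[of _ _ "per_sum ?A ?E"], simp)+
  have s: "sinpi (1 + e - a - b - (e - a)) = sinpi b" "sinpi (1 + c + d - f - (e - a)) = sinpi (g - b)"
    "sinpi (1 + e - f - (e - a)) = sinpi (f - a)" "sinpi (1 + d - f) = sinpi (f - d)" "sinpi (1 + c - f) = sinpi (f - c)"
    using sinpi_reflect[of b] sinpi_reflect[of "f - a"] sinpi_reflect[of "f - d"] sinpi_reflect[of "f - c"]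
    by (simp_all add: g algebra_simps)
  have r: "1 - (e - a) = 1 + a - e" "1 - (e - b) = 1 + b - e" "1 - (1 + d - f) = f - d" "1 - (1 + c - f) = f - c"
    "1 + e - a - b - (e - a) = 1 - b" "1 + c + d - f - (e - a) = g - b" "1 + e - f - (e - a) = 1 + a - f"
    unfolding g by simp_all
  have "of_real pi ^ 3 * (rGamma (1 - (e - a)) * rGamma (1 - (e - b)) * rGamma (1 - (1 + d - f)) * rGamma (1 - (1 + c - f)) *
      rGamma (1 + e - a - b - (e - a)) * rGamma (1 + c + d - f - (e - a)) * rGamma (1 + e - f - (e - a))) *
      Kf (e - a) (e - b) (1 + d - f) (1 + c - f) (1 + e - a - b) (1 + c + d - f) (1 + e - f) =
    per_sum ?A' ?E' 0 * (sinpi (1 + e - a - b - (e - a)) * sinpi (1 + c + d - f - (e - a)) * sinpi (1 + e - f - (e - a))) +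
    per_sum ?A' ?E' (- (e - a)) * (sinpi (e - b) * sinpi (1 + d - f) * sinpi (1 + c - f))"
    by (rule Kf_eq_per_sum) (simp add: algebra_simps)
  then show ?thesis
    unfolding s p0 K unfolding r by (simp add: mult_ac)
qed

text \<open>Multiplication by \<open>pi ^ 3\<close> and the reciprocal Gammas in \<open>M\<close>
  completes the coefficient of each \<open>K\<close> to the one for which \<open>Y0\<close>,
  \<open>Y4\<close>, \<open>Y8\<close> express it through \<open>E\<close>. Genericity permits
  dividing by this multiplier and by the interpolation denominator
  \<open>sinpi a * sinpi b * sinpi (a - b)\<close>.\<close>

lemma relation_lhs_generic:
  assumes bal: "e + f + g - a - b - c - d = 1"
    and nz: "sinpi a \<noteq> 0" "sinpi b \<noteq> 0" "sinpi (a - b) \<noteq> 0"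
    and M: "rGamma (1 + a - e) \<noteq> 0" "rGamma (1 - b) \<noteq> 0" "rGamma (g - b) \<noteq> 0" "rGamma (1 + a - f) \<noteq> 0"
  shows "relation_lhs a b c d e f g = 0"
proof -
  have g: "g = 1 + a + b + c + d - e - f" using bal by algebra
  let ?A = "params4 a b (g - d) (g - c)" and ?E = "params4 1 (1 + a + b - f) (1 + a + b - e) g"
  define P where "P = per_sum ?A ?E"
  have balP: "balanced ?A ?E" unfolding balanced_params4 g by simp
  have bal': "f + e + g - a - b - c - d = 1" using bal by (simp add: algebra_simps)
  have sym: "per_sum ?A (params4 1 (1 + a + b - e) (1 + a + b - f) g) = P"
    unfolding P_def per_sum_def[abs_def] per_term_params4 by (simp add: mult_ac)
  have K0: "Kf a b c d e f g = Kf a b (g - d) (g - c) (1 + a + b - f) (1 + a + b - e) g"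
  proof -
    have "e + g - c - d = 1 + a + b - f" "f + g - c - d = 1 + a + b - e" unfolding g by simp_all
    then show ?thesis using Kf_swap[OF bal] by simp
  qed
  have r0: "1 + a + b - f - a = 1 + b - f" "1 + a + b - e - a = 1 + b - e" by simp_all
  have s0: "sinpi (1 + b - f) = sinpi (f - b)" "sinpi (1 + b - e) = sinpi (e - b)"
    using sinpi_reflect[of "f - b"] sinpi_reflect[of "e - b"] by (simp_all add: algebra_simps)
  have Y0: "of_real pi ^ 3 * (rGamma (1 - a) * rGamma (1 - b) * rGamma (1 - (g - d)) * rGamma (1 - (g - c)) *
      rGamma (1 + b - f) * rGamma (1 + b - e) * rGamma (g - a)) * Kf a b c d e f g =
    P 0 * (sinpi (f - b) * sinpi (e - b) * sinpi (g - a)) + P (- a) * (sinpi b * sinpi (g - d) * sinpi (g - c))"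
    using Kf_eq_per_sum[of "1 + a + b - f" "1 + a + b - e" g a b "g - d" "g - c"]
    unfolding r0 s0 K0[symmetric] P_def[symmetric] by (simp add: g)
  define K4 where "K4 = Kf (e - a) (e - b) (e - c) (e - d) (1 + e - f) (1 + e - g) e"
  define K8 where "K8 = Kf (f - a) (f - b) (f - c) (f - d) (1 + f - g) f (1 + f - e)"
  have K4: "K4 = Kf (e - a) (e - b) (e - c) (e - d) (1 + e - g) e (1 + e - f)"
    unfolding K4_def using Kf_commute(2,3) by metis
  note Y4 = Kf_n4_eq_per_sum[OF bal, folded P_def K4]
  note Y8 = Kf_n4_eq_per_sum[OF bal', unfolded sym, folded K8_def]
  have comb: "sinpi a * sinpi b * sinpi (a - b) *
     (sinpi (f - b) * gamma_factor a b c d f e g * (P (e - a - b) * sinpi b * sinpi (g - b) * sinpi (f - a) + P (- b) * sinpi (e - b) * sinpi (f - c) * sinpi (f - d)) -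
      sinpi (e - b) * gamma_factor a b c d e f g * (P (f - a - b) * sinpi b * sinpi (g - b) * sinpi (e - a) + P (- b) * sinpi (f - b) * sinpi (e - c) * sinpi (e - d)) +
     sinpi (f - e) * sinpi (e - a) * sinpi (f - a) * sinpi (g - b) *
       (P 0 * sinpi (g - a) * sinpi (f - b) * sinpi (e - b) + P (- a) * sinpi b * sinpi (g - c) * sinpi (g - d))) = 0"
  proof (rule three_term_combination)
    show "sinpi a * sinpi b * sinpi (a - b) * P (e - a - b) = P 0 * sinpi (e - b) * sinpi (e - a) * sinpi (a - b)
        - P (- b) * sinpi (e - a - b) * sinpi (e - b) * sinpi a + P (- a) * sinpi (e - a - b) * sinpi (e - a) * sinpi b"
      using per_sum_Lagrange[OF balP, of a b "e - a - b"] by (simp add: P_def)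
    show "sinpi a * sinpi b * sinpi (a - b) * P (f - a - b) = P 0 * sinpi (f - b) * sinpi (f - a) * sinpi (a - b)
        - P (- b) * sinpi (f - a - b) * sinpi (f - b) * sinpi a + P (- a) * sinpi (f - a - b) * sinpi (f - a) * sinpi b"
      using per_sum_Lagrange[OF balP, of a b "f - a - b"] by (simp add: P_def)
  qed (use gamma_factor_antisym[OF bal] gamma_factor_product_form[OF bal] gamma_factor_product_form[OF bal'] gamma_factor_elimination[OF bal] in simp_all)
  have "of_real pi ^ 3 * (rGamma (1 + a - e) * rGamma (1 - b) * rGamma (g - b) * rGamma (1 + a - f)) * relation_lhs a b c d e f g =
     rGamma a * rGamma (g - c) * rGamma (g - d) *
     (sinpi (f - b) * gamma_factor a b c d f e g * (P (e - a - b) * sinpi b * sinpi (g - b) * sinpi (f - a) + P (- b) * sinpi (e - b) * sinpi (f - c) * sinpi (f - d)) -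
      sinpi (e - b) * gamma_factor a b c d e f g * (P (f - a - b) * sinpi b * sinpi (g - b) * sinpi (e - a) + P (- b) * sinpi (f - b) * sinpi (e - c) * sinpi (e - d)) +
     sinpi (f - e) * sinpi (e - a) * sinpi (f - a) * sinpi (g - b) *
       (P 0 * sinpi (g - a) * sinpi (f - b) * sinpi (e - b) + P (- a) * sinpi b * sinpi (g - c) * sinpi (g - d)))"
  proof -
    define S where "S = sinpi (f - e)"
    define G where "G = sinpi (f - b) * gamma_factor a b c d f e g"
    define G' where "G' = sinpi (e - b) * gamma_factor a b c d e f g"
    have sa: "sinpi a = of_real pi * (rGamma a * rGamma (1 - a))" by (rule sinpi_rGamma)
    have sc: "sinpi (g - c) = of_real pi * (rGamma (g - c) * rGamma (1 - (g - c)))" by (rule sinpi_rGamma)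
    have sd: "sinpi (g - d) = of_real pi * (rGamma (g - d) * rGamma (1 - (g - d)))" by (rule sinpi_rGamma)
    have se: "sinpi (e - a) = of_real pi * (rGamma (e - a) * rGamma (1 + a - e))"
      using sinpi_rGamma[of "e - a"] by (simp add: algebra_simps)
    have sf: "sinpi (f - a) = of_real pi * (rGamma (f - a) * rGamma (1 + a - f))"
      using sinpi_rGamma[of "f - a"] by (simp add: algebra_simps)
    have sg: "sinpi (g - b) = of_real pi * (rGamma (g - b) * rGamma (1 + b - g))"
      using sinpi_rGamma[of "g - b"] by (simp add: algebra_simps)
    \<comment> \<open>By reflection the sines of \<open>a\<close>, \<open>g - c\<close>,
      \<open>g - d\<close> supply the reciprocal Gammas missing for \<open>Y0\<close>, while the
      surplus ones combine to the sines of \<open>e - a\<close>, \<open>f - a\<close>,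
      \<open>g - b\<close>.\<close>
    have 0: "of_real pi ^ 3 * (rGamma (1 + a - e) * rGamma (1 - b) * rGamma (g - b) * rGamma (1 + a - f)) *
        (sinpi a * S * sinpi (g - c) * sinpi (g - d) *
       (rGamma (1 + b - e) * rGamma (e - a) * rGamma (1 + b - f) * rGamma (1 + b - g) * rGamma (g - a) * rGamma (f - a)) * Kf a b c d e f g) =
       rGamma a * rGamma (g - c) * rGamma (g - d) * (S * sinpi (e - a) * sinpi (f - a) * sinpi (g - b)) *
       (of_real pi ^ 3 * (rGamma (1 - a) * rGamma (1 - b) * rGamma (1 - (g - d)) * rGamma (1 - (g - c)) *
      rGamma (1 + b - f) * rGamma (1 + b - e) * rGamma (g - a)) * Kf a b c d e f g)"
      unfolding sa sc sd se sf sg by algebra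
    have 4: "of_real pi ^ 3 * (rGamma (1 + a - e) * rGamma (1 - b) * rGamma (g - b) * rGamma (1 + a - f)) *
        (G * (rGamma a * rGamma (1 + b - e) * rGamma (f - c) * rGamma (f - d) * rGamma (g - c) * rGamma (g - d)) * K4) =
       rGamma a * rGamma (g - c) * rGamma (g - d) * G * (of_real pi ^ 3 * (rGamma (1 + a - e) * rGamma (1 + b - e) * rGamma (f - c) * rGamma (f - d) *
      rGamma (1 - b) * rGamma (g - b) * rGamma (1 + a - f)) * K4)"
      by algebra
    have 8: "of_real pi ^ 3 * (rGamma (1 + a - e) * rGamma (1 - b) * rGamma (g - b) * rGamma (1 + a - f)) *
        (G' * (rGamma a * rGamma (1 + b - f) * rGamma (e - c) * rGamma (e - d) * rGamma (g - c) * rGamma (g - d)) * K8) =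
       rGamma a * rGamma (g - c) * rGamma (g - d) * G' * (of_real pi ^ 3 * (rGamma (1 + a - f) * rGamma (1 + b - f) * rGamma (e - c) * rGamma (e - d) *
      rGamma (1 - b) * rGamma (g - b) * rGamma (1 + a - e)) * K8)"
      by algebra
    show ?thesis
      unfolding relation_lhs_def K4_def[symmetric] K8_def[symmetric] S_def[symmetric] G_def[symmetric] G'_def[symmetric]
        right_diff_distrib distrib_left[of "of_real pi ^ 3 * _"] 0 4 8 Y0 Y4 Y8
      by algebra
  qed
  moreover have "sinpi (f - b) * gamma_factor a b c d f e g * (P (e - a - b) * sinpi b * sinpi (g - b) * sinpi (f - a) + P (- b) * sinpi (e - b) * sinpi (f - c) * sinpi (f - d)) -
      sinpi (e - b) * gamma_factor a b c d e f g * (P (f - a - b) * sinpi b * sinpi (g - b) * sinpi (e - a) + P (- b) * sinpi (f - b) * sinpi (e - c) * sinpi (e - d)) +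
     sinpi (f - e) * sinpi (e - a) * sinpi (f - a) * sinpi (g - b) *
       (P 0 * sinpi (g - a) * sinpi (f - b) * sinpi (e - b) + P (- a) * sinpi b * sinpi (g - c) * sinpi (g - d)) = 0"
    using comb nz by simp
  ultimately show ?thesis using M by simp
qed

lemma eventually_affine_notin_Ints:
  fixes p m :: complex
  assumes "m \<noteq> 0"
  shows "eventually (\<lambda>t. p + m * t \<notin> \<int>) (at 0)"
proof -
  \<comment> \<open>\<open>p\<close> itself may be an integer, so it is removed from the set to be
    avoided; the punctured neighbourhood takes care of it.\<close>
  have "closed (\<int> - {p})" by (rule closed_subset_Ints) auto
  then have "open (- (\<int> - {p}))" by (rule open_Compl)
  moreover have "((\<lambda>t. p + m * t) \<longlongrightarrow> p + m * 0) (at 0)" by (intro tendsto_intros)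
  ultimately have "eventually (\<lambda>t. p + m * t \<in> - (\<int> - {p})) (at 0)"
    by (intro topological_tendstoD) auto
  moreover have "eventually (\<lambda>t::complex. t \<noteq> 0) (at 0)" by (simp add: eventually_at_filter)
  ultimately show ?thesis by eventually_elim (use assms in auto)
qed

lemma rGamma_nonzero: "z \<notin> \<int> \<Longrightarrow> rGamma (z :: complex) \<noteq> 0"
  by (auto simp: rGamma_eq_zero_iff)

lemma holomorphic_sinpi: "f holomorphic_on A \<Longrightarrow> (\<lambda>t. sinpi (f t)) holomorphic_on A"
  unfolding sinpi_def by (intro holomorphic_intros)

lemma holomorphic_cospi: "f holomorphic_on A \<Longrightarrow> (\<lambda>t. cospi (f t)) holomorphic_on A"
  unfolding cospi_def by (intro holomorphic_intros)

text \<open>Along the chosen line none of the linear forms that must avoid the integers is constant.\<close>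

lemma relation_lhs_eq_0:
  assumes bal: "e + f + g - a - b - c - d = 1"
  shows "relation_lhs a b c d e f g = 0"
proof -
  \<comment> \<open>The weights satisfy 3 = 1 + 2, which preserves the balance condition.\<close>
  define L where "L t = relation_lhs (a + t) (b + 2 * t) c d e f (g + 3 * t)" for t
  have "L holomorphic_on UNIV"
    unfolding L_def[abs_def] relation_lhs_def gamma_factor_def
    by (intro holomorphic_intros holomorphic_sinpi holomorphic_cospi holomorphic_rGamma' Kf_holomorphic)
      (use bal in algebra)+
  then have "isCont L 0"
    by (metis UNIV_I holomorphic_on_imp_continuous_on continuous_on_eq_continuous_at open_UNIV)
  then have lim: "(L \<longlongrightarrow> L 0) (at 0)" by (simp add: isCont_def)
  have "eventually (\<lambda>t. a + 1 * t \<notin> \<int>) (at 0)" "eventually (\<lambda>t. b + 2 * t \<notin> \<int>) (at 0)"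
    "eventually (\<lambda>t. a - b + -1 * t \<notin> \<int>) (at 0)" "eventually (\<lambda>t. 1 + a - e + 1 * t \<notin> \<int>) (at 0)"
    "eventually (\<lambda>t. 1 - b + -2 * t \<notin> \<int>) (at 0)" "eventually (\<lambda>t. g - b + 1 * t \<notin> \<int>) (at 0)"
    "eventually (\<lambda>t. 1 + a - f + 1 * t \<notin> \<int>) (at 0)"
    by (rule eventually_affine_notin_Ints, simp)+
  then have ev: "eventually (\<lambda>t. L t = 0) (at 0)"
  proof eventually_elim
    case (elim t)
    have eqs: "a + t - (b + 2 * t) = a - b + -1 * t" "1 + (a + t) - e = 1 + a - e + 1 * t" "1 - (b + 2 * t) = 1 - b + -2 * t"
      "g + 3 * t - (b + 2 * t) = g - b + 1 * t" "1 + (a + t) - f = 1 + a - f + 1 * t"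
      by simp_all
    show ?case unfolding L_def
    proof (rule relation_lhs_generic)
      show "e + f + (g + 3 * t) - (a + t) - (b + 2 * t) - c - d = 1" using bal by algebra
      show "sinpi (a + t) \<noteq> 0" "sinpi (b + 2 * t) \<noteq> 0"
        using elim(1,2) by (simp_all add: sinpi_eq_0_iff)
      show "sinpi (a + t - (b + 2 * t)) \<noteq> 0"
        unfolding sinpi_eq_0_iff eqs(1) by (fact elim)
      show "rGamma (1 + (a + t) - e) \<noteq> 0" "rGamma (1 - (b + 2 * t)) \<noteq> 0" "rGamma (g + 3 * t - (b + 2 * t)) \<noteq> 0"
        "rGamma (1 + (a + t) - f) \<noteq> 0"
        unfolding eqs(2-5) by (rule rGamma_nonzero, fact elim)+
    qed
  qed
  have "(L \<longlongrightarrow> 0) (at 0)" using ev by (rule tendsto_eventually)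
  then have "L 0 = 0" using lim by (intro tendsto_unique[OF at_neq_bot])
  then show ?thesis by (simp add: L_def)
qed

section \<open>The continuous extension of gamma\<close>

definition gamma_ext :: "complex^7 \<Rightarrow> complex" where
  "gamma_ext x = sinpi (x$5 - x$2) * gamma_factor (x$1) (x$2) (x$3) (x$4) (x$5) (x$6) (x$7)"

lemma gamma_raw_eq:
  fixes x :: "complex^7"
  assumes "x \<in> V" "x$3 - x$2 \<notin> \<int>"
  shows "gamma_raw x = gamma_ext x"
proof -
  have "x$5 + x$6 + x$7 - x$1 - x$2 - x$3 - x$4 = 1" using assms by (simp add: V_def)
  note * = gamma_bracket[OF this]
  have "sinpi (x$3 - x$2) \<noteq> 0" using assms by (simp add: sinpi_eq_0_iff)
  then show ?thesis unfolding gamma_raw_def gamma_ext_def Let_def * by simp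
qed

text \<open>Makes the filter in the definition of \<open>gamma\<close> nontrivial, so that the
  \<open>Lim\<close> there is determined by convergence.\<close>

lemma islimpt_generic_V:
  fixes x :: "complex^7"
  assumes "x \<in> V"
  shows "x islimpt {y \<in> V. y$3 - y$2 \<notin> \<int>}"
  unfolding islimpt_approachable
proof (intro allI impI)
  fix \<epsilon> :: real assume \<epsilon>: "\<epsilon> > 0"
  \<comment> \<open>Raising \<open>c\<close> and \<open>e\<close> together stays in \<open>V\<close>
    and moves \<open>c - b\<close> off the integers.\<close>
  define w :: "complex^7" where "w = vector [0, 0, 1, 0, 1, 0, 0]"
  have "((\<lambda>t. x + t *s w) \<longlongrightarrow> x + 0 *s w) (at 0)"
    unfolding vector_scalar_mult_def by (intro tendsto_intros)
  then have "eventually (\<lambda>t. dist (x + t *s w) x < \<epsilon>) (at 0)"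
    using \<epsilon> by (auto dest: tendstoD)
  moreover have "eventually (\<lambda>t. x$3 - x$2 + 1 * t \<notin> \<int>) (at 0)"
    by (rule eventually_affine_notin_Ints) simp
  moreover have "eventually (\<lambda>t::complex. t \<noteq> 0) (at 0)" by (simp add: eventually_at_filter)
  ultimately have "eventually (\<lambda>t. dist (x + t *s w) x < \<epsilon> \<and> x$3 - x$2 + t \<notin> \<int> \<and> t \<noteq> 0) (at 0)"
    by eventually_elim simp
  then obtain t where t: "dist (x + t *s w) x < \<epsilon>" "x$3 - x$2 + t \<notin> \<int>" "t \<noteq> 0"
    using eventually_happens'[OF at_neq_bot] by blast
  have "x + t *s w \<in> V" using assms by (simp add: V_def w_def algebra_simps)
  moreover have "(x + t *s w)$3 - (x + t *s w)$2 \<notin> \<int>" using t(2) by (simp add: w_def algebra_simps)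
  moreover have "x + t *s w \<noteq> x"
  proof
    assume "x + t *s w = x"
    moreover have "(x + t *s w)$3 = x$3 + t" by (simp add: w_def)
    ultimately show False using t(3) by simp
  qed
  ultimately show "\<exists>x'\<in>{y \<in> V. y$3 - y$2 \<notin> \<int>}. x' \<noteq> x \<and> dist x' x < \<epsilon>"
    using t(1) by blast
qed

lemma gamma_eq:
  fixes x :: "complex^7"
  assumes "x \<in> V"
  shows "gamma x = gamma_ext x"
proof (cases "x$3 - x$2 \<in> \<int>")
  case False
  then show ?thesis using gamma_raw_eq[OF assms] by (simp add: gamma_def)
next
  case True
  let ?S = "{y \<in> V. y$3 - y$2 \<notin> \<int>}"
  have "(gamma_ext \<longlongrightarrow> gamma_ext x) (at x within ?S)"
    unfolding gamma_ext_def[abs_def] gamma_factor_def sinpi_def cospi_def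
    by (intro tendsto_intros tendsto_ident_at)+ simp_all
  moreover have "eventually (\<lambda>y. gamma_ext y = gamma_raw y) (at x within ?S)"
    by (auto simp: eventually_at_filter gamma_raw_eq)
  ultimately have "(gamma_raw \<longlongrightarrow> gamma_ext x) (at x within ?S)"
    by (rule Lim_transform_eventually)
  then have "Lim (at x within ?S) gamma_raw = gamma_ext x"
    using islimpt_generic_V[OF assms] by (intro tendsto_Lim) (simp_all add: trivial_limit_within)
  then show ?thesis using True by (simp add: gamma_def)
qed

lemma three_term_relation:
  fixes a b c d e f g :: complex
  defines "x \<equiv> vector [a, b, c, d, e, f, g] :: complex^7"
    and "x' \<equiv> vector [a, b, c, d, f, e, g] :: complex^7"
    and "\<sigma>x \<equiv> vector [1 + b - e, b, f - c, g - c, 1 + a + b - e, 1 + b - c, 1 + b + d - e] :: complex^7"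
  assumes x: "x \<in> V"
  shows "sinpi a * sinpi (f - e) * sinpi (g - c) * sinpi (g - d) * beta \<sigma>x * K_sub p0 x
     + gamma x' * beta x * K_sub n4 x - gamma x * beta x' * K_sub n8 x = 0"
proof -
  have bal: "e + f + g - a - b - c - d = 1" using x by (simp add: x_def V_def)
  then have g: "g = 1 + a + b + c + d - e - f" by algebra
  have x': "x' \<in> V" using x by (simp add: x_def x'_def V_def algebra_simps)
  have r: "1 + b - (1 + a + b - e) = e - a" "1 + b - c - (f - c) = 1 + b - f" "1 + b - c - (g - c) = 1 + b - g"
    "1 + b + d - e - (f - c) = g - a" "1 + b + d - e - (g - c) = f - a"
    unfolding g by simp_all
  have beta: "beta \<sigma>x = rGamma (1 + b - e) * rGamma (e - a) * rGamma (1 + b - f) * rGamma (1 + b - g) * rGamma (g - a) * rGamma (f - a)"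
    by (simp add: beta_def \<sigma>x_def Let_def r)
  have K: "K_sub p0 x = Kf a b c d e f g"
    "K_sub n4 x = Kf (e - a) (e - b) (e - c) (e - d) (1 + e - f) (1 + e - g) e"
    "K_sub n8 x = Kf (f - a) (f - b) (f - c) (f - d) (1 + f - g) f (1 + f - e)"
    using n4_spec(2)[of a b c d e f g] n8_spec(2)[of a b c d e f g] x
    by (simp_all add: K_sub_def p0_eq act_one x_def K_eq_Kf)
  show ?thesis
    using relation_lhs_eq_0[OF bal] unfolding beta K gamma_eq[OF x] gamma_eq[OF x']
    by (simp add: relation_lhs_def gamma_ext_def beta_def x_def x'_def)
qed

section \<open>Matrices of \<open>n4\<close> and \<open>n8\<close> and the Hamming type\<close>

text \<open>On \<open>V\<close> the constant \<open>1\<close> in \<open>n4\<close> and \<open>n8\<close> is the linear form \<open>e + f + g - a - b - c - d\<close>.\<close>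

definition n4_matrix :: "real^7^7" where
  "n4_matrix = vector
     [vector [-1, 0, 0, 0, 1, 0, 0],
      vector [0, -1, 0, 0, 1, 0, 0],
      vector [0, 0, -1, 0, 1, 0, 0],
      vector [0, 0, 0, -1, 1, 0, 0],
      vector [-1, -1, -1, -1, 2, 0, 1],
      vector [-1, -1, -1, -1, 2, 1, 0],
      vector [0, 0, 0, 0, 1, 0, 0]]"

definition n8_matrix :: "real^7^7" where
  "n8_matrix = vector
     [vector [-1, 0, 0, 0, 0, 1, 0],
      vector [0, -1, 0, 0, 0, 1, 0],
      vector [0, 0, -1, 0, 0, 1, 0],
      vector [0, 0, 0, -1, 0, 1, 0],
      vector [-1, -1, -1, -1, 1, 2, 0],
      vector [0, 0, 0, 0, 0, 1, 0],
      vector [-1, -1, -1, -1, 0, 2, 1]]"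

lemma vector_7_eta: "vector [x$1, x$2, x$3, x$4, x$5, x$6, x$7] = (x :: 'a::zero^7)"
  by (simp add: vec_eq_iff forall_7)

lemma n4_eq: "n4 = n4_matrix"
proof (rule act_eq_on_V, rule ballI)
  fix x :: "complex^7" assume x: "x \<in> V"
  then have e: "x$7 = 1 + x$1 + x$2 + x$3 + x$4 - x$5 - x$6" by (simp add: V_def algebra_simps)
  have "act n4 x = vector [x$5 - x$1, x$5 - x$2, x$5 - x$3, x$5 - x$4, 1 + x$5 - x$6, 1 + x$5 - x$7, x$5]"
    using n4_spec(2)[of "x$1" "x$2" "x$3" "x$4" "x$5" "x$6" "x$7"] x unfolding vector_7_eta by simp
  also have "\<dots> = act n4_matrix x"
    by (simp add: vec_eq_iff forall_7 act_def matrix_vector_mult_def sum_7 n4_matrix_def)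
      (simp add: e)
  finally show "act n4 x = act n4_matrix x" .
qed

lemma n8_eq: "n8 = n8_matrix"
proof (rule act_eq_on_V, rule ballI)
  fix x :: "complex^7" assume x: "x \<in> V"
  then have e: "x$7 = 1 + x$1 + x$2 + x$3 + x$4 - x$5 - x$6" by (simp add: V_def algebra_simps)
  have "act n8 x = vector [x$6 - x$1, x$6 - x$2, x$6 - x$3, x$6 - x$4, 1 + x$6 - x$7, x$6, 1 + x$6 - x$5]"
    using n8_spec(2)[of "x$1" "x$2" "x$3" "x$4" "x$5" "x$6" "x$7"] x unfolding vector_7_eta by simp
  also have "\<dots> = act n8_matrix x"
    by (simp add: vec_eq_iff forall_7 act_def matrix_vector_mult_def sum_7 n8_matrix_def)
      (simp add: e)
  finally show "act n8 x = act n8_matrix x" .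
qed

lemma matrix_inv_mult_eqI:
  fixes A :: "real^'n^'n"
  assumes "invertible A" "A *v v = w"
  shows "matrix_inv A *v w = v"
proof -
  have "matrix_inv A ** A = mat 1"
    using assms(1) unfolding invertible_def matrix_inv_def by (rule someI2_ex) simp
  then show ?thesis
    unfolding assms(2)[symmetric] by (simp add: matrix_vector_mul_assoc)
qed

text \<open>Exhibiting a preimage of \<open>omega0\<close> replaces the computation of a matrix
  inverse.\<close>

lemma theta_inv_omega0:
  assumes A: "A \<in> M_K" and v: "(theta_Q ** A ** theta_R) *v v = omega0"
  shows "matrix_inv (theta A) *v omega0 = v"
proof (rule matrix_inv_mult_eqI)
  show "invertible (theta A)"
    using is_theta_theta A by (auto simp: is_theta_def hom_def)
  show "theta A *v v = omega0" using v A by (simp add: theta_eq)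
qed

lemma hamming_type_244: "hamming_type p0 n4 n8 = [2, 4, 4]"
proof -
  have p: "matrix_inv (theta p0) *v omega0 = omega0"
    by (rule theta_inv_omega0)
      (use subgroup.one_closed[OF M_K_subgroup] in \<open>simp_all add: p0_eq theta_QR\<close>)
  \<comment> \<open>\<open>theta\<close> takes values in signed permutation matrices, so the
    preimage of \<open>omega0\<close> lists the signs of the columns.\<close>
  have 4: "matrix_inv (theta n4) *v omega0 = vector [-1, -1, -1, -1, 1, 1]"
    by (rule theta_inv_omega0[OF n4_spec(1)])
      (simp add: n4_eq vec_eq_iff forall_6 matrix_vector_mult_def matrix_matrix_mult_def sum_6 sum_7 theta_Q_def theta_R_def n4_matrix_def omega0_def)
  have 8: "matrix_inv (theta n8) *v omega0 = vector [-1, -1, -1, 1, -1, 1]"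
    by (rule theta_inv_omega0[OF n8_spec(1)])
      (simp add: n8_eq vec_eq_iff forall_6 matrix_vector_mult_def matrix_matrix_mult_def sum_6 sum_7 theta_Q_def theta_R_def n8_matrix_def omega0_def)
  have C: "card {i :: 6. Q i} = (\<Sum>i\<in>UNIV. if Q i then 1 else 0)" for Q
    by (simp add: sum.If_cases)
  have "hamming_dist p0 n4 = 4" "hamming_dist p0 n8 = 4" "hamming_dist n4 n8 = 2"
    unfolding hamming_dist_def p 4 8 C sum_6 by (simp_all add: omega0_def)
  then show ?thesis by (simp add: hamming_type_def)
qed

theorem proposition6p5:
  shows "(\<forall>a b c d e f g :: complex.
            let x = vector [a, b, c, d, e, f, g] :: complex^7;
                x' = vector [a, b, c, d, f, e, g] :: complex^7;
                \<sigma>x = vector [1 + b - e, b, f - c, g - c, 1 + a + b - e, 1 + b - c, 1 + b + d - e] :: complex^7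
            in x \<in> V \<longrightarrow>
               sinpi a * sinpi (f - e) * sinpi (g - c) * sinpi (g - d) * beta \<sigma>x * K_sub p0 x
               + gamma x' * beta x * K_sub n4 x
               - gamma x * beta x' * K_sub n8 x = 0)
         \<and> hamming_type p0 n4 n8 = [2, 4, 4]"
  using three_term_relation hamming_type_244 by (simp add: Let_def)

end
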